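(* Let $A$ be a locally closed subset of a reduced complex space $X$ on which a strictly plurisubharmonic function $\rho$ is defined. Then the following properties are equivalent: a) $A$ is set-theoretically weakly $1$-pseudoconcave. b) For any domain $D\Subset A$, we have $$\max_{p\in\overline D}|u(p)|=\max_{p\in\partial_A D}|u(p)|\qquad\text{for all } u\in\tilde{\mathscr{O}}_A(D)\cap\mathcal{C}(\overline D).$$ c) There is an ordinal $\alpha\ge0$ such that for any domain $D\Subset A$, we have $$\max_{p\in\overline D}|u(p)|=\max_{p\in\partial_A D}|u(p)|\qquad\text{for all } u\in\mathscr{O}_{A,\alpha}(D)\cap\mathcal{C}(\overline D).$$
   Context: Complex spaces are Hausdorff, and $X$ is a reduced complex space of pure dimension. A strictly plurisubharmonic function on $X$ is a real valued function which, locally in embeddings of open pieces of $X$ as analytic subvarieties of open sets of $\mathbb{C}^N$, is the restriction of a $\mathcal{C}^2$ strictly plurisubharmonic function. $D\Subset A$ means that $D$ is relatively compact in $A$; domains $D$ are taken in the subspace topology of $A$, $\partial_A D$ is the boundary of $D$ in $A$ and $\overline D$ its closure. Pseudoconcavity. Let $q$ be a positive integer, $p\in A$. $A$ is set-theoretically $q$-pseudoconvex at $p$ if there are an open neighbourhood $\omega_p$ of $p$ in $X$, an isomorphism $z$ of $\omega_p$ onto a local model $Z$ (a closed analytic subvariety of an open set $U\subset\mathbb{C}^N$, with its reduced structure), a function $\varphi\in\mathcal{C}^\infty(U,\mathbb{R})$ and an open set $\omega'_p$ with $p\in\omega'_p\subseteq\omega_p$ such that $z(A\cap\omega'_p)\subseteq\{\varphi\le\varphi(z(p))\}$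 and the complex Hessian $(\partial^2\varphi/\partial z_i\partial\bar z_j)$ at $z(p)$ has at least $N-q+1$ positive eigenvalues. (This does not depend on the choice of the local model.) $A$ is set-theoretically weakly $q$-pseudoconcave if it is not set-theoretically $q$-pseudoconvex at any $p\in A$. LACR functions. $\mathcal{C}_A$ is the sheaf of germs of continuous complex valued functions on $A$. $\mathscr{O}_A\subseteq\mathcal{C}_A$ is the subsheaf of germs of functions that are, near each point, restrictions to $A$ of holomorphic functions on open subsets of $X$. For a set $\mathcal{H}$ of germs of continuous functions on $A$ and $U$ open in $A$, $\mathcal{H}(U)$ is the set of continuous functions on $U$ all of whose germs belong to $\mathcal{H}$; $\mathcal{H}^c$ is the set of germs $f_{(x)}$ having, on some open neighbourhood $U_x$ of $x$ in $A$, a representative which is the limit, uniformly on compact subsets of $U_x$, of a sequence in $\mathcal{H}(U_x)$. $\mathcal{H}^{(c)}$ is the smallest set of germs that contains $\mathcal{H}$ and is stable under the operation $\mathcal{H}\mapsto\mathcal{H}^c$. Set $\mathscr{O}_{A,0}=\mathscr{O}_A$ and, for ordinals $\alpha>0$, $\mathscr{O}_{A,\alpha}=\big(\bigcup_{\beta<\alpha}\mathscr{O}_{A,\beta}\big)^c$. The sheaf of LACR (locally approximable continuous CR) functions is $\tilde{\mathscr{O}}_A=\mathscr{O}_A^{(c)}$, which equals $\mathscr{O}_{A,\alpha}$ for all sufficiently large $\alpha$.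
   Formalization: Domains D are arbitrary nonempty relatively open, relatively compact subsets of A, not necessarily connected: with connected domains the claim fails for a Cantor set A in the complex plane; an empty boundary counts as failure of the maximum equality. *)

theory Defs
  imports "HOL-Analysis.Analysis" "Jordan_Normal_Form.Char_Poly"
begin

section \<open>Calculus on \<open>\<complex>\<^sup>N\<close>\<close>

text \<open>
  The embedding dimension \<open>N\<close> varies from chart to chart, so it cannot be a type index.  As with
  \<^const>\<open>Euclidean_space\<close>, points of \<open>\<complex>\<^sup>N\<close> are the sequences that vanish from index \<open>N\<close> on; the
  coordinates are those with index below \<open>N\<close>.
\<close>

definition Cspace :: "nat \<Rightarrow> (nat \<Rightarrow> complex) topology" where
  "Cspace N = subtopology (product_topology (\<lambda>_. euclidean) UNIV) {z. \<forall>i\<ge>N. z i = 0}"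

text \<open>
  Derivative along the real line in direction \<open>c\<close> of the \<open>i\<close>-th coordinate: with
  \<open>z\<^sub>i = x\<^sub>i + \<i> y\<^sub>i\<close>, the value \<open>c = 1\<close> gives \<open>\<partial>/\<partial>x\<^sub>i\<close> and \<open>c = \<i>\<close> gives \<open>\<partial>/\<partial>y\<^sub>i\<close>.
\<close>

definition coord_line :: "nat \<Rightarrow> complex \<Rightarrow> (nat \<Rightarrow> complex) \<Rightarrow> real \<Rightarrow> nat \<Rightarrow> complex" where
  "coord_line i c z t = z(i := z i + of_real t * c)"

definition partial_deriv ::
    "nat \<Rightarrow> complex \<Rightarrow> ((nat \<Rightarrow> complex) \<Rightarrow> 'b::real_normed_vector) \<Rightarrow> (nat \<Rightarrow> complex) \<Rightarrow> 'b" where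
  "partial_deriv i c f z = vector_derivative (\<lambda>t. f (coord_line i c z t)) (at 0)"

primrec Ck_on ::
    "nat \<Rightarrow> nat \<Rightarrow> (nat \<Rightarrow> complex) set \<Rightarrow> ((nat \<Rightarrow> complex) \<Rightarrow> 'b::real_normed_vector) \<Rightarrow> bool" where
  "Ck_on 0 N U f \<longleftrightarrow> continuous_map (subtopology (Cspace N) U) euclidean f"
| "Ck_on (Suc k) N U f \<longleftrightarrow>
     continuous_map (subtopology (Cspace N) U) euclidean f \<and>
     (\<forall>i<N. \<forall>c\<in>{1, \<i>}.
        (\<forall>z\<in>U. (\<lambda>t. f (coord_line i c z t)) differentiable (at 0)) \<and>
        Ck_on k N U (partial_deriv i c f))"

definition Cinf_on ::
    "nat \<Rightarrow> (nat \<Rightarrow> complex) set \<Rightarrow> ((nat \<Rightarrow> complex) \<Rightarrow> 'b::real_normed_vector) \<Rightarrow> bool" where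
  "Cinf_on N U f \<longleftrightarrow> (\<forall>k. Ck_on k N U f)"

definition d_dz ::
    "nat \<Rightarrow> ((nat \<Rightarrow> complex) \<Rightarrow> complex) \<Rightarrow> (nat \<Rightarrow> complex) \<Rightarrow> complex" where
  "d_dz i f z = (partial_deriv i 1 f z - \<i> * partial_deriv i \<i> f z) / 2"

definition d_dzbar ::
    "nat \<Rightarrow> ((nat \<Rightarrow> complex) \<Rightarrow> complex) \<Rightarrow> (nat \<Rightarrow> complex) \<Rightarrow> complex" where
  "d_dzbar i f z = (partial_deriv i 1 f z + \<i> * partial_deriv i \<i> f z) / 2"

definition complex_hessian ::
    "nat \<Rightarrow> ((nat \<Rightarrow> complex) \<Rightarrow> real) \<Rightarrow> (nat \<Rightarrow> complex) \<Rightarrow> complex mat" where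
  "complex_hessian N \<phi> z =
     mat N N (\<lambda>(i, j). d_dz i (d_dzbar j (\<lambda>w. complex_of_real (\<phi> w))) z)"

definition num_pos_eigenvalues :: "complex mat \<Rightarrow> nat" where
  "num_pos_eigenvalues M =
     (\<Sum>l | 0 < l \<and> eigenvalue M (complex_of_real l). order (complex_of_real l) (char_poly M))"

definition strictly_psh_on ::
    "nat \<Rightarrow> (nat \<Rightarrow> complex) set \<Rightarrow> ((nat \<Rightarrow> complex) \<Rightarrow> real) \<Rightarrow> bool" where
  "strictly_psh_on N U \<psi> \<longleftrightarrow> Ck_on 2 N U \<psi> \<and>
     (\<forall>z\<in>U. \<forall>w. (\<exists>i<N. w i \<noteq> 0) \<longrightarrow>
        0 < Re (\<Sum>i<N. \<Sum>j<N. complex_hessian N \<psi> z $$ (i, j) * w i * cnj (w j)))"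

text \<open>Holomorphic in several variables: continuous and holomorphic in each variable separately.\<close>

definition holo_on :: "nat \<Rightarrow> (nat \<Rightarrow> complex) set \<Rightarrow> ((nat \<Rightarrow> complex) \<Rightarrow> complex) \<Rightarrow> bool" where
  "holo_on N U f \<longleftrightarrow> continuous_map (subtopology (Cspace N) U) euclidean f \<and>
     (\<forall>z\<in>U. \<forall>i<N. (\<lambda>t. f (z(i := t))) field_differentiable (at (z i)))"


section \<open>Reduced complex spaces\<close>

text \<open>Closedness of \<open>Z\<close> in \<open>U\<close> follows, as the condition is imposed at every point of \<open>U\<close>.\<close>

definition analytic_subvariety ::
    "nat \<Rightarrow> (nat \<Rightarrow> complex) set \<Rightarrow> (nat \<Rightarrow> complex) set \<Rightarrow> bool" where
  "analytic_subvariety N U Z \<longleftrightarrow> Z \<subseteq> U \<and>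
     (\<forall>a\<in>U. \<exists>W F. openin (Cspace N) W \<and> a \<in> W \<and> W \<subseteq> U \<and> finite F \<and>
        (\<forall>f\<in>F. holo_on N W f) \<and> Z \<inter> W = {w \<in> W. \<forall>f\<in>F. f w = 0})"

text \<open>Sections over \<open>W\<close> of the reduced structure sheaf of a subvariety containing \<open>W\<close>:\<close>

definition model_sections ::
    "nat \<Rightarrow> (nat \<Rightarrow> complex) set \<Rightarrow> ((nat \<Rightarrow> complex) \<Rightarrow> complex) set" where
  "model_sections N W =
     {g. \<forall>a\<in>W. \<exists>V G. openin (Cspace N) V \<and> a \<in> V \<and> holo_on N V G \<and> (\<forall>w\<in>V \<inter> W. g w = G w)}"

text \<open>
  A reduced complex space is a topological space \<open>X\<close> with a subsheaf \<open>\<O>\<close> of the sheaf of continuous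
  functions, locally isomorphic to reduced local models.  Sections over \<open>V\<close> are total functions of
  which only the values on \<open>V\<close> matter.
\<close>

type_synonym 'a structure_sheaf = "'a set \<Rightarrow> ('a \<Rightarrow> complex) set"

definition subsheaf_of_continuous :: "'a topology \<Rightarrow> 'a structure_sheaf \<Rightarrow> bool" where
  "subsheaf_of_continuous X \<O> \<longleftrightarrow>
     (\<forall>V f. openin X V \<and> f \<in> \<O> V \<longrightarrow> continuous_map (subtopology X V) euclidean f) \<and>
     (\<forall>V f g. openin X V \<and> f \<in> \<O> V \<and> (\<forall>x\<in>V. g x = f x) \<longrightarrow> g \<in> \<O> V) \<and>
     (\<forall>V W f. openin X V \<and> openin X W \<and> W \<subseteq> V \<and> f \<in> \<O> V \<longrightarrow> f \<in> \<O> W) \<and>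
     (\<forall>V f. openin X V \<and> (\<forall>x\<in>V. \<exists>W. openin X W \<and> x \<in> W \<and> W \<subseteq> V \<and> f \<in> \<O> W) \<longrightarrow> f \<in> \<O> V)"

text \<open>\<open>z\<close> is an isomorphism of the open subspace \<open>\<omega>\<close> of \<open>X\<close> onto the local model \<open>Z \<subseteq> U \<subseteq> \<complex>\<^sup>N\<close>:\<close>

definition local_embedding ::
    "'a topology \<Rightarrow> 'a structure_sheaf \<Rightarrow> 'a set \<Rightarrow> nat \<Rightarrow> (nat \<Rightarrow> complex) set \<Rightarrow>
     (nat \<Rightarrow> complex) set \<Rightarrow> ('a \<Rightarrow> nat \<Rightarrow> complex) \<Rightarrow> bool" where
  "local_embedding X \<O> \<omega> N U Z z \<longleftrightarrow>
     openin X \<omega> \<and> openin (Cspace N) U \<and> analytic_subvariety N U Z \<and>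
     homeomorphic_map (subtopology X \<omega>) (subtopology (Cspace N) Z) z \<and>
     (\<forall>V f. openin X V \<and> V \<subseteq> \<omega> \<longrightarrow>
        (f \<in> \<O> V \<longleftrightarrow> (\<exists>g\<in>model_sections N (z ` V). \<forall>x\<in>V. f x = g (z x))))"

definition reduced_complex_space :: "'a topology \<Rightarrow> 'a structure_sheaf \<Rightarrow> bool" where
  "reduced_complex_space X \<O> \<longleftrightarrow> Hausdorff_space X \<and> subsheaf_of_continuous X \<O> \<and>
     (\<forall>p\<in>topspace X. \<exists>\<omega> N U Z z. p \<in> \<omega> \<and> local_embedding X \<O> \<omega> N U Z z)"

text \<open>Here the local model is all of \<open>U\<close>, so \<open>p\<close> is a manifold point of dimension \<open>n\<close>.\<close>

definition regular_point :: "'a topology \<Rightarrow> 'a structure_sheaf \<Rightarrow> nat \<Rightarrow> 'a \<Rightarrow> bool" where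
  "regular_point X \<O> n p \<longleftrightarrow> (\<exists>\<omega> U z. p \<in> \<omega> \<and> local_embedding X \<O> \<omega> n U U z)"

text \<open>
  The local dimension at \<open>p\<close> is the upper limit of the dimensions of the regular points
  near \<open>p\<close>, that is, the largest dimension occurring in every neighbourhood of \<open>p\<close>.
\<close>

definition has_local_dimension :: "'a topology \<Rightarrow> 'a structure_sheaf \<Rightarrow> 'a \<Rightarrow> nat \<Rightarrow> bool" where
  "has_local_dimension X \<O> p n \<longleftrightarrow>
     (let dims = {m. \<forall>W. openin X W \<and> p \<in> W \<longrightarrow> (\<exists>x\<in>W. regular_point X \<O> m x)}
      in n \<in> dims \<and> (\<forall>m\<in>dims. m \<le> n))"

definition pure_dimensional :: "'a topology \<Rightarrow> 'a structure_sheaf \<Rightarrow> bool" where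
  "pure_dimensional X \<O> \<longleftrightarrow> (\<exists>n. \<forall>p\<in>topspace X. has_local_dimension X \<O> p n)"

definition strictly_psh_function ::
    "'a topology \<Rightarrow> 'a structure_sheaf \<Rightarrow> ('a \<Rightarrow> real) \<Rightarrow> bool" where
  "strictly_psh_function X \<O> \<rho> \<longleftrightarrow>
     (\<forall>p\<in>topspace X. \<exists>\<omega> N U Z z \<psi>. p \<in> \<omega> \<and> local_embedding X \<O> \<omega> N U Z z \<and>
        strictly_psh_on N U \<psi> \<and> (\<forall>x\<in>\<omega>. \<rho> x = \<psi> (z x)))"

definition locally_closed_in :: "'a topology \<Rightarrow> 'a set \<Rightarrow> bool" where
  "locally_closed_in X A \<longleftrightarrow> (\<exists>S T. openin X S \<and> closedin X T \<and> A = S \<inter> T)"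


section \<open>Set-theoretic weak pseudoconcavity\<close>

text \<open>The eigenvalue count \<open>N - q + 1 \<le> \<dots>\<close> is rearranged to avoid truncated subtraction.\<close>

definition set_q_pseudoconvex_at ::
    "'a topology \<Rightarrow> 'a structure_sheaf \<Rightarrow> nat \<Rightarrow> 'a set \<Rightarrow> 'a \<Rightarrow> bool" where
  "set_q_pseudoconvex_at X \<O> q A p \<longleftrightarrow>
     (\<exists>\<omega> N U Z z \<phi> \<omega>'. p \<in> \<omega> \<and> local_embedding X \<O> \<omega> N U Z z \<and>
        Cinf_on N U (\<phi> :: (nat \<Rightarrow> complex) \<Rightarrow> real) \<and>
        openin X \<omega>' \<and> p \<in> \<omega>' \<and> \<omega>' \<subseteq> \<omega> \<and>
        (\<forall>x\<in>A \<inter> \<omega>'. \<phi> (z x) \<le> \<phi> (z p)) \<and>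
        N + 1 \<le> num_pos_eigenvalues (complex_hessian N \<phi> (z p)) + q)"

definition set_weakly_q_pseudoconcave ::
    "'a topology \<Rightarrow> 'a structure_sheaf \<Rightarrow> nat \<Rightarrow> 'a set \<Rightarrow> bool" where
  "set_weakly_q_pseudoconcave X \<O> q A \<longleftrightarrow> (\<forall>p\<in>A. \<not> set_q_pseudoconvex_at X \<O> q A p)"


section \<open>LACR functions\<close>

text \<open>
  A germ on \<open>A\<close> is its base point together with the class of all functions that agree on a
  neighbourhood of that point in \<open>A\<close>.
\<close>

type_synonym 'a germ = "'a \<times> ('a \<Rightarrow> complex) set"

definition germ :: "'a topology \<Rightarrow> 'a set \<Rightarrow> 'a \<Rightarrow> ('a \<Rightarrow> complex) \<Rightarrow> 'a germ" where
  "germ X A x f = (x, {g. \<exists>W. openin (subtopology X A) W \<and> x \<in> W \<and> (\<forall>y\<in>W. g y = f y)})"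

definition continuous_germs :: "'a topology \<Rightarrow> 'a set \<Rightarrow> 'a germ set" where
  "continuous_germs X A = {germ X A x f | x f W.
     openin (subtopology X A) W \<and> x \<in> W \<and> continuous_map (subtopology X W) euclidean f}"

definition holomorphic_germs :: "'a topology \<Rightarrow> 'a structure_sheaf \<Rightarrow> 'a set \<Rightarrow> 'a germ set" where
  "holomorphic_germs X \<O> A =
     {germ X A x F | x F V. x \<in> A \<and> openin X V \<and> x \<in> V \<and> F \<in> \<O> V}"

definition germ_sections ::
    "'a topology \<Rightarrow> 'a set \<Rightarrow> 'a germ set \<Rightarrow> 'a set \<Rightarrow> ('a \<Rightarrow> complex) set" where
  "germ_sections X A H U =
     {f. continuous_map (subtopology X U) euclidean f \<and> (\<forall>x\<in>U. germ X A x f \<in> H)}"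

text \<open>The operation \<open>H \<mapsto> H\<^sup>c\<close>:\<close>

definition germ_closure :: "'a topology \<Rightarrow> 'a set \<Rightarrow> 'a germ set \<Rightarrow> 'a germ set" where
  "germ_closure X A H = {germ X A x f | x f U s.
     openin (subtopology X A) U \<and> x \<in> U \<and>
     continuous_map (subtopology X U) euclidean f \<and>
     (\<forall>n::nat. s n \<in> germ_sections X A H U) \<and>
     (\<forall>K. compactin X K \<and> K \<subseteq> U \<longrightarrow> uniform_limit K s f sequentially)}"

text \<open>The germs \<open>H\<^sup>(\<^sup>c\<^sup>)\<close>:\<close>

definition germ_hull :: "'a topology \<Rightarrow> 'a set \<Rightarrow> 'a germ set \<Rightarrow> 'a germ set" where
  "germ_hull X A H =
     \<Inter>{G. G \<subseteq> continuous_germs X A \<and> H \<subseteq> G \<and> germ_closure X A G \<subseteq> G}"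

definition LACR :: "'a topology \<Rightarrow> 'a structure_sheaf \<Rightarrow> 'a set \<Rightarrow> 'a germ set" where
  "LACR X \<O> A = germ_hull X A (holomorphic_germs X \<O> A)"

text \<open>
  Ordinals are represented by well-orders \<open>r\<close>.  The ordinals below the order type of \<open>r\<close>
  are the order types of the initial segments \<^term>\<open>underS r x\<close> for \<open>x\<close> in the field of \<open>r\<close>, and
  \<open>LACR_below X \<O> A r x\<close> is \<open>\<O>\<^bsub>A,\<beta>\<^esub>\<close> for \<open>\<beta>\<close> the order type of \<^term>\<open>underS r x\<close>.
\<close>

definition LACR_below ::
    "'a topology \<Rightarrow> 'a structure_sheaf \<Rightarrow> 'a set \<Rightarrow> 'o rel \<Rightarrow> 'o \<Rightarrow> 'a germ set" where
  "LACR_below X \<O> A r = wo_rel.worec r (\<lambda>h x.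
     if underS r x = {} then holomorphic_germs X \<O> A
     else germ_closure X A (\<Union>y\<in>underS r x. h y))"

definition LACR_stage ::
    "'a topology \<Rightarrow> 'a structure_sheaf \<Rightarrow> 'a set \<Rightarrow> 'o rel \<Rightarrow> 'a germ set" where
  "LACR_stage X \<O> A r =
     (if Field r = {} then holomorphic_germs X \<O> A
      else germ_closure X A (\<Union>x\<in>Field r. LACR_below X \<O> A r x))"

lemma LACR_below_unfold:
  fixes r :: "'o rel" and X :: "'a topology"
  assumes "Well_order r"
  shows "LACR_below X \<O> A r x =
    (if underS r x = {} then holomorphic_germs X \<O> A
     else germ_closure X A (\<Union>y\<in>underS r x. LACR_below X \<O> A r y))"
proof -
  interpret wo_rel r using assms by (simp add: wo_rel_def)
  let ?F = "\<lambda>h x. if Order_Relation.underS r x = {} then holomorphic_germs X \<O> A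
     else germ_closure X A (\<Union>y\<in>Order_Relation.underS r x. h y)"
  have "adm_wo ?F" unfolding adm_wo_def
  proof (intro allI impI)
    fix f g :: "'o \<Rightarrow> 'a germ set" and x
    assume "\<forall>y\<in>Order_Relation.underS r x. f y = g y"
    then have "(\<Union>y\<in>Order_Relation.underS r x. f y) = (\<Union>y\<in>Order_Relation.underS r x. g y)"
      by (intro SUP_cong refl) blast
    then show "?F f x = ?F g x" by (simp only:)
  qed
  from fun_cong[OF worec_fixpoint[OF this], of x]
  show ?thesis unfolding LACR_below_def .
qed


section \<open>The maximum principle\<close>

definition is_max_on :: "('a \<Rightarrow> real) \<Rightarrow> 'a set \<Rightarrow> real \<Rightarrow> bool" where
  "is_max_on f S m \<longleftrightarrow> (\<exists>p\<in>S. f p = m) \<and> (\<forall>p\<in>S. f p \<le> m)"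

text \<open>
  Domains are nonempty relatively open subsets of \<open>A\<close>.  They are not required to be connected: a
  locally closed set such as a Cantor set may have no connected open subset at all.
\<close>

definition rel_compact_domain :: "'a topology \<Rightarrow> 'a set \<Rightarrow> 'a set \<Rightarrow> bool" where
  "rel_compact_domain X A D \<longleftrightarrow> D \<noteq> {} \<and> openin (subtopology X A) D \<and>
     compactin (subtopology X A) ((subtopology X A) closure_of D)"

text \<open>
  Both maxima have to exist, so the principle fails if some domain \<open>D\<close> has empty boundary in \<open>A\<close>
  (and a section such as a constant exists).
\<close>

definition maximum_principle :: "'a topology \<Rightarrow> 'a set \<Rightarrow> 'a germ set \<Rightarrow> bool" where
  "maximum_principle X A H \<longleftrightarrow>
     (\<forall>D u. rel_compact_domain X A D \<and> u \<in> germ_sections X A H D \<and>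
        continuous_map (subtopology X ((subtopology X A) closure_of D)) euclidean u \<longrightarrow>
        (\<exists>m. is_max_on (\<lambda>p. cmod (u p)) ((subtopology X A) closure_of D) m \<and>
             is_max_on (\<lambda>p. cmod (u p)) ((subtopology X A) frontier_of D) m))"

end

theory Submission
  imports Defs "HOL-Complex_Analysis.Complex_Analysis"
begin

text \<open>
  Call \<open>p\<close> a peak of a continuous function \<open>f\<close> on \<open>A\<close> if, in some chart \<open>z\<close>, the function
  \<open>|f|\<^sup>2 + Re h(z) + c |z|\<^sup>2\<close> has a local maximum on \<open>A\<close> at \<open>p\<close> for some holomorphic \<open>h\<close> and \<open>c > 0\<close>.
  By Taylor expansion every \<open>C\<^sup>2\<close> function with positive definite Levi form at a point is bounded
  below near it, with equality at the point, by some \<open>Re h + c |z|\<^sup>2\<close>.  Hence \<open>A\<close> is set-theoretically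
  \<open>1\<close>-pseudoconvex at \<open>p\<close> iff the zero function has a peak at \<open>p\<close>, and this also holds as soon as
  some holomorphic function has a peak at \<open>p\<close>.

  If no such point exists, holomorphic germs have no peaks.  A peak becomes strict after subtracting
  \<open>\<delta> |z - z(p)|\<^sup>2\<close>, so it persists, at a nearby point, under uniform approximation; thus having no
  peaks is stable under the closure operation and no LACR function has a peak.  A section \<open>u\<close> whose modulus
  is larger inside \<open>D\<close> than on the boundary would have one, at a maximum of \<open>|u|\<^sup>2 + \<epsilon> \<rho>\<close>.

  Conversely, from a peak of the zero function at \<open>p\<close> one gets a holomorphic \<open>k\<close> with
  \<open>Re k(z) \<le> Re k(z(p)) - c |z - z(p)|\<^sup>2\<close> on \<open>A\<close> near \<open>p\<close>, and \<open>exp k\<close> violates the maximum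
  principle on small neighbourhoods of \<open>p\<close>, already among the germs of \<open>\<O>\<^sub>A\<close>, which all stages contain.
\<close>

section \<open>Several complex variables in coordinates\<close>

text \<open>Two regularity classes have to meet: pseudoconvexity is tested with C-infinity functions
  on charts, whereas \<rho> is only C^2 there. The functions Re h + c |z|^2 bridge them: they are
  smooth and have complex Hessian c times the identity, so all N eigenvalues are positive. The
  family also survives recentring: |z - a|^2 and |z|^2 differ by the real part of an affine
  holomorphic function, so a peak can be made strict at its own point without leaving the family.
  The modulus enters squared so that, for holomorphic functions, it can be traded for a term
  absorbed in h.

  The dimension N varies from chart to chart, so a point is a sequence and the calculus is built
  from one-variable derivatives along coordinate lines. Holomorphy of partial derivatives, symmetry
  of second derivatives and Taylor expansion along rays come from one-variable theorems, made
  uniform by compactness or by continuity of the derivatives.\<close>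

definition Cpts :: "nat \<Rightarrow> (nat \<Rightarrow> complex) set" where
  "Cpts N = {z. \<forall>i\<ge>N. z i = 0}"

definition pdisc :: "nat \<Rightarrow> (nat \<Rightarrow> complex) \<Rightarrow> real \<Rightarrow> (nat \<Rightarrow> complex) set" where
  "pdisc N z d = {w \<in> Cpts N. \<forall>i<N. cmod (w i - z i) < d}"

lemma Cspace_eq: "Cspace N = top_of_set (Cpts N)"
  by (simp add: Cspace_def Cpts_def euclidean_product_topology)

lemma topspace_Cspace [simp]: "topspace (Cspace N) = Cpts N"
  by (simp add: Cspace_eq)

lemma pdisc_subset: "pdisc N z d \<subseteq> Cpts N"
  by (auto simp: pdisc_def)

lemma pdisc_mono: "d \<le> e \<Longrightarrow> pdisc N z d \<subseteq> pdisc N z e"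
  by (force simp: pdisc_def)

lemma centre_in_pdisc: "z \<in> Cpts N \<Longrightarrow> 0 < d \<Longrightarrow> z \<in> pdisc N z d"
  by (auto simp: pdisc_def)

lemma continuous_on_proj: "continuous_on S (\<lambda>z. z i :: complex)"
  by (rule continuous_on_subset[OF continuous_on_product_coordinates subset_UNIV])

lemma continuous_on_fun_upd:
  fixes g :: "(nat \<Rightarrow> complex) \<Rightarrow> complex"
  assumes "continuous_on S g"
  shows "continuous_on S (\<lambda>w. w(i := g w))"
proof (rule continuous_on_coordinatewise_then_product)
  show "continuous_on S (\<lambda>w. (w(i := g w)) j)" for j
    using assms continuous_on_proj by (cases "j = i") auto
qed

lemma open_coordinate_disc:
  "open {w. \<forall>i<N. cmod (w i - z i) < d}" for z :: "nat \<Rightarrow> complex"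
proof -
  have "{w. \<forall>i<N. cmod (w i - z i) < d} = (\<Inter>i\<in>{..<N}. (\<lambda>w. w i) -` ball (z i) d)"
    by (auto simp: dist_norm norm_minus_commute)
  moreover have "open \<dots>"
    by (intro open_INT finite_lessThan ballI open_vimage continuous_on_proj open_ball)
  ultimately show ?thesis by simp
qed

lemma openin_pdisc: "openin (Cspace N) (pdisc N z d)"
  unfolding Cspace_eq openin_open pdisc_def
  by (intro exI[of _ "{w. \<forall>i<N. cmod (w i - z i) < d}"] conjI open_coordinate_disc) auto

text \<open>A basic open set of the product topology restricts finitely many coordinates, and points
  of \<open>Cpts N\<close> all agree from index \<open>N\<close> on, so one radius serves all
  restricted coordinates.\<close>

lemma pdisc_in_open:
  assumes "open T" "z \<in> T" "z \<in> Cpts N"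
  obtains d where "d > 0" "pdisc N z d \<subseteq> T"
proof -
  have "openin (product_topology (\<lambda>_. euclidean) UNIV) T"
    using assms(1) by (simp add: open_fun_def)
  then obtain V where V: "finite {i. V i \<noteq> UNIV}" "\<And>i. open (V i)"
      "z \<in> PiE UNIV V" "PiE UNIV V \<subseteq> T"
    unfolding openin_product_topology_alt using assms(2) by auto
  have "\<exists>e>0. ball (z i) e \<subseteq> V i" for i
    using V(2,3) by (metis PiE_mem UNIV_I openE)
  then obtain e where e: "\<And>i. e i > 0" "\<And>i. ball (z i) (e i) \<subseteq> V i" by metis
  \<comment> \<open>The element 1 covers the case that no coordinate is restricted.\<close>
  define d where "d = Min (insert 1 (e ` {i. V i \<noteq> UNIV}))"
  have "d > 0" unfolding d_def using V(1) e(1) by (subst Min_gr_iff) auto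
  have dle: "d \<le> e i" if "V i \<noteq> UNIV" for i
    unfolding d_def using V(1) that by (intro Min_le) auto
  have "pdisc N z d \<subseteq> T"
  proof
    fix w assume w: "w \<in> pdisc N z d"
    have "w i \<in> V i" for i
    proof (cases "V i = UNIV")
      case False
      have "cmod (w i - z i) < d"
        using w assms(3) \<open>d > 0\<close> by (cases "i < N") (auto simp: pdisc_def Cpts_def)
      then have "w i \<in> ball (z i) (e i)" using dle[OF False]
        by (simp add: dist_norm norm_minus_commute)
      then show ?thesis using e(2) by blast
    qed auto
    then show "w \<in> T" using V(4) by auto
  qed
  then show ?thesis using that \<open>d > 0\<close> by blast
qed

lemma openin_Cspace_pdisc:
  assumes "openin (Cspace N) U" "z \<in> U"
  obtains d where "d > 0" "pdisc N z d \<subseteq> U"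
proof -
  from assms obtain T where T: "open T" "U = Cpts N \<inter> T"
    by (auto simp: Cspace_eq openin_open)
  obtain d where "d > 0" "pdisc N z d \<subseteq> T"
    using pdisc_in_open[OF T(1), of z N] T(2) assms(2) by blast
  then show ?thesis using that T(2) pdisc_subset by blast
qed

lemma continuous_Cspace:
  "U \<subseteq> Cpts N \<Longrightarrow> continuous_map (subtopology (Cspace N) U) euclidean f \<longleftrightarrow> continuous_on U f"
  by (simp add: Cspace_eq subtopology_subtopology Int_absorb1)

text \<open>The form in which later estimates use continuity: polydiscs take the place of
  balls.\<close>

lemma continuous_on_Cpts_iff:
  fixes f :: "(nat \<Rightarrow> complex) \<Rightarrow> 'b::metric_space"
  assumes "U \<subseteq> Cpts N"
  shows "continuous_on U f \<longleftrightarrow>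
    (\<forall>z\<in>U. \<forall>e>0. \<exists>d>0. \<forall>w\<in>U \<inter> pdisc N z d. dist (f w) (f z) < e)"
proof
  assume c: "continuous_on U f"
  show "\<forall>z\<in>U. \<forall>e>0. \<exists>d>0. \<forall>w\<in>U \<inter> pdisc N z d. dist (f w) (f z) < e"
  proof (intro ballI allI impI)
    fix z and e :: real assume "z \<in> U" "e > 0"
    obtain A where A: "open A" "A \<inter> U = f -` ball (f z) e \<inter> U"
      using c[unfolded continuous_on_open_invariant, rule_format, OF open_ball[of "f z" e]] by auto
    then have "z \<in> A" using \<open>z \<in> U\<close> \<open>e > 0\<close> by auto
    then obtain d where "d > 0" "pdisc N z d \<subseteq> A"
      using pdisc_in_open A(1) assms \<open>z \<in> U\<close> by blast
    moreover have "dist (f w) (f z) < e" if "w \<in> U \<inter> pdisc N z d" for w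
    proof -
      have "w \<in> A \<inter> U" using that \<open>pdisc N z d \<subseteq> A\<close> by blast
      then show ?thesis unfolding A(2) by (simp add: dist_commute)
    qed
    ultimately show "\<exists>d>0. \<forall>w\<in>U \<inter> pdisc N z d. dist (f w) (f z) < e" by blast
  qed
next
  assume *: "\<forall>z\<in>U. \<forall>e>0. \<exists>d>0. \<forall>w\<in>U \<inter> pdisc N z d. dist (f w) (f z) < e"
  show "continuous_on U f"
    unfolding continuous_on_def
  proof (intro ballI tendstoI)
    fix z and e :: real assume z: "z \<in> U" "0 < e"
    then obtain d where d: "d > 0" "\<forall>w\<in>U \<inter> pdisc N z d. dist (f w) (f z) < e"
      using * by blast
    show "\<forall>\<^sub>F x in at z within U. dist (f x) (f z) < e"
      unfolding eventually_at_topological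
    proof (intro exI conjI ballI impI)
      show "open {w. \<forall>i<N. cmod (w i - z i) < d}" by (rule open_coordinate_disc)
    qed (use d assms in \<open>auto simp: pdisc_def\<close>)
  qed
qed

lemma holo_on_subset: "holo_on N U f \<Longrightarrow> V \<subseteq> U \<Longrightarrow> holo_on N V f"
  unfolding holo_on_def
  using continuous_map_from_subtopology_mono[of "Cspace N" U euclidean f V] by auto

lemma fun_upd_Cpts: "w \<in> Cpts N \<Longrightarrow> i < N \<Longrightarrow> w(i := t) \<in> Cpts N"
  by (auto simp: Cpts_def)

text \<open>First-order Taylor formula, with the second derivative controlled by Cauchy's
  inequality. The bound involves only \<open>M\<close> and \<open>r\<close>, so it is uniform over
  the slices of a function of several variables.\<close>

lemma difference_quotient_bound:
  fixes F :: "complex \<Rightarrow> complex"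
  assumes hol: "F holomorphic_on ball a r" and M: "\<And>t. t \<in> ball a r \<Longrightarrow> cmod (F t) \<le> M"
    and r: "r > 0" and h: "h \<noteq> 0" "cmod h < r / 2"
  shows "cmod ((F (a + h) - F a) / h - deriv F a) \<le> 32 * M / r\<^sup>2 * cmod h"
proof -
  let ?S = "ball a (r / 2)"
  have sub: "?S \<subseteq> ball a r" using r by (auto simp: subset_ball)
  have B: "cmod ((deriv ^^ 2) F x) \<le> 32 * M / r\<^sup>2" if "x \<in> ?S" for x
  proof -
    have inb: "cball x (r / 4) \<subseteq> ball a r"
    proof
      fix y assume "y \<in> cball x (r / 4)"
      with that have "dist a x < r / 2" "dist x y \<le> r / 4" by auto
      then have "dist a y < r / 2 + r / 4" using dist_triangle[of a y x] by linarith
      then show "y \<in> ball a r" using r by auto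
    qed
    \<comment> \<open>Discs of radius r / 4 about points of the half disc stay in
      \<open>ball a r\<close>, and 2 M / (r / 4)^2 = 32 M / r^2.\<close>
    have "cmod ((deriv ^^ 2) F x) \<le> fact 2 * M / (r / 4) ^ 2"
    proof (rule Cauchy_inequality)
      show "F holomorphic_on ball x (r / 4)"
        using hol inb ball_subset_cball holomorphic_on_subset by blast
      show "continuous_on (cball x (r / 4)) F"
        using hol inb holomorphic_on_imp_continuous_on holomorphic_on_subset by blast
      show "cmod (F y) \<le> M" if "cmod (x - y) = r / 4" for y
        using that inb M[of y] by (auto simp: dist_norm subset_iff)
    qed (use r in auto)
    then show ?thesis by (simp add: power2_eq_square field_simps fact_numeral)
  qed
  have "cmod (((deriv ^^ 0) F) (a + h) -
      (\<Sum>i\<le>1. (deriv ^^ i) F a * ((a + h) - a) ^ i / fact i))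
      \<le> 32 * M / r\<^sup>2 * cmod ((a + h) - a) ^ Suc 1 / fact 1"
  proof (rule complex_Taylor[where S = ?S and f = "\<lambda>i. (deriv ^^ i) F"])
    show "((deriv ^^ i) F has_field_derivative (deriv ^^ Suc i) F x) (at x within ?S)"
      if "x \<in> ?S" for i x
    proof -
      have "(deriv ^^ i) F holomorphic_on ball a r"
        by (intro holomorphic_higher_deriv hol) auto
      then have "((deriv ^^ i) F has_field_derivative deriv ((deriv ^^ i) F) x) (at x)"
        using that sub by (intro holomorphic_derivI[of _ "ball a r"]) auto
      then show ?thesis by (simp add: has_field_derivative_at_within)
    qed
    show "cmod ((deriv ^^ Suc 1) F x) \<le> 32 * M / r\<^sup>2" if "x \<in> ?S" for x
      using B[OF that] by (simp add: numeral_2_eq_2)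
  qed (use r h in \<open>auto simp: dist_norm\<close>)
  then have *: "cmod (F (a + h) - F a - deriv F a * h) \<le> 32 * M / r\<^sup>2 * (cmod h)\<^sup>2"
    by (simp add: power2_eq_square algebra_simps)
  have "(F (a + h) - F a) / h - deriv F a = (F (a + h) - F a - deriv F a * h) / h"
    using h by (simp add: field_simps)
  then have "cmod ((F (a + h) - F a) / h - deriv F a) = cmod (F (a + h) - F a - deriv F a * h) / cmod h"
    by (simp add: norm_divide)
  also have "\<dots> \<le> 32 * M / r\<^sup>2 * (cmod h)\<^sup>2 / cmod h"
    using * by (intro divide_right_mono) auto
  finally show ?thesis using h by (simp add: power2_eq_square)
qed

section \<open>Complex partial derivatives of holomorphic functions\<close>

definition cpdisc :: "nat \<Rightarrow> (nat \<Rightarrow> complex) \<Rightarrow> real \<Rightarrow> (nat \<Rightarrow> complex) set" where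
  "cpdisc N z d = {w \<in> Cpts N. \<forall>i<N. cmod (w i - z i) \<le> d}"

lemma cpdisc_subset_pdisc: "d < e \<Longrightarrow> cpdisc N z d \<subseteq> pdisc N z e"
  by (force simp: cpdisc_def pdisc_def)

lemma pdisc_subset_cpdisc: "pdisc N z d \<subseteq> cpdisc N z d"
  by (force simp: cpdisc_def pdisc_def)

lemma compact_cpdisc: "compact (cpdisc N z d)"
proof -
  have eq: "cpdisc N z d = PiE UNIV (\<lambda>i. if i < N then cball (z i) d else {0})"
  proof (intro equalityI subsetI)
    fix w assume "w \<in> cpdisc N z d"
    then show "w \<in> PiE UNIV (\<lambda>i. if i < N then cball (z i) d else {0})"
      by (auto simp: cpdisc_def Cpts_def dist_norm norm_minus_commute PiE_iff)
  next
    fix w assume w: "w \<in> PiE UNIV (\<lambda>i. if i < N then cball (z i) d else {0})"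
    have "w i \<in> (if i < N then cball (z i) d else {0})" for i
      using w by (simp add: PiE_iff)
    then show "w \<in> cpdisc N z d"
      unfolding cpdisc_def Cpts_def mem_Collect_eq
      by (metis dist_norm mem_cball norm_minus_commute not_le singletonD)
  qed
  have "compactin (product_topology (\<lambda>_. euclidean) UNIV)
    (PiE UNIV (\<lambda>i. if i < N then cball (z i) d else {0}))"
    unfolding compactin_PiE by auto
  then show ?thesis unfolding eq euclidean_product_topology by simp
qed

definition cderiv :: "nat \<Rightarrow> ((nat \<Rightarrow> complex) \<Rightarrow> complex) \<Rightarrow> (nat \<Rightarrow> complex) \<Rightarrow> complex" where
  "cderiv i f z = deriv (\<lambda>t. f (z(i := t))) (z i)"

lemma holo_on_slice:
  assumes "holo_on N U f" "j < N" "\<And>t. t \<in> B \<Longrightarrow> w(j := t) \<in> U"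
  shows "(\<lambda>t. f (w(j := t))) holomorphic_on B"
  unfolding holomorphic_on_def
proof
  fix t assume "t \<in> B"
  then have "(\<lambda>s. f ((w(j := t))(j := s))) field_differentiable (at ((w(j := t)) j))"
    using assms unfolding holo_on_def by blast
  then show "(\<lambda>t. f (w(j := t))) field_differentiable (at t within B)"
    by (simp add: field_differentiable_at_within)
qed

text \<open>Difference quotients in direction \<open>i\<close> are continuous, and holomorphic in
  every other variable; they converge to \<open>cderiv i f\<close> locally uniformly, and both
  properties pass to the limit. In the variable \<open>i\<close> itself, the derivative of a
  one-variable holomorphic function is holomorphic.\<close>

lemma cderiv_holo_on:
  assumes U: "openin (Cspace N) U" and f: "holo_on N U f" and i: "i < N"
  shows "holo_on N U (cderiv i f)"
proof -
  have UC: "U \<subseteq> Cpts N" using openin_subset[OF U] by simp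
  have contf: "continuous_on U f" using f UC by (simp add: holo_on_def continuous_Cspace)
  define q where "q h w = (f (w(i := w i + h)) - f w) / h" for h w
  \<comment> \<open>Increments tending to zero, at most r / 3 and hence below the r / 2 required by
    \<open>difference_quotient_bound\<close>.\<close>
  define hs where "hs r n = complex_of_real (r / (real n + 3))" for r n
  have hs: "cmod (hs r n) = r / (real n + 3)" "hs r n \<noteq> 0" if "r > 0" for r n
    using that unfolding hs_def norm_of_real of_real_eq_0_iff by simp_all
  have key: "\<exists>r>0. pdisc N z (2 * r) \<subseteq> U \<and>
      uniform_limit (pdisc N z r) (\<lambda>n. q (hs r n)) (cderiv i f) sequentially"
    if z: "z \<in> U" for z
  proof -
    obtain d where d: "d > 0" "pdisc N z d \<subseteq> U" using openin_Cspace_pdisc[OF U z] by blast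
    \<comment> \<open>One third of \<open>d\<close>, so that the closed polydisc of radius 2 r is
      still inside \<open>U\<close>. By compactness it yields a single bound \<open>M\<close>, and
      increments smaller than r from the polydisc of radius r stay in it.\<close>
    define r where "r = d / 3"
    have r: "r > 0" using d by (simp add: r_def)
    have cp: "cpdisc N z (2 * r) \<subseteq> U"
      using cpdisc_subset_pdisc[of "2 * r" d N z] d by (auto simp: r_def)
    then have pU: "pdisc N z (2 * r) \<subseteq> U" using pdisc_subset_cpdisc by blast
    have "bounded (f ` cpdisc N z (2 * r))"
      by (intro compact_imp_bounded compact_continuous_image compact_cpdisc
          continuous_on_subset[OF contf] cp)
    then obtain M where M: "\<And>w. w \<in> cpdisc N z (2 * r) \<Longrightarrow> cmod (f w) \<le> M"
      unfolding bounded_iff by blast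
    have shift: "w(i := t) \<in> pdisc N z (2 * r)"
      if "w \<in> pdisc N z r" "t \<in> ball (w i) r" for w t
    proof -
      have "cmod (t - z i) < 2 * r"
      proof -
        have "cmod (t - z i) \<le> cmod (t - w i) + cmod (w i - z i)"
          using norm_triangle_ineq[of "t - w i" "w i - z i"] by simp
        also have "\<dots> < r + r"
          using that i by (intro add_strict_mono) (auto simp: pdisc_def dist_norm norm_minus_commute)
        finally show ?thesis by simp
      qed
      moreover have "cmod (w j - z j) < 2 * r" if "j < N" for j
        using \<open>w \<in> pdisc N z r\<close> that r by (force simp: pdisc_def)
      ultimately show ?thesis
        using fun_upd_Cpts[OF _ i, of w t] that by (auto simp: pdisc_def)
    qed
    have bd: "cmod (q h w - cderiv i f w) \<le> 32 * M / r\<^sup>2 * cmod h"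
      if w: "w \<in> pdisc N z r" and h: "h \<noteq> 0" "cmod h < r / 2" for w h
    proof -
      have "cmod ((f (w(i := w i + h)) - f (w(i := w i))) / h
          - deriv (\<lambda>t. f (w(i := t))) (w i)) \<le> 32 * M / r\<^sup>2 * cmod h"
      proof (rule difference_quotient_bound)
        show "(\<lambda>t. f (w(i := t))) holomorphic_on ball (w i) r"
          using holo_on_slice[OF f i] shift[OF w] pU by blast
        show "cmod (f (w(i := t))) \<le> M" if "t \<in> ball (w i) r" for t
          using M shift[OF w that] pdisc_subset_cpdisc by blast
      qed (use r h in auto)
      then show ?thesis by (simp add: q_def cderiv_def)
    qed
    have "uniform_limit (pdisc N z r) (\<lambda>n. q (hs r n)) (cderiv i f) sequentially"
      unfolding uniform_limit_iff
    proof (intro allI impI)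
      fix e :: real assume "e > 0"
      have "(\<lambda>n. r / (real n + 3)) \<longlonglongrightarrow> 0"
        by real_asymp
      then have "(\<lambda>n. 32 * M / r\<^sup>2 * (r / (real n + 3))) \<longlonglongrightarrow> 32 * M / r\<^sup>2 * 0"
        by (intro tendsto_mult tendsto_const)
      then have "\<forall>\<^sub>F n in sequentially. 32 * M / r\<^sup>2 * (r / (real n + 3)) < e"
        using \<open>e > 0\<close> by (intro order_tendstoD(2)) auto
      then show "\<forall>\<^sub>F n in sequentially. \<forall>x\<in>pdisc N z r. dist (q (hs r n) x) (cderiv i f x) < e"
      proof eventually_elim
        case (elim n)
        note n = hs[OF r, of n]
        have "r / (real n + 3) \<le> r / 3" using r by (intro divide_left_mono) auto
        then have "cmod (hs r n) < r / 2" using n r by simp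
        show ?case
        proof
          fix w assume "w \<in> pdisc N z r"
          from bd[OF this n(2) \<open>cmod (hs r n) < r / 2\<close>] elim n(1)
          show "dist (q (hs r n) w) (cderiv i f w) < e" by (simp add: dist_norm)
        qed
      qed
    qed
    then show ?thesis using r pU by blast
  qed
  have upd: "w(i := w i + hs r n) \<in> pdisc N z (2 * r)"
    if "w \<in> pdisc N z r" "r > 0" for w z r n
  proof -
    have "0 < r * real n + r * 2" using that(2) by (intro add_nonneg_pos) auto
    then have "r / (real n + 3) < r" by (simp add: field_simps)
    then have "cmod (hs r n) < r" using that(2) by (simp add: hs(1))
    then have "cmod (w i + hs r n - z i) < 2 * r"
      using that i norm_triangle_ineq[of "w i - z i" "hs r n"]
      by (fastforce simp: pdisc_def algebra_simps)
    moreover have "cmod (w j - z j) < 2 * r" if "j < N" for j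
      using \<open>w \<in> pdisc N z r\<close> \<open>r > 0\<close> that by (force simp: pdisc_def)
    ultimately show ?thesis using that fun_upd_Cpts[OF _ i, of w] by (auto simp: pdisc_def)
  qed
  have "continuous_on U (cderiv i f)"
    unfolding continuous_on_Cpts_iff[OF UC]
  proof (intro ballI allI impI)
    fix z and e :: real assume z: "z \<in> U" and e: "e > 0"
    obtain r where r: "r > 0" "pdisc N z (2 * r) \<subseteq> U"
      and ul: "uniform_limit (pdisc N z r) (\<lambda>n. q (hs r n)) (cderiv i f) sequentially"
      using key[OF z] by blast
    have "continuous_on (pdisc N z r) (cderiv i f)"
    proof (rule uniform_limit_theorem[OF _ ul])
      have "continuous_on (pdisc N z r) (q (hs r n))" for n
      proof -
        have "continuous_on (pdisc N z r) (\<lambda>w. w(i := w i + hs r n))"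
          by (intro continuous_on_fun_upd continuous_intros continuous_on_proj)
        then have "continuous_on (pdisc N z r) (\<lambda>w. f (w(i := w i + hs r n)))"
          by (rule continuous_on_compose2[OF contf]) (use upd r in blast)
        moreover have "continuous_on (pdisc N z r) f"
          using contf r pdisc_mono[of r "2 * r" N z] by (auto intro: continuous_on_subset)
        ultimately show ?thesis unfolding q_def
          by (intro continuous_intros) (use r hs(2) in auto)
      qed
      then show "\<forall>\<^sub>F n in sequentially. continuous_on (pdisc N z r) (q (hs r n))" by simp
    qed simp
    moreover have "z \<in> pdisc N z r" using z UC r by (intro centre_in_pdisc) auto
    ultimately obtain d where d: "d > 0"
      "\<forall>w\<in>pdisc N z r \<inter> pdisc N z d. dist (cderiv i f w) (cderiv i f z) < e"
      unfolding continuous_on_Cpts_iff[OF pdisc_subset] using e by blast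
    show "\<exists>d>0. \<forall>w\<in>U \<inter> pdisc N z d. dist (cderiv i f w) (cderiv i f z) < e"
      by (rule exI[of _ "min r d"]) (use d r in \<open>auto simp: pdisc_def\<close>)
  qed
  moreover have "(\<lambda>t. cderiv i f (w(j := t))) field_differentiable (at (w j))"
    if w: "w \<in> U" and j: "j < N" for w j
  proof -
    obtain r where r: "r > 0" "pdisc N w (2 * r) \<subseteq> U"
      and ul: "uniform_limit (pdisc N w r) (\<lambda>n. q (hs r n)) (cderiv i f) sequentially"
      using key[OF w] by blast
    have inr: "w(j := t) \<in> pdisc N w r" if "t \<in> ball (w j) r" for t
      using that w UC fun_upd_Cpts[OF _ j, of w t] r
      by (auto simp: pdisc_def dist_norm norm_minus_commute)
    have inU: "w(j := t) \<in> U" if "t \<in> ball (w j) r" for t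
      using inr[OF that] r pdisc_mono[of r "2 * r" N w] by auto
    have "(\<lambda>t. cderiv i f (w(j := t))) holomorphic_on ball (w j) r"
    proof (cases "j = i")
      case True
      have "deriv (\<lambda>t. f (w(j := t))) holomorphic_on ball (w j) r"
        by (intro holomorphic_deriv holo_on_slice[OF f j] inU) auto
      then show ?thesis by (simp add: cderiv_def True)
    next
      case False
      show ?thesis
      proof (rule holomorphic_uniform_sequence)
        show "(\<lambda>t. q (hs r n) (w(j := t))) holomorphic_on ball (w j) r" for n
        proof -
          \<comment> \<open>Changing coordinate \<open>j\<close> commutes with incrementing
            coordinate \<open>i\<close>, so the quotient is a combination of two slices of
            \<open>f\<close>.\<close>
          have *: "(w(j := t))(i := (w(j := t)) i + hs r n) = (w(i := w i + hs r n))(j := t)" for t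
            using False by (simp add: fun_upd_twist)
          have A: "(\<lambda>t. f ((w(i := w i + hs r n))(j := t))) holomorphic_on ball (w j) r"
          proof (rule holo_on_slice[OF f j])
            fix t assume "t \<in> ball (w j) r"
            from subsetD[OF r(2) upd[OF inr[OF this] r(1), where n = n]]
            show "(w(i := w i + hs r n))(j := t) \<in> U" by (simp only: *)
          qed
          have B: "(\<lambda>t. f (w(j := t))) holomorphic_on ball (w j) r"
            by (rule holo_on_slice[OF f j inU])
          show ?thesis unfolding q_def *
            by (intro holomorphic_intros A B) (use r hs(2) in auto)
        qed
        fix x assume "x \<in> ball (w j) r"
        then obtain d where d: "d > 0" "cball x d \<subseteq> ball (w j) r"
          using open_contains_cball_eq[OF open_ball] by blast
        moreover have "uniform_limit (cball x d) (\<lambda>n t. q (hs r n) (w(j := t)))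
            (\<lambda>t. cderiv i f (w(j := t))) sequentially"
          unfolding uniform_limit_iff
        proof (intro allI impI)
          fix e :: real assume "e > 0"
          then have "\<forall>\<^sub>F n in sequentially. \<forall>v\<in>pdisc N w r. dist (q (hs r n) v) (cderiv i f v) < e"
            using ul unfolding uniform_limit_iff by blast
          then show "\<forall>\<^sub>F n in sequentially. \<forall>t\<in>cball x d.
              dist (q (hs r n) (w(j := t))) (cderiv i f (w(j := t))) < e"
            by (rule eventually_mono) (use d inr in blast)
        qed
        ultimately show "\<exists>d>0. cball x d \<subseteq> ball (w j) r \<and>
          uniform_limit (cball x d) (\<lambda>n t. q (hs r n) (w(j := t)))
            (\<lambda>t. cderiv i f (w(j := t))) sequentially" by blast
      qed auto
    qed
    then show ?thesis using r
      by (auto simp: holomorphic_on_def at_within_open[OF _ open_ball])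
  qed
  ultimately show ?thesis using UC by (simp add: holo_on_def continuous_Cspace)
qed


section \<open>Partial derivatives of the model functions\<close>

lemma coord_line_eventually:
  assumes U: "openin (Cspace N) U" and z: "z \<in> U" and i: "i < N"
  shows "\<forall>\<^sub>F t in nhds 0. coord_line i c z t \<in> U"
proof -
  have zC: "z \<in> Cpts N" using openin_subset[OF U] z by auto
  obtain d where d: "d > 0" "pdisc N z d \<subseteq> U" using openin_Cspace_pdisc[OF U z] by blast
  have "((\<lambda>t. cmod (of_real t * c)) \<longlongrightarrow> cmod (of_real 0 * c)) (nhds 0)"
    by (intro tendsto_intros filterlim_ident)
  then have "\<forall>\<^sub>F t in nhds 0. cmod (of_real t * c) < d"
    using d by (intro order_tendstoD(2)) auto
  then show ?thesis
  proof eventually_elim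
    case (elim t)
    then have "coord_line i c z t \<in> pdisc N z d"
      using d fun_upd_Cpts[OF zC i] by (auto simp: coord_line_def pdisc_def)
    then show ?case using d by blast
  qed
qed

lemma coord_line_0 [simp]: "coord_line i c z 0 = z"
  by (simp add: coord_line_def)

lemma partial_deriv_cong:
  assumes U: "openin (Cspace N) U" and z: "z \<in> U" and i: "i < N"
    and eq: "\<And>w. w \<in> U \<Longrightarrow> f w = g w"
  shows "partial_deriv i c f z = partial_deriv i c g z"
  unfolding partial_deriv_def
  by (rule vector_derivative_cong_eq)
    (use coord_line_eventually[OF U z i, of c] eq in \<open>auto elim: eventually_mono\<close>)

lemma coord_line_differentiable_cong:
  assumes U: "openin (Cspace N) U" and z: "z \<in> U" and i: "i < N"
    and eq: "\<And>w. w \<in> U \<Longrightarrow> f w = g w"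
    and f: "(\<lambda>t. f (coord_line i c z t)) differentiable (at 0)"
  shows "(\<lambda>t. g (coord_line i c z t)) differentiable (at 0)"
proof -
  obtain D where D: "((\<lambda>t. f (coord_line i c z t)) has_derivative D) (at 0)"
    using f unfolding differentiable_def by blast
  have "((\<lambda>t. g (coord_line i c z t)) has_derivative D) (at 0)"
    by (rule has_derivative_transform_eventually[OF D])
      (use coord_line_eventually[OF U z i, of c] eq z in
        \<open>auto simp: eventually_at_filter elim: eventually_mono\<close>)
  then show ?thesis unfolding differentiable_def by blast
qed

text \<open>Openness of \<open>U\<close> makes derivatives of total functions depend only on the
  values in \<open>U\<close>; thus a formula valid on \<open>U\<close> alone may replace a
  derivative inside \<open>Ck_on\<close>.\<close>

lemma Ck_on_cong:
  assumes U: "openin (Cspace N) U"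
  shows "(\<And>w. w \<in> U \<Longrightarrow> f w = g w) \<Longrightarrow> Ck_on k N U f \<Longrightarrow> Ck_on k N U g"
proof (induction k arbitrary: f g)
  case 0
  then show ?case by (auto elim!: continuous_map_eq)
next
  case (Suc k)
  have "continuous_map (subtopology (Cspace N) U) euclidean g"
    using Suc.prems by (auto elim!: continuous_map_eq)
  moreover have "(\<lambda>t. g (coord_line i c z t)) differentiable (at 0)"
    if "i < N" "c \<in> {1, \<i>}" "z \<in> U" for i c z
  proof (rule coord_line_differentiable_cong[OF U that(3,1) Suc.prems(1)])
    show "(\<lambda>t. f (coord_line i c z t)) differentiable (at 0)" using Suc.prems(2) that by auto
  qed
  moreover have "Ck_on k N U (partial_deriv i c g)" if "i < N" "c \<in> {1, \<i>}" for i c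
    by (rule Suc.IH[of "partial_deriv i c f"])
      (use partial_deriv_cong[OF U _ that(1) Suc.prems(1)] Suc.prems(2) that in auto)
  ultimately show ?case by simp
qed

section \<open>Building holomorphic functions and the model functions Re h + k |z|^2\<close>

lemma holo_on_iff:
  "U \<subseteq> Cpts N \<Longrightarrow> holo_on N U f \<longleftrightarrow> continuous_on U f \<and>
     (\<forall>z\<in>U. \<forall>i<N. (\<lambda>t. f (z(i := t))) field_differentiable (at (z i)))"
  by (simp add: holo_on_def continuous_Cspace)

lemma holo_on_const: "U \<subseteq> Cpts N \<Longrightarrow> holo_on N U (\<lambda>w. a)"
  by (simp add: holo_on_iff)

lemma holo_on_coord: "U \<subseteq> Cpts N \<Longrightarrow> holo_on N U (\<lambda>w. w j)"
proof -
  have "(\<lambda>t. (z(i := t)) j) field_differentiable (at (z i))" for z :: "nat \<Rightarrow> complex" and i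
    by (cases "i = j") (auto simp: field_differentiable_ident)
  then show "U \<subseteq> Cpts N \<Longrightarrow> holo_on N U (\<lambda>w. w j)"
    by (simp add: holo_on_iff continuous_on_proj)
qed

lemma holo_on_add:
  "U \<subseteq> Cpts N \<Longrightarrow> holo_on N U f \<Longrightarrow> holo_on N U g \<Longrightarrow> holo_on N U (\<lambda>w. f w + g w)"
  by (auto simp: holo_on_iff intro!: continuous_intros field_differentiable_add)

lemma holo_on_mult:
  "U \<subseteq> Cpts N \<Longrightarrow> holo_on N U f \<Longrightarrow> holo_on N U g \<Longrightarrow> holo_on N U (\<lambda>w. f w * g w)"
  by (auto simp: holo_on_iff intro!: continuous_intros field_differentiable_mult)

lemma holo_on_sum:
  "U \<subseteq> Cpts N \<Longrightarrow> (\<And>i. i \<in> I \<Longrightarrow> holo_on N U (f i)) \<Longrightarrow> holo_on N U (\<lambda>w. \<Sum>i\<in>I. f i w)"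
  by (induction I rule: infinite_finite_induct) (auto intro: holo_on_const holo_on_add)

lemma holo_on_exp:
  assumes "U \<subseteq> Cpts N" "holo_on N U f"
  shows "holo_on N U (\<lambda>w. exp (f w))"
proof -
  have "(\<lambda>t. exp (f (z(i := t)))) field_differentiable (at (z i))" if "z \<in> U" "i < N" for z i
    using field_differentiable_compose[of "\<lambda>t. f (z(i := t))" "z i" exp] assms that
    by (auto simp: holo_on_iff o_def field_differentiable_within_exp)
  then show ?thesis using assms by (auto simp: holo_on_iff intro!: continuous_intros)
qed

lemma cderiv_has_field_derivative:
  assumes "holo_on N U h" "z \<in> U" "i < N"
  shows "((\<lambda>t. h (z(i := t))) has_field_derivative cderiv i h z) (at (z i))"
  using assms unfolding holo_on_def cderiv_def by (blast intro: field_differentiable_derivI)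

definition nsq :: "nat \<Rightarrow> (nat \<Rightarrow> complex) \<Rightarrow> real" where
  "nsq N z = (\<Sum>i<N. (cmod (z i))\<^sup>2)"

lemma continuous_on_nsq: "continuous_on S (nsq N)"
  unfolding nsq_def by (intro continuous_intros continuous_on_proj)

lemma cmod_add_scaled_square:
  "(cmod (a + of_real t * c))\<^sup>2 = (cmod a)\<^sup>2 + 2 * Re (cnj c * a) * t + (cmod c)\<^sup>2 * t\<^sup>2"
  unfolding cmod_power2 by (simp add: power2_eq_square algebra_simps)

lemma nsq_coord_line:
  assumes "i < N"
  shows "nsq N (coord_line i c z t) = nsq N z + 2 * Re (cnj c * z i) * t + (cmod c)\<^sup>2 * t\<^sup>2"
proof -
  have "nsq N (coord_line i c z t) =
      (cmod (z i + of_real t * c))\<^sup>2 + (\<Sum>j\<in>{..<N} - {i}. (cmod (z j))\<^sup>2)"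
    unfolding nsq_def coord_line_def using assms by (subst sum.remove[of _ i]) auto
  moreover have "nsq N z = (cmod (z i))\<^sup>2 + (\<Sum>j\<in>{..<N} - {i}. (cmod (z j))\<^sup>2)"
    unfolding nsq_def using assms by (subst sum.remove[of _ i]) auto
  ultimately show ?thesis by (simp add: cmod_add_scaled_square)
qed

lemma psh_model_has_derivative:
  assumes "holo_on N U h" "z \<in> U" "i < N"
  shows "((\<lambda>t. Re (h (coord_line i c z t)) + k * nsq N (coord_line i c z t))
    has_real_derivative Re (c * cderiv i h z + 2 * of_real k * cnj c * z i)) (at 0)"
proof -
  have "((\<lambda>t. z i + of_real t * c) has_vector_derivative c) (at 0)"
    by (auto intro!: derivative_eq_intros)
  then have "(((\<lambda>t. h (z(i := t))) \<circ> (\<lambda>t. z i + of_real t * c)) has_vector_derivative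
      c * cderiv i h z) (at 0)"
    by (rule field_vector_diff_chain_at) (use cderiv_has_field_derivative[OF assms] in simp)
  then have "((\<lambda>t. Re (h (coord_line i c z t))) has_vector_derivative Re (c * cderiv i h z)) (at 0)"
    unfolding o_def coord_line_def[symmetric]
    by (rule bounded_linear.has_vector_derivative[OF bounded_linear_Re])
  then have "((\<lambda>t. Re (h (coord_line i c z t))) has_real_derivative Re (c * cderiv i h z)) (at 0)"
    by (simp add: has_real_derivative_iff_has_vector_derivative)
  moreover have "((\<lambda>t. k * nsq N (coord_line i c z t)) has_real_derivative
      2 * k * Re (cnj c * z i)) (at 0)"
    unfolding nsq_coord_line[OF assms(3)] by (auto intro!: derivative_eq_intros)
  ultimately have "((\<lambda>t. Re (h (coord_line i c z t)) + k * nsq N (coord_line i c z t))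
    has_real_derivative Re (c * cderiv i h z) + 2 * k * Re (cnj c * z i)) (at 0)"
    by (rule DERIV_add)
  then show ?thesis by (simp add: algebra_simps)
qed

lemma partial_deriv_psh_model:
  assumes "holo_on N U h" "z \<in> U" "i < N"
  shows "partial_deriv i c (\<lambda>w. Re (h w) + k * nsq N w) z =
    Re (c * cderiv i h z + 2 * of_real k * cnj c * z i)"
  unfolding partial_deriv_def
  using psh_model_has_derivative[OF assms]
  by (intro vector_derivative_at) (simp add: has_real_derivative_iff_has_vector_derivative)

lemma holo_on_psh_model_deriv:
  assumes U: "openin (Cspace N) U" and "holo_on N U h" "i < N"
  shows "holo_on N U (\<lambda>w. c * cderiv i h w + b * w i)"
  using openin_subset[OF U] assms
  by (auto intro!: holo_on_add holo_on_mult holo_on_const holo_on_coord cderiv_holo_on)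

text \<open>The gradient of |z|^2 is linear, so each derivative of a model function is the real part
  of a holomorphic function: again a model function, with \<open>k = 0\<close>. Hence the induction
  keeps both \<open>h\<close> and \<open>k\<close> arbitrary.\<close>

lemma Ck_on_psh_model:
  assumes U: "openin (Cspace N) U"
  shows "holo_on N U h \<Longrightarrow> Ck_on n N U (\<lambda>w. Re (h w) + k * nsq N w)"
proof (induction n arbitrary: h k)
  have UC: "U \<subseteq> Cpts N" using openin_subset[OF U] by simp
  have cont: "continuous_map (subtopology (Cspace N) U) euclidean (\<lambda>w. Re (h w) + k * nsq N w)"
    if "holo_on N U h" for h k
    using that UC by (auto simp: continuous_Cspace holo_on_iff intro!: continuous_intros continuous_on_nsq)
  case 0
  then show ?case using cont by simp
  case (Suc n)
  have "(\<lambda>t. Re (h (coord_line i c z t)) + k * nsq N (coord_line i c z t)) differentiable (at 0)"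
    if "i < N" "z \<in> U" for i c z
    using psh_model_has_derivative[OF Suc.prems that(2,1)]
    by (meson has_field_derivative_imp_has_derivative differentiable_def)
  moreover have "Ck_on n N U (partial_deriv i c (\<lambda>w. Re (h w) + k * nsq N w))"
    if "i < N" for i c
  proof (rule Ck_on_cong[OF U])
    show "Ck_on n N U (\<lambda>w. Re (c * cderiv i h w + 2 * of_real k * cnj c * w i) + 0 * nsq N w)"
      by (intro Suc.IH holo_on_psh_model_deriv U Suc.prems that)
  qed (simp add: partial_deriv_psh_model[OF Suc.prems _ that])
  ultimately show ?case using cont[OF Suc.prems] by simp
qed

section \<open>The complex Hessian and its eigenvalues for the model functions\<close>

lemma partial_deriv_has_real_derivative:
  assumes "(\<lambda>t. a (coord_line i c z t) :: real) differentiable (at 0)"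
  shows "((\<lambda>t. a (coord_line i c z t)) has_real_derivative partial_deriv i c a z) (at 0)"
  using assms
  by (simp add: partial_deriv_def vector_derivative_works has_real_derivative_iff_has_vector_derivative)

lemma partial_deriv_complex:
  assumes "(\<lambda>t. a (coord_line i c z t)) differentiable (at 0)"
    and "(\<lambda>t. b (coord_line i c z t)) differentiable (at 0)"
  shows "partial_deriv i c (\<lambda>w. (of_real (a w) + \<i> * of_real (b w)) / 2) z =
    (of_real (partial_deriv i c a z) + \<i> * of_real (partial_deriv i c b z)) / 2"
proof -
  have ab: "((\<lambda>t. a (coord_line i c z t)) has_real_derivative partial_deriv i c a z) (at 0)"
    "((\<lambda>t. b (coord_line i c z t)) has_real_derivative partial_deriv i c b z) (at 0)"
    using assms by (simp_all add: partial_deriv_has_real_derivative)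
  have "((\<lambda>t. (complex_of_real (a (coord_line i c z t)) + \<i> * of_real (b (coord_line i c z t))) / 2)
      has_vector_derivative
      (of_real (partial_deriv i c a z) + \<i> * of_real (partial_deriv i c b z)) / 2) (at 0)"
    by (intro has_vector_derivative_divide has_vector_derivative_add
        has_vector_derivative_mult_right has_vector_derivative_of_real ab)
  then show ?thesis by (simp add: partial_deriv_def vector_derivative_at)
qed

lemma partial_deriv_of_real:
  assumes "(\<lambda>t. a (coord_line i c z t)) differentiable (at 0)"
  shows "partial_deriv i c (\<lambda>w. complex_of_real (a w)) z = of_real (partial_deriv i c a z)"
proof -
  have "((\<lambda>t. a (coord_line i c z t)) has_real_derivative partial_deriv i c a z) (at 0)"
    using assms by (rule partial_deriv_has_real_derivative)
  from has_vector_derivative_of_real[OF this, where ?'a = complex]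
  show ?thesis by (simp add: partial_deriv_def vector_derivative_at)
qed

text \<open>The two Wirtinger derivatives are split into real second partials. The order of
  differentiation is kept as it arises; symmetry is proved only later.\<close>

lemma complex_hessian_entry:
  assumes U: "openin (Cspace N) U" and \<phi>: "Ck_on 2 N U \<phi>" and z: "z \<in> U" and ij: "i < N" "j < N"
  shows "complex_hessian N \<phi> z $$ (i, j) =
    Complex (partial_deriv i 1 (partial_deriv j 1 \<phi>) z + partial_deriv i \<i> (partial_deriv j \<i> \<phi>) z)
     (partial_deriv i 1 (partial_deriv j \<i> \<phi>) z - partial_deriv i \<i> (partial_deriv j 1 \<phi>) z) / 4"
proof -
  have d1: "(\<lambda>t. \<phi> (coord_line j c w t)) differentiable (at 0)" if "w \<in> U" "c \<in> {1, \<i>}" for w c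
    using \<phi> that ij by (auto simp: numeral_2_eq_2)
  have d2: "(\<lambda>t. partial_deriv j d \<phi> (coord_line i c z t)) differentiable (at 0)"
    if "c \<in> {1, \<i>}" "d \<in> {1, \<i>}" for c d
    using \<phi> that ij z by (auto simp: numeral_2_eq_2)
  \<comment> \<open>\<open>d_dzbar\<close> is rewritten on all of \<open>U\<close>, not just at
    \<open>z\<close>, because it is differentiated once more.\<close>
  have eq: "d_dzbar j (\<lambda>w. complex_of_real (\<phi> w)) w =
      (of_real (partial_deriv j 1 \<phi> w) + \<i> * of_real (partial_deriv j \<i> \<phi> w)) / 2"
    if "w \<in> U" for w
    using d1[OF that] by (simp add: d_dzbar_def partial_deriv_of_real)
  have "partial_deriv i c (d_dzbar j (\<lambda>w. complex_of_real (\<phi> w))) z =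
      (of_real (partial_deriv i c (partial_deriv j 1 \<phi>) z) +
       \<i> * of_real (partial_deriv i c (partial_deriv j \<i> \<phi>) z)) / 2" if "c \<in> {1, \<i>}" for c
    by (rule trans[OF partial_deriv_cong[OF U z ij(1) eq] partial_deriv_complex])
      (use d2 that in auto)
  from this[of 1] this[of "\<i>"] show ?thesis
    using ij by (simp add: complex_hessian_def d_dz_def) (simp add: complex_eq_iff)
qed

lemma cderiv_affine:
  assumes h: "holo_on N U h" and z: "z \<in> U" and i: "i < N"
  shows "cderiv i (\<lambda>w. d * h w + b * w j) z = d * cderiv i h z + b * (if i = j then 1 else 0)"
proof -
  have "((\<lambda>t. (z(i := t)) j) has_field_derivative (if i = j then 1 else 0)) (at (z i))"
    by auto
  then have "((\<lambda>t. d * h (z(i := t)) + b * (z(i := t)) j) has_field_derivative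
      d * cderiv i h z + b * (if i = j then 1 else 0)) (at (z i))"
    by (intro DERIV_add DERIV_cmult cderiv_has_field_derivative[OF h z i])
  then show ?thesis unfolding cderiv_def[of i "\<lambda>w. d * h w + b * w j"] by (rule DERIV_imp_deriv)
qed

text \<open>Re h is pluriharmonic and contributes nothing, while |z|^2 contributes the
  identity.\<close>

lemma complex_hessian_psh_model:
  assumes U: "openin (Cspace N) U" and h: "holo_on N U h" and z: "z \<in> U"
  shows "complex_hessian N (\<lambda>w. Re (h w) + k * nsq N w) z = of_real k \<cdot>\<^sub>m 1\<^sub>m N"
proof (rule eq_matI)
  fix i j assume "i < dim_row (of_real k \<cdot>\<^sub>m 1\<^sub>m N :: complex mat)" "j < dim_col (of_real k \<cdot>\<^sub>m 1\<^sub>m N :: complex mat)"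
  then have ij: "i < N" "j < N" by auto
  \<comment> \<open>In the combinations of \<open>complex_hessian_entry\<close> the terms with c d
    cancel, since 1 + \<i>^2 = 0, and those with c times \<open>cnj d\<close> add up to 4 k on the
    diagonal.\<close>
  have "partial_deriv i c (partial_deriv j d (\<lambda>w. Re (h w) + k * nsq N w)) z =
      Re (c * (d * cderiv i (cderiv j h) z + 2 * of_real k * cnj d * (if i = j then 1 else 0)))" for c d
  proof -
    have "partial_deriv i c (partial_deriv j d (\<lambda>w. Re (h w) + k * nsq N w)) z =
      partial_deriv i c (\<lambda>w. Re (d * cderiv j h w + (2 * of_real k * cnj d) * w j) + 0 * nsq N w) z"
      by (rule partial_deriv_cong[OF U z ij(1)]) (simp add: partial_deriv_psh_model[OF h _ ij(2)])
    also have "\<dots> = Re (c * cderiv i (\<lambda>w. d * cderiv j h w + (2 * of_real k * cnj d) * w j) z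
        + 2 * of_real 0 * cnj c * z i)"
      by (rule partial_deriv_psh_model[OF holo_on_psh_model_deriv[OF U h ij(2)] z ij(1)])
    also have "\<dots> = Re (c * (d * cderiv i (cderiv j h) z + 2 * of_real k * cnj d * (if i = j then 1 else 0)))"
      by (subst cderiv_affine[OF cderiv_holo_on[OF U h ij(2)] z ij(1)]) simp
    finally show ?thesis .
  qed
  then show "complex_hessian N (\<lambda>w. Re (h w) + k * nsq N w) z $$ (i, j) = (of_real k \<cdot>\<^sub>m 1\<^sub>m N) $$ (i, j)"
    using ij by (subst complex_hessian_entry[OF U Ck_on_psh_model[OF U h] z])
      (auto simp: complex_eq_iff)
qed (auto simp: complex_hessian_def)

lemma num_pos_eigenvalues_scalar:
  assumes "k > 0"
  shows "num_pos_eigenvalues (complex_of_real k \<cdot>\<^sub>m 1\<^sub>m N) = N"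
\<comment> \<open>In dimension 0 there is no eigenvector, so the set of positive eigenvalues is
  empty rather than {k}.\<close>
proof (cases "N = 0")
  case True
  then have "\<not> eigenvalue (complex_of_real k \<cdot>\<^sub>m 1\<^sub>m N) l" for l
    unfolding eigenvalue_def eigenvector_def by auto
  then show ?thesis using True by (simp add: num_pos_eigenvalues_def)
next
  case False
  let ?M = "complex_of_real k \<cdot>\<^sub>m 1\<^sub>m N"
  have M: "?M \<in> carrier_mat N N" by simp
  have "char_poly ?M = (\<Prod>a\<leftarrow>diag_mat ?M. [:- a, 1:])"
    by (rule char_poly_upper_triangular[OF M]) auto
  also have "diag_mat ?M = replicate N (complex_of_real k)"
    by (auto simp: diag_mat_def intro: nth_equalityI)
  finally have cp: "char_poly ?M = [:- complex_of_real k, 1:] ^ N" by simp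
  have ev: "eigenvalue ?M l \<longleftrightarrow> l = of_real k" for l
    unfolding eigenvalue_root_char_poly[OF M] cp using False by auto
  have "{l. 0 < l \<and> eigenvalue ?M (complex_of_real l)} = {k}"
    using assms unfolding ev by auto
  then show ?thesis
    unfolding num_pos_eigenvalues_def cp by (simp add: order_power_n_n)
qed


section \<open>Derivatives along rays\<close>

lemma coord_line_add: "coord_line i c (coord_line i c z s) t = coord_line i c z (s + t)"
  by (auto simp: coord_line_def algebra_simps)

lemma coord_line_commute:
  "coord_line i c (coord_line j d z s) t = coord_line j d (coord_line i c z t) s"
  by (auto simp: coord_line_def fun_upd_def algebra_simps)

lemma coord_line_Cpts: "z \<in> Cpts N \<Longrightarrow> i < N \<Longrightarrow> coord_line i c z t \<in> Cpts N"
  by (simp add: coord_line_def fun_upd_Cpts)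

lemma coord_line_in_pdisc:
  assumes "w \<in> pdisc N z d" "i < N" "cmod c \<le> 1" "\<bar>t\<bar> \<le> e"
  shows "coord_line i c w t \<in> pdisc N z (d + e)"
proof -
  have "cmod (coord_line i c w t j - z j) < d + e" if "j < N" for j
  proof (cases "j = i")
    case True
    have "cmod (w i + of_real t * c - z i) \<le> cmod (w i - z i) + cmod (of_real t * c)"
      using norm_triangle_ineq[of "w i - z i" "of_real t * c"] by (simp add: algebra_simps)
    also have "cmod (of_real t * c) \<le> \<bar>t\<bar> * 1"
      unfolding norm_mult norm_of_real using assms(3) by (intro mult_left_mono) auto
    also have "cmod (w i - z i) < d" using assms by (simp add: pdisc_def)
    finally show ?thesis using assms(4) by (simp add: coord_line_def True)
  next
    case False
    then show ?thesis using assms that abs_ge_zero[of t] by (force simp: coord_line_def pdisc_def)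
  qed
  moreover have "coord_line i c w t \<in> Cpts N"
    using assms coord_line_Cpts pdisc_subset by blast
  ultimately show ?thesis by (simp add: pdisc_def)
qed

text \<open>Real and imaginary parts of a direction may have either sign or vanish, so the mean
  value theorem is put in a form that covers all three cases.\<close>

lemma mvt_symmetric:
  fixes g :: "real \<Rightarrow> real"
  assumes "\<And>x. \<bar>x\<bar> \<le> \<bar>s\<bar> \<Longrightarrow> (g has_real_derivative g' x) (at x)"
  obtains x where "\<bar>x\<bar> \<le> \<bar>s\<bar>" "g s - g 0 = s * g' x"
proof -
  consider "s = 0" | "s > 0" | "s < 0" by linarith
  then show ?thesis
  proof cases
    case 1
    then show ?thesis using that[of 0] by simp
  next
    case 2
    then obtain x where "0 < x" "x < s" "g s - g 0 = (s - 0) * g' x"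
      using MVT2[of 0 s g g'] assms by auto
    then show ?thesis using that[of x] by auto
  next
    case 3
    then obtain x where "s < x" "x < 0" "g 0 - g s = (0 - s) * g' x"
      using MVT2[of s 0 g g'] assms by auto
    then show ?thesis using that[of x] by (auto simp: algebra_simps)
  qed
qed

text \<open>The bound on \<open>cmod c\<close> makes a step of parameter \<open>t\<close> move the
  point by at most |t|, as the polydisc estimates require.\<close>

definition C1_dir ::
    "nat \<Rightarrow> (nat \<Rightarrow> complex) set \<Rightarrow> nat \<Rightarrow> complex \<Rightarrow> ((nat \<Rightarrow> complex) \<Rightarrow> real) \<Rightarrow> bool" where
  "C1_dir N U i c f \<longleftrightarrow> i < N \<and> cmod c \<le> 1 \<and>
     (\<forall>z\<in>U. (\<lambda>t. f (coord_line i c z t)) differentiable (at 0)) \<and>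
     continuous_on U (partial_deriv i c f)"

lemma coord_line_DERIV:
  assumes "C1_dir N U i c f" "coord_line i c z s \<in> U"
  shows "((\<lambda>t. f (coord_line i c z t)) has_real_derivative
    partial_deriv i c f (coord_line i c z s)) (at s)"
proof -
  have "((\<lambda>t. f (coord_line i c (coord_line i c z s) t)) has_real_derivative
    partial_deriv i c f (coord_line i c z s)) (at 0)"
    using assms by (intro partial_deriv_has_real_derivative) (auto simp: C1_dir_def)
  then show ?thesis
    using DERIV_shift[of "\<lambda>t. f (coord_line i c z t)" _ 0 s] by (simp add: coord_line_add add.commute)
qed

lemma coord_line_mvt:
  assumes "C1_dir N U i c f" "w \<in> pdisc N z d" "pdisc N z (d + \<bar>s\<bar>) \<subseteq> U"
  obtains x where "\<bar>x\<bar> \<le> \<bar>s\<bar>"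
    "f (coord_line i c w s) - f w = s * partial_deriv i c f (coord_line i c w x)"
proof -
  have "((\<lambda>t. f (coord_line i c w t)) has_real_derivative
      partial_deriv i c f (coord_line i c w x)) (at x)" if "\<bar>x\<bar> \<le> \<bar>s\<bar>" for x
  proof (rule coord_line_DERIV[OF assms(1)])
    show "coord_line i c w x \<in> U"
      using coord_line_in_pdisc[OF assms(2), of i c x "\<bar>s\<bar>"] assms(1,3) that by (auto simp: C1_dir_def)
  qed
  then show ?thesis
    by (rule mvt_symmetric[of s "\<lambda>t. f (coord_line i c w t)"
      "\<lambda>x. partial_deriv i c f (coord_line i c w x)"]) (use that in auto)
qed

text \<open>The mean value theorem turns the quotient into a partial derivative at a point near
  \<open>z\<close>, where continuity applies. The base point \<open>a t\<close> moves with
  \<open>t\<close> because the lemma is applied along a chain of coordinate steps.\<close>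

lemma increment_tendsto:
  assumes U: "openin (Cspace N) U" and f: "C1_dir N U i c f" and z: "z \<in> U"
    and a: "\<And>t. a t \<in> Cpts N" "\<And>j. j < N \<Longrightarrow> ((\<lambda>t. a t j) \<longlongrightarrow> z j) (at (0::real))"
  shows "((\<lambda>t. (f (coord_line i c (a t) (t * r)) - f (a t)) / t) \<longlongrightarrow> r * partial_deriv i c f z) (at 0)"
proof (rule tendstoI)
  fix e :: real assume e: "e > 0"
  \<comment> \<open>The extra 1 covers r = 0 and makes |r| e' strictly less than e.\<close>
  define e' where "e' = e / (\<bar>r\<bar> + 1)"
  have e': "e' > 0" using e by (simp add: e'_def)
  have UC: "U \<subseteq> Cpts N" using openin_subset[OF U] by simp
  obtain d1 where d1: "d1 > 0" "pdisc N z d1 \<subseteq> U" using openin_Cspace_pdisc[OF U z] by blast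
  obtain d2 where d2: "d2 > 0"
    "\<And>w. w \<in> U \<inter> pdisc N z d2 \<Longrightarrow> dist (partial_deriv i c f w) (partial_deriv i c f z) < e'"
    using f z e' unfolding C1_dir_def continuous_on_Cpts_iff[OF UC] by blast
  define d where "d = min d1 d2 / 2"
  have d: "d > 0" "pdisc N z (d + d) \<subseteq> U \<inter> pdisc N z d2"
    using d1 d2 pdisc_mono[of "d + d" d1 N z] pdisc_mono[of "d + d" d2 N z] by (auto simp: d_def)
  have "\<forall>\<^sub>F t in at (0::real). \<forall>j\<in>{..<N}. dist (a t j) (z j) < d"
    by (rule eventually_ball_finite) (use tendstoD[OF a(2) d(1)] in auto)
  moreover have "((\<lambda>t::real. \<bar>t * r\<bar>) \<longlongrightarrow> \<bar>0 * r\<bar>) (at 0)"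
    by (intro tendsto_intros)
  then have "\<forall>\<^sub>F t in at (0::real). \<bar>t * r\<bar> < d"
    using d by (intro order_tendstoD(2)) auto
  moreover have "\<forall>\<^sub>F t in at (0::real). t \<noteq> 0" by (simp add: eventually_at_filter)
  ultimately show "\<forall>\<^sub>F t in at 0. dist ((f (coord_line i c (a t) (t * r)) - f (a t)) / t)
      (r * partial_deriv i c f z) < e"
  proof eventually_elim
    case (elim t)
    have at: "a t \<in> pdisc N z d" using elim(1) a(1) by (simp add: pdisc_def dist_norm)
    have "pdisc N z (d + \<bar>t * r\<bar>) \<subseteq> U"
      using d(2) elim(2) pdisc_mono[of "d + \<bar>t * r\<bar>" "d + d" N z] by auto
    then obtain x where x: "\<bar>x\<bar> \<le> \<bar>t * r\<bar>"
      "f (coord_line i c (a t) (t * r)) - f (a t) = t * r * partial_deriv i c f (coord_line i c (a t) x)"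
      using coord_line_mvt[OF f at] by blast
    have "coord_line i c (a t) x \<in> pdisc N z (d + d)"
      by (rule coord_line_in_pdisc[OF at]) (use f x(1) elim(2) in \<open>auto simp: C1_dir_def\<close>)
    then have "dist (partial_deriv i c f (coord_line i c (a t) x)) (partial_deriv i c f z) < e'"
      using d2(2) d(2) by blast
    then have "\<bar>r\<bar> * \<bar>partial_deriv i c f (coord_line i c (a t) x) - partial_deriv i c f z\<bar> \<le> \<bar>r\<bar> * e'"
      by (intro mult_left_mono) (auto simp: dist_real_def)
    also have "\<dots> < e" using e by (simp add: e'_def field_simps)
    finally have "\<bar>r * (partial_deriv i c f (coord_line i c (a t) x) - partial_deriv i c f z)\<bar> < e"
      by (simp add: abs_mult)
    then show ?case using elim(3) x(2) by (simp add: dist_real_def algebra_simps)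
  qed
qed

definition ray :: "(nat \<Rightarrow> complex) \<Rightarrow> (nat \<Rightarrow> complex) \<Rightarrow> real \<Rightarrow> nat \<Rightarrow> complex" where
  "ray z v t = (\<lambda>j. z j + of_real t * v j)"

definition dir_deriv :: "nat \<Rightarrow> ((nat \<Rightarrow> complex) \<Rightarrow> real) \<Rightarrow> (nat \<Rightarrow> complex) \<Rightarrow> (nat \<Rightarrow> complex) \<Rightarrow> real" where
  "dir_deriv N f v z =
     (\<Sum>i<N. Re (v i) * partial_deriv i 1 f z + Im (v i) * partial_deriv i \<i> f z)"

text \<open>Continuous partial derivatives give the derivative along any ray: the displacement is
  split into 2 N steps, one for the real and one for the imaginary part of each coordinate, and each
  step is a case of \<open>increment_tendsto\<close>.\<close>

lemma ray_tendsto: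
  assumes U: "openin (Cspace N) U" and z: "z \<in> U" and v: "v \<in> Cpts N"
    and f: "\<And>i c. i < N \<Longrightarrow> c \<in> {1, \<i>} \<Longrightarrow> C1_dir N U i c f"
  shows "((\<lambda>t. (f (ray z v t) - f z) / t) \<longlongrightarrow> dir_deriv N f v z) (at 0)"
proof -
  have zC: "z \<in> Cpts N" using openin_subset[OF U] z by auto
  define a where "a k t = (\<lambda>j. if j < k then z j + of_real t * v j else z j)" for k :: nat and t :: real
  have aC: "a k t \<in> Cpts N" for k t using zC v by (auto simp: a_def Cpts_def)
  have alim: "((\<lambda>t. a k t j) \<longlongrightarrow> z j) (at 0)" for k j
  proof (cases "j < k")
    case True
    have "((\<lambda>t. z j + of_real t * v j) \<longlongrightarrow> z j + of_real 0 * v j) (at 0)"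
      by (intro tendsto_intros)
    then show ?thesis using True by (simp add: a_def)
  qed (simp add: a_def)
  have "((\<lambda>t. (f (a k t) - f z) / t) \<longlongrightarrow>
      (\<Sum>i<k. Re (v i) * partial_deriv i 1 f z + Im (v i) * partial_deriv i \<i> f z)) (at 0)"
    if "k \<le> N" for k
    using that
  proof (induction k)
    case 0
    then show ?case by (simp add: a_def)
  next
    case (Suc k)
    \<comment> \<open>Halfway through step \<open>k\<close>: the real part of coordinate
      \<open>k\<close> has been moved, the imaginary part not yet.\<close>
    define b where "b t = coord_line k 1 (a k t) (t * Re (v k))" for t
    have k: "k < N" using Suc by simp
    have bC: "b t \<in> Cpts N" for t unfolding b_def by (rule coord_line_Cpts[OF aC k])
    have blim: "((\<lambda>t. b t j) \<longlongrightarrow> z j) (at 0)" for j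
    proof (cases "j = k")
      case True
      have "((\<lambda>t. a k t k + of_real (t * Re (v k)) * 1) \<longlongrightarrow> z k + of_real (0 * Re (v k)) * 1) (at 0)"
        by (intro tendsto_intros alim)
      then show ?thesis using True by (simp add: b_def coord_line_def)
    next
      case False
      then show ?thesis using alim by (simp add: b_def coord_line_def)
    qed
    have ab: "a (Suc k) t = coord_line k \<i> (b t) (t * Im (v k))" for t
      by (rule ext) (auto simp: a_def b_def coord_line_def less_Suc_eq complex_eq_iff algebra_simps)
    have "((\<lambda>t. (f (a k t) - f z) / t + (f (coord_line k 1 (a k t) (t * Re (v k))) - f (a k t)) / t
        + (f (coord_line k \<i> (b t) (t * Im (v k))) - f (b t)) / t) \<longlongrightarrow>
      (\<Sum>i<k. Re (v i) * partial_deriv i 1 f z + Im (v i) * partial_deriv i \<i> f z)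
        + Re (v k) * partial_deriv k 1 f z + Im (v k) * partial_deriv k \<i> f z) (at 0)"
      by (intro tendsto_add Suc.IH increment_tendsto[OF U f z] aC bC alim blim)
        (use Suc.prems in auto)
    then show ?case
      unfolding ab[symmetric] b_def[symmetric]
      by (simp add: add_divide_distrib[symmetric] add.assoc)
  qed
  from this[of N] have "((\<lambda>t. (f (a N t) - f z) / t) \<longlongrightarrow> dir_deriv N f v z) (at 0)"
    by (simp add: dir_deriv_def)
  moreover have "a N t = ray z v t" for t
    using zC v by (auto simp: a_def ray_def Cpts_def)
  ultimately show ?thesis by simp
qed

lemma ray_DERIV:
  assumes U: "openin (Cspace N) U" and z: "ray z v t \<in> U" and v: "v \<in> Cpts N"
    and f: "\<And>i c. i < N \<Longrightarrow> c \<in> {1, \<i>} \<Longrightarrow> C1_dir N U i c f"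
  shows "((\<lambda>s. f (ray z v s)) has_real_derivative dir_deriv N f v (ray z v t)) (at t)"
proof -
  have "ray (ray z v t) v h = ray z v (t + h)" for h
    by (simp add: ray_def algebra_simps)
  then show ?thesis
    using ray_tendsto[OF U z v f] by (simp add: DERIV_def)
qed

section \<open>Symmetry of second partial derivatives\<close>

lemma Ck_on_2_C1_dir:
  assumes "openin (Cspace N) U" "Ck_on 2 N U \<phi>" "i < N" "c \<in> {1, \<i>}"
  shows "C1_dir N U i c \<phi>"
    and "j < N \<Longrightarrow> d \<in> {1, \<i>} \<Longrightarrow> C1_dir N U j d (partial_deriv i c \<phi>)"
proof -
  have UC: "U \<subseteq> Cpts N" using openin_subset[OF assms(1)] by simp
  show "C1_dir N U i c \<phi>"
    and "j < N \<Longrightarrow> d \<in> {1, \<i>} \<Longrightarrow> C1_dir N U j d (partial_deriv i c \<phi>)"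
    using assms by (auto simp: C1_dir_def numeral_2_eq_2 continuous_Cspace[OF UC])
qed

text \<open>Schwarz's argument: the mean value theorem in direction \<open>c\<close> and then in
  direction \<open>d\<close> turns the second difference into s^2 times the mixed derivative at a
  point close to \<open>z\<close>.\<close>

lemma second_difference_tendsto:
  assumes U: "openin (Cspace N) U" and \<phi>: "Ck_on 2 N U \<phi>" and z: "z \<in> U"
    and i: "i < N" "c \<in> {1, \<i>}" and j: "j < N" "d \<in> {1, \<i>}"
  shows "((\<lambda>s. (\<phi> (coord_line i c (coord_line j d z s) s) - \<phi> (coord_line i c z s)
      - \<phi> (coord_line j d z s) + \<phi> z) / s\<^sup>2) \<longlongrightarrow> partial_deriv j d (partial_deriv i c \<phi>) z) (at 0)"
proof (rule tendstoI)
  fix e :: real assume e: "e > 0"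
  let ?\<phi>2 = "partial_deriv j d (partial_deriv i c \<phi>)"
  have UC: "U \<subseteq> Cpts N" using openin_subset[OF U] by simp
  have zC: "z \<in> Cpts N" using UC z by auto
  note C1 = Ck_on_2_C1_dir(1)[OF U \<phi> i] and C2 = Ck_on_2_C1_dir(2)[OF U \<phi> i j]
  obtain d1 where d1: "d1 > 0" "pdisc N z d1 \<subseteq> U" using openin_Cspace_pdisc[OF U z] by blast
  obtain d2 where d2: "d2 > 0"
    "\<And>w. w \<in> U \<inter> pdisc N z d2 \<Longrightarrow> dist (?\<phi>2 w) (?\<phi>2 z) < e"
    using C2 z e unfolding C1_dir_def continuous_on_Cpts_iff[OF UC] by blast
  \<comment> \<open>One third: the centre is placed in the polydisc of radius \<delta>, and two
    moves of size at most \<delta> follow.\<close>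
  define \<delta> where "\<delta> = min d1 d2 / 3"
  have \<delta>: "\<delta> > 0" "pdisc N z (\<delta> + \<delta> + \<delta>) \<subseteq> U \<inter> pdisc N z d2"
    using d1 d2 pdisc_mono[of "\<delta> + \<delta> + \<delta>" d1 N z] pdisc_mono[of "\<delta> + \<delta> + \<delta>" d2 N z]
    by (auto simp: \<delta>_def)
  have "((\<lambda>s::real. \<bar>s\<bar>) \<longlongrightarrow> \<bar>0\<bar>) (at 0)"
    by (intro tendsto_intros)
  then have "\<forall>\<^sub>F s in at (0::real). \<bar>s\<bar> < \<delta>"
    using \<delta> by (intro order_tendstoD(2)) auto
  moreover have "\<forall>\<^sub>F s in at (0::real). s \<noteq> 0" by (simp add: eventually_at_filter)
  ultimately show "\<forall>\<^sub>F s in at 0. dist ((\<phi> (coord_line i c (coord_line j d z s) s) -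
      \<phi> (coord_line i c z s) - \<phi> (coord_line j d z s) + \<phi> z) / s\<^sup>2) (?\<phi>2 z) < e"
  proof eventually_elim
    case (elim s)
    have cd: "cmod c \<le> 1" "cmod d \<le> 1" using i j by auto
    have z0: "z \<in> pdisc N z \<delta>" using zC \<delta> by (intro centre_in_pdisc)
    have line: "coord_line i c z x \<in> pdisc N z (\<delta> + \<delta>)"
      "coord_line i c (coord_line j d z s) x \<in> U" if "\<bar>x\<bar> \<le> \<bar>s\<bar>" for x
      using coord_line_in_pdisc[OF z0 i(1) cd(1), of x \<delta>]
        coord_line_in_pdisc[OF coord_line_in_pdisc[OF z0 j(1) cd(2), of s \<delta>] i(1) cd(1), of x \<delta>]
        that elim \<delta> by auto
    have sub: "pdisc N z (\<delta> + \<delta>) \<subseteq> U"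
      using \<delta> pdisc_mono[of "\<delta> + \<delta>" "\<delta> + \<delta> + \<delta>" N z] by auto
    have "((\<lambda>t. \<phi> (coord_line i c (coord_line j d z s) t) - \<phi> (coord_line i c z t))
      has_real_derivative partial_deriv i c \<phi> (coord_line i c (coord_line j d z s) x)
        - partial_deriv i c \<phi> (coord_line i c z x)) (at x)" if "\<bar>x\<bar> \<le> \<bar>s\<bar>" for x
      using line[OF that] sub by (intro DERIV_diff coord_line_DERIV[OF C1]) auto
    then obtain x where x: "\<bar>x\<bar> \<le> \<bar>s\<bar>"
      "\<phi> (coord_line i c (coord_line j d z s) s) - \<phi> (coord_line i c z s)
        - (\<phi> (coord_line i c (coord_line j d z s) 0) - \<phi> (coord_line i c z 0))
      = s * (partial_deriv i c \<phi> (coord_line i c (coord_line j d z s) x)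
        - partial_deriv i c \<phi> (coord_line i c z x))"
      by (rule mvt_symmetric)
    have "pdisc N z (\<delta> + \<delta> + \<bar>s\<bar>) \<subseteq> U"
      using \<delta>(2) elim pdisc_mono[of "\<delta> + \<delta> + \<bar>s\<bar>" "\<delta> + \<delta> + \<delta>" N z] by auto
    then obtain y where y: "\<bar>y\<bar> \<le> \<bar>s\<bar>"
      "partial_deriv i c \<phi> (coord_line j d (coord_line i c z x) s) - partial_deriv i c \<phi> (coord_line i c z x)
      = s * ?\<phi>2 (coord_line j d (coord_line i c z x) y)"
      using coord_line_mvt[OF C2 line(1)[OF x(1)]] by blast
    have "\<phi> (coord_line i c (coord_line j d z s) s) - \<phi> (coord_line i c z s)
        - \<phi> (coord_line j d z s) + \<phi> z = s\<^sup>2 * ?\<phi>2 (coord_line j d (coord_line i c z x) y)"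
      using x(2) y(2) unfolding coord_line_commute[of i c j d z s x]
      by (simp add: power2_eq_square)
    moreover have "coord_line j d (coord_line i c z x) y \<in> pdisc N z (\<delta> + \<delta> + \<delta>)"
      by (rule coord_line_in_pdisc[OF line(1)[OF x(1)] j(1) cd(2)]) (use y elim in auto)
    then have "dist (?\<phi>2 (coord_line j d (coord_line i c z x) y)) (?\<phi>2 z) < e"
      using d2 \<delta> by blast
    ultimately show ?case using elim by simp
  qed
qed

text \<open>The second difference is symmetric in the two directions, and limits are unique.\<close>

lemma partial_deriv_commute:
  fixes \<phi> :: "(nat \<Rightarrow> complex) \<Rightarrow> real"
  assumes U: "openin (Cspace N) U" and \<phi>: "Ck_on 2 N U \<phi>" and z: "z \<in> U"
    and i: "i < N" "c \<in> {1, \<i>}" and j: "j < N" "d \<in> {1, \<i>}"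
  shows "partial_deriv j d (partial_deriv i c \<phi>) z = partial_deriv i c (partial_deriv j d \<phi>) z"
proof (rule tendsto_unique[OF _ second_difference_tendsto[OF assms]])
  show "((\<lambda>s. (\<phi> (coord_line i c (coord_line j d z s) s) - \<phi> (coord_line i c z s)
      - \<phi> (coord_line j d z s) + \<phi> z) / s\<^sup>2) \<longlongrightarrow> partial_deriv i c (partial_deriv j d \<phi>) z) (at 0)"
    using second_difference_tendsto[OF U \<phi> z j i]
    by (simp add: coord_line_commute[of i c j d] algebra_simps)
qed simp

lemma complex_hessian_hermitian:
  assumes U: "openin (Cspace N) U" and \<phi>: "Ck_on 2 N U \<phi>" and z: "z \<in> U" and ij: "i < N" "j < N"
  shows "complex_hessian N \<phi> z $$ (j, i) = cnj (complex_hessian N \<phi> z $$ (i, j))"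
  using ij partial_deriv_commute[OF U \<phi> z ij(1) _ ij(2)]
  by (simp add: complex_hessian_entry[OF U \<phi> z] complex_eq_iff)


section \<open>Hermitian forms and the second-order expansion\<close>

definition hform :: "nat \<Rightarrow> complex mat \<Rightarrow> (nat \<Rightarrow> complex) \<Rightarrow> (nat \<Rightarrow> complex) \<Rightarrow> complex" where
  "hform N M v w = (\<Sum>i<N. \<Sum>j<N. M $$ (i, j) * v i * cnj (w j))"

text \<open>The conjugation falls on the fixed vector, which makes this holomorphic in
  \<open>w\<close>.\<close>

definition inner_to :: "nat \<Rightarrow> (nat \<Rightarrow> complex) \<Rightarrow> (nat \<Rightarrow> complex) \<Rightarrow> complex" where
  "inner_to N a w = (\<Sum>i<N. w i * cnj (a i))"

lemma nsq_nonneg: "0 \<le> nsq N v"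
  by (simp add: nsq_def sum_nonneg)

lemma cmod_le_nsq: "i < N \<Longrightarrow> (cmod (v i))\<^sup>2 \<le> nsq N v"
  unfolding nsq_def by (intro member_le_sum) auto

lemma nsq_add_scaled:
  "nsq N (\<lambda>i. v i + of_real t * w i) = nsq N v + 2 * Re (inner_to N v w) * t + nsq N w * t\<^sup>2"
proof -
  have "nsq N (\<lambda>i. v i + of_real t * w i) =
      (\<Sum>i<N. (cmod (v i))\<^sup>2 + 2 * Re (w i * cnj (v i)) * t + (cmod (w i))\<^sup>2 * t\<^sup>2)"
    unfolding nsq_def cmod_add_scaled_square by (intro sum.cong) (auto simp: algebra_simps)
  also have "\<dots> = nsq N v + 2 * Re (inner_to N v w) * t + nsq N w * t\<^sup>2"
    unfolding nsq_def inner_to_def Re_sum sum.distrib sum_distrib_left sum_distrib_right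
    by simp
  finally show ?thesis .
qed

text \<open>Moving the centre of |w|^2 to \<open>a\<close> costs only a constant and the real part
  of the holomorphic function \<open>inner_to N a\<close>. Every recentring of a peak rests on
  this.\<close>

lemma nsq_diff:
  "nsq N (\<lambda>i. w i - a i) = nsq N w - nsq N a - 2 * (Re (inner_to N a w) - Re (inner_to N a a))"
proof -
  have "nsq N w = nsq N (\<lambda>i. a i + of_real 1 * (w i - a i))" by simp
  also have "\<dots> = nsq N a + 2 * Re (inner_to N a (\<lambda>i. w i - a i)) + nsq N (\<lambda>i. w i - a i)"
    by (subst nsq_add_scaled) simp
  also have "inner_to N a (\<lambda>i. w i - a i) = inner_to N a w - inner_to N a a"
    by (simp add: inner_to_def sum_subtractf left_diff_distrib)
  finally show ?thesis by simp
qed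

lemma holo_on_inner_to: "U \<subseteq> Cpts N \<Longrightarrow> holo_on N U (inner_to N a)"
  unfolding inner_to_def[abs_def]
  by (intro holo_on_sum holo_on_mult holo_on_const holo_on_coord)

lemma hform_add_scaled:
  "Re (hform N M (\<lambda>i. v i + of_real t * w i) (\<lambda>i. v i + of_real t * w i)) =
    Re (hform N M v v) + (Re (hform N M w v) + Re (hform N M v w)) * t + Re (hform N M w w) * t\<^sup>2"
proof -
  have "hform N M (\<lambda>i. v i + of_real t * w i) (\<lambda>i. v i + of_real t * w i) =
    hform N M v v + (hform N M w v + hform N M v w) * of_real t + hform N M w w * of_real (t\<^sup>2)"
    unfolding hform_def sum_distrib_right sum.distrib[symmetric]
    by (intro sum.cong refl) (simp add: algebra_simps power2_eq_square)
  then show ?thesis by (simp del: of_real_power)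
qed

lemma hform_hermitian:
  assumes "\<And>i j. i < N \<Longrightarrow> j < N \<Longrightarrow> M $$ (j, i) = cnj (M $$ (i, j))"
  shows "hform N M v w = cnj (hform N M w v)"
proof -
  have "cnj (hform N M w v) = (\<Sum>i<N. \<Sum>j<N. M $$ (j, i) * v j * cnj (w i))"
    unfolding hform_def cnj_sum by (intro sum.cong refl) (simp add: assms[symmetric] mult.commute mult.left_commute)
  also have "\<dots> = hform N M v w" unfolding hform_def by (rule sum.swap)
  finally show ?thesis by simp
qed

text \<open>Minimum of the Rayleigh quotient, attained on the compact unit sphere and extended by
  homogeneity.\<close>

lemma hform_min:
  assumes "N > 0"
  obtains v where "v \<in> Cpts N" "nsq N v = 1"
    "\<And>w. Re (hform N M v v) * nsq N w \<le> Re (hform N M w w)"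
proof -
  define S where "S = {w \<in> Cpts N. nsq N w = 1}"
  have "S = cpdisc N (\<lambda>_. 0) 1 \<inter> nsq N -` {1}"
  proof -
    have "cmod (w i) \<le> 1" if "nsq N w = 1" "i < N" for w i
      using cmod_le_nsq[OF that(2), of w] that(1) by (simp add: power_le_one_iff abs_square_le_1)
    then show ?thesis by (auto simp: S_def cpdisc_def)
  qed
  moreover have "closed (nsq N -` {1})"
    using continuous_on_nsq[of UNIV N] by (intro closed_vimage closed_singleton)
  ultimately have "compact S" using compact_cpdisc by (simp add: compact_Int_closed)
  moreover have "(\<lambda>i. if i = 0 then 1 else 0) \<in> S"
  proof -
    have "nsq N (\<lambda>i. if i = 0 then 1 else 0) = (\<Sum>i<N. if i = 0 then 1 else 0)"
      unfolding nsq_def by (intro sum.cong) auto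
    then show ?thesis using assms by (simp add: S_def Cpts_def)
  qed
  then have "S \<noteq> {}" by blast
  moreover have "continuous_on S (\<lambda>w. Re (hform N M w w))"
    unfolding hform_def by (intro continuous_intros continuous_on_proj)
  ultimately obtain v where v: "v \<in> S" "\<And>w. w \<in> S \<Longrightarrow> Re (hform N M v v) \<le> Re (hform N M w w)"
    using continuous_attains_inf[of S "\<lambda>w. Re (hform N M w w)"] by auto
  have "Re (hform N M v v) * nsq N w \<le> Re (hform N M w w)" for w
  proof (cases "nsq N w = 0")
    case True
    then have "\<forall>i<N. w i = 0" unfolding nsq_def by (subst (asm) sum_nonneg_eq_0_iff) auto
    then show ?thesis using True by (simp add: hform_def)
  next
    case False
    define s where "s = sqrt (nsq N w)"
    have s: "s > 0" "s\<^sup>2 = nsq N w" using False nsq_nonneg[of N w] by (auto simp: s_def)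
    \<comment> \<open>Entries of \<open>w\<close> from index \<open>N\<close> on are ignored by the
      form; they are cut off to land in \<open>Cpts N\<close>.\<close>
    define w' where "w' i = (if i < N then w i / of_real s else 0)" for i
    have "nsq N w' = nsq N w / s\<^sup>2"
      unfolding nsq_def sum_divide_distrib
      by (intro sum.cong) (use s in \<open>auto simp: w'_def norm_divide power_divide\<close>)
    then have "w' \<in> S" using s False by (auto simp: S_def Cpts_def w'_def)
    then have "Re (hform N M v v) \<le> Re (hform N M w' w')" by (rule v(2))
    also have "hform N M w' w' = hform N M w w / of_real (s\<^sup>2)"
      unfolding hform_def sum_divide_distrib
      by (intro sum.cong refl) (use s(1) in \<open>auto simp: w'_def power2_eq_square\<close>)
    finally have "Re (hform N M v v) \<le> Re (hform N M w w) / nsq N w"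
      unfolding s(2) Re_divide_of_real .
    moreover have "nsq N w > 0" using False nsq_nonneg[of N w] by linarith
    ultimately show ?thesis by (simp add: pos_le_divide_eq)
  qed
  then show ?thesis using that[of v] v(1) by (simp add: S_def)
qed

lemma quadratic_nonneg_linear_zero:
  fixes a b :: real
  assumes "\<And>t. 0 \<le> b * t + a * t\<^sup>2"
  shows "b = 0"
proof (rule ccontr)
  assume "b \<noteq> 0"
  define m where "m = \<bar>a\<bar> + 1"
  have m: "m > 0" by (simp add: m_def)
  \<comment> \<open>The test point minimises b t + m t^2, whose leading coefficient is positive and
    dominates \<open>a\<close>.\<close>
  have "0 \<le> b * (- b / (2 * m)) + a * (- b / (2 * m))\<^sup>2" by (rule assms)
  also have "\<dots> \<le> b * (- b / (2 * m)) + m * (- b / (2 * m))\<^sup>2"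
    by (intro add_left_mono mult_right_mono) (auto simp: m_def)
  also have "\<dots> = - (b\<^sup>2 / (4 * m))" using m by (simp add: field_simps power2_eq_square)
  also have "\<dots> < 0" using m \<open>b \<noteq> 0\<close> by simp
  finally show False by simp
qed

text \<open>First variation at a minimiser: along every direction \<open>w\<close> the linear term
  of a nonnegative quadratic in \<open>t\<close> vanishes. Multiples of the unit vectors then
  recover the eigenvalue equation row by row.\<close>

lemma hermitian_min_eigenvalue:
  assumes M: "M \<in> carrier_mat N N"
    and herm: "\<And>i j. i < N \<Longrightarrow> j < N \<Longrightarrow> M $$ (j, i) = cnj (M $$ (i, j))"
    and v: "nsq N v = 1" and min: "\<And>w. Re (hform N M v v) * nsq N w \<le> Re (hform N M w w)"
  shows "eigenvalue M (of_real (Re (hform N M v v)))"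
proof -
  define l where "l = Re (hform N M v v)"
  have sym: "Re (hform N M v w) = Re (hform N M w v)" for w
    by (simp add: hform_hermitian[OF herm, where v = v and w = w])
  have Re_eq: "Re (hform N M w v) = l * Re (inner_to N v w)" for w
  proof -
    have "0 \<le> (2 * Re (hform N M w v) - 2 * l * Re (inner_to N v w)) * t
        + (Re (hform N M w w) - l * nsq N w) * t\<^sup>2" for t
      using min[of "\<lambda>i. v i + of_real t * w i"] v sym[of w]
      unfolding hform_add_scaled nsq_add_scaled
      by (simp add: algebra_simps l_def)
    then have "2 * Re (hform N M w v) - 2 * l * Re (inner_to N v w) = 0"
      by (rule quadratic_nonneg_linear_zero)
    then show ?thesis by simp
  qed
  have row: "(\<Sum>j<N. M $$ (i, j) * cnj (v j)) = of_real l * cnj (v i)" if i: "i < N" for i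
  proof -
    let ?s = "\<Sum>j<N. M $$ (i, j) * cnj (v j)"
    have "Re (d * ?s) = l * Re (d * cnj (v i))" for d
    proof -
      let ?w = "\<lambda>k. if k = i then d else 0"
      have "hform N M ?w v = (\<Sum>k<N. if k = i then d * (\<Sum>j<N. M $$ (k, j) * cnj (v j)) else 0)"
        unfolding hform_def by (intro sum.cong) (auto simp: sum_distrib_left algebra_simps)
      then have "hform N M ?w v = d * ?s" using i by (simp add: sum.delta)
      moreover have "inner_to N v ?w = (\<Sum>k<N. if k = i then d * cnj (v k) else 0)"
        unfolding inner_to_def by (intro sum.cong) auto
      then have "inner_to N v ?w = d * cnj (v i)" using i by (simp add: sum.delta)
      ultimately show ?thesis using Re_eq[of ?w] by simp
    qed
    \<comment> \<open>The choice d = 1 compares real parts, d = \<i> imaginary parts.\<close>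
    from this[of 1] this[of "\<i>"] show ?thesis by (simp add: complex_eq_iff)
  qed
  \<comment> \<open>\<open>hform\<close> conjugates the variable of the column index, so the
    eigenvector is the conjugate of \<open>v\<close>.\<close>
  define x where "x = Matrix.vec N (\<lambda>j. cnj (v j))"
  have "M *\<^sub>v x = of_real l \<cdot>\<^sub>v x"
    using M row by (intro eq_vecI) (auto simp: x_def scalar_prod_def atLeast0LessThan)
  moreover have "x \<noteq> 0\<^sub>v N"
  proof
    assume "x = 0\<^sub>v N"
    then have "cnj (v i) = 0" if "i < N" for i
      using that index_vec[of i N "\<lambda>j. cnj (v j)"] index_zero_vec(1)[of i N] by (simp add: x_def)
    then show False using v by (simp add: nsq_def)
  qed
  ultimately have "eigenvector M x (of_real l)"
    using M by (auto simp: eigenvector_def x_def)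
  then show ?thesis by (auto simp: eigenvalue_def l_def)
qed

text \<open>Powers of distinct linear factors are coprime, so their product still divides
  \<open>p\<close>.\<close>

lemma sum_order_le_degree:
  fixes p :: "'a::idom poly"
  assumes "p \<noteq> 0" "finite S"
  shows "(\<Sum>a\<in>S. order a p) \<le> degree p"
proof -
  have "(\<Prod>a\<in>S. [:- a, 1:] ^ order a p) dvd p"
    using assms(2)
  proof (induction S rule: finite_induct)
    case (insert b S)
    obtain q where q: "p = (\<Prod>a\<in>S. [:- a, 1:] ^ order a p) * q" using insert.IH by (auto simp: dvd_def)
    have "order b (\<Prod>a\<in>S. [:- a, 1:] ^ order a p) = 0"
      using insert.hyps by (intro order_0I) (auto simp: poly_prod)
    then have "order b q = order b p"
      using q assms(1) by (metis add_0 order_mult)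
    then have "[:- b, 1:] ^ order b p dvd q" using order_1[of b q] by simp
    then have "(\<Prod>a\<in>S. [:- a, 1:] ^ order a p) * [:- b, 1:] ^ order b p dvd
        (\<Prod>a\<in>S. [:- a, 1:] ^ order a p) * q"
      by (intro mult_dvd_mono dvd_refl)
    then have "(\<Prod>a\<in>S. [:- a, 1:] ^ order a p) * [:- b, 1:] ^ order b p dvd p"
      by (simp only: q[symmetric])
    then show ?case using insert.hyps by (simp add: mult.commute)
  qed simp
  then have "degree (\<Prod>a\<in>S. [:- a, 1:] ^ order a p) \<le> degree p"
    using assms(1) by (intro dvd_imp_degree_le)
  moreover have "degree (\<Prod>a\<in>S. [:- a, 1:] ^ order a p) = (\<Sum>a\<in>S. order a p)"
    by (subst degree_prod_eq_sum_degree) (auto simp: degree_linear_power)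
  ultimately show ?thesis by simp
qed

text \<open>Counted with multiplicity, the positive eigenvalues already exhaust the degree
  \<open>N\<close> of the characteristic polynomial; a further real eigenvalue would exceed
  it.\<close>

lemma all_eigenvalues_pos:
  assumes M: "M \<in> carrier_mat N N" and num: "N \<le> num_pos_eigenvalues M"
    and l: "eigenvalue M (complex_of_real l)"
  shows "l > 0"
proof (rule ccontr)
  assume neg: "\<not> l > 0"
  let ?p = "char_poly M"
  let ?E = "{r. 0 < r \<and> eigenvalue M (complex_of_real r)}"
  have deg: "degree ?p = N" and p0: "?p \<noteq> 0"
    using degree_monic_char_poly[OF M] by auto
  have "finite {r. poly ?p r = 0}" using poly_roots_finite[OF p0] .
  then have fin: "finite (complex_of_real ` ?E)"
    by (rule rev_finite_subset) (auto simp: eigenvalue_root_char_poly[OF M])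
  have lE: "complex_of_real l \<notin> complex_of_real ` ?E" using neg by auto
  have "num_pos_eigenvalues M = (\<Sum>a\<in>complex_of_real ` ?E. order a ?p)"
    unfolding num_pos_eigenvalues_def by (subst sum.reindex) (auto simp: inj_on_def)
  then have "order (complex_of_real l) ?p + N \<le> (\<Sum>a\<in>insert (complex_of_real l) (complex_of_real ` ?E). order a ?p)"
    using fin lE num by simp
  also have "\<dots> \<le> N"
    using sum_order_le_degree[OF p0, of "insert (complex_of_real l) (complex_of_real ` ?E)"] fin deg by simp
  finally have "order (complex_of_real l) ?p = 0" by simp
  then show False
    using l p0 unfolding eigenvalue_root_char_poly[OF M] by (simp add: order_root)
qed

text \<open>The least value of the form on the unit sphere is an eigenvalue, hence positive. This
  turns the eigenvalue count in the definition of pseudoconvexity into an estimate.\<close>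

lemma hermitian_pos_bound:
  assumes M: "M \<in> carrier_mat N N"
    and herm: "\<And>i j. i < N \<Longrightarrow> j < N \<Longrightarrow> M $$ (j, i) = cnj (M $$ (i, j))"
    and num: "N \<le> num_pos_eigenvalues M"
  obtains c where "c > 0" "\<And>w. c * nsq N w \<le> Re (hform N M w w)"
proof (cases "N = 0")
  case True
  then show ?thesis using that[of 1] by (simp add: nsq_def hform_def)
next
  case False
  then obtain v where v: "nsq N v = 1" "\<And>w. Re (hform N M v v) * nsq N w \<le> Re (hform N M w w)"
    using hform_min[of N M] by blast
  then show ?thesis
    using that all_eigenvalues_pos[OF M num hermitian_min_eigenvalue[OF M herm v]] by blast
qed

text \<open>Counterpart for strictly plurisubharmonic functions: positivity is given pointwise, and
  the minimum on the sphere makes it uniform.\<close>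

lemma pos_form_bound:
  assumes "\<And>w. \<exists>i<N. w i \<noteq> 0 \<Longrightarrow> 0 < Re (hform N M w w)"
  obtains c where "c > 0" "\<And>w. c * nsq N w \<le> Re (hform N M w w)"
proof (cases "N = 0")
  case True
  then show ?thesis using that[of 1] by (simp add: nsq_def hform_def)
next
  case False
  then obtain v where v: "nsq N v = 1" "\<And>w. Re (hform N M v v) * nsq N w \<le> Re (hform N M w w)"
    using hform_min[of N M] by blast
  then have "\<exists>i<N. v i \<noteq> 0" by (auto simp: nsq_def intro: ccontr)
  then show ?thesis using that assms v(2) by blast
qed

text \<open>
  Second-order Taylor expansion: the non-mixed part of the real Hessian is absorbed in the real part
  of a holomorphic polynomial, so only the Levi form has to be bounded from below.
\<close>

definition taylor_poly ::
    "nat \<Rightarrow> ((nat \<Rightarrow> complex) \<Rightarrow> real) \<Rightarrow> (nat \<Rightarrow> complex) \<Rightarrow> (nat \<Rightarrow> complex) \<Rightarrow> complex" where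
  "taylor_poly N \<phi> z v =
     (\<Sum>j<N. Complex (partial_deriv j 1 \<phi> z) (- partial_deriv j \<i> \<phi> z) * v j) +
     (\<Sum>j<N. \<Sum>i<N. Complex
        (partial_deriv i 1 (partial_deriv j 1 \<phi>) z - partial_deriv i \<i> (partial_deriv j \<i> \<phi>) z)
        (- partial_deriv i 1 (partial_deriv j \<i> \<phi>) z - partial_deriv i \<i> (partial_deriv j 1 \<phi>) z)
        / 4 * v i * v j)"

text \<open>The second derivative at t = 0 of \<phi> along the ray z + t v.\<close>

definition second_deriv ::
    "nat \<Rightarrow> ((nat \<Rightarrow> complex) \<Rightarrow> real) \<Rightarrow> (nat \<Rightarrow> complex) \<Rightarrow> (nat \<Rightarrow> complex) \<Rightarrow> real" where
  "second_deriv N \<phi> v z = (\<Sum>j<N.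
     Re (v j) * dir_deriv N (partial_deriv j 1 \<phi>) v z + Im (v j) * dir_deriv N (partial_deriv j \<i> \<phi>) v z)"

text \<open>\<open>taylor_poly\<close> has the coefficients 2 d\<phi>/dz_j and d^2\<phi>/(dz_i
  dz_j): half the real second derivative is the real part of its quadratic part plus the Levi
  form.\<close>

lemma taylor_poly_plus_levi:
  assumes U: "openin (Cspace N) U" and \<phi>: "Ck_on 2 N U \<phi>" and z: "z \<in> U"
  shows "Re (taylor_poly N \<phi> z v) + Re (hform N (complex_hessian N \<phi> z) v v) =
    dir_deriv N \<phi> v z + second_deriv N \<phi> v z / 2"
proof -
  let ?P = "\<lambda>i c j d. partial_deriv i c (partial_deriv j d \<phi>) z"
  have "Re (hform N (complex_hessian N \<phi> z) v v) =
    (\<Sum>j<N. \<Sum>i<N. Re (complex_hessian N \<phi> z $$ (i, j) * v i * cnj (v j)))"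
    unfolding hform_def Re_sum by (rule sum.swap)
  moreover have "Re (taylor_poly N \<phi> z v) = dir_deriv N \<phi> v z + (\<Sum>j<N. \<Sum>i<N. Re (Complex
        (?P i 1 j 1 - ?P i \<i> j \<i>) (- ?P i 1 j \<i> - ?P i \<i> j 1) / 4 * v i * v j))"
    unfolding taylor_poly_def plus_complex.simps Re_sum dir_deriv_def
    by (intro arg_cong2[where f = "(+)"] sum.cong refl) (simp add: algebra_simps)
  moreover have "second_deriv N \<phi> v z / 2 =
    (\<Sum>j<N. \<Sum>i<N. (Re (v j) * (Re (v i) * ?P i 1 j 1 + Im (v i) * ?P i \<i> j 1)
      + Im (v j) * (Re (v i) * ?P i 1 j \<i> + Im (v i) * ?P i \<i> j \<i>)) / 2)"
    unfolding second_deriv_def dir_deriv_def sum_distrib_left sum.distrib[symmetric] sum_divide_distrib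
    by simp
  moreover have "Re (Complex (?P i 1 j 1 - ?P i \<i> j \<i>) (- ?P i 1 j \<i> - ?P i \<i> j 1) / 4 * v i * v j)
      + Re (complex_hessian N \<phi> z $$ (i, j) * v i * cnj (v j)) =
      (Re (v j) * (Re (v i) * ?P i 1 j 1 + Im (v i) * ?P i \<i> j 1)
      + Im (v j) * (Re (v i) * ?P i 1 j \<i> + Im (v i) * ?P i \<i> j \<i>)) / 2"
    if "i < N" "j < N" for i j
    unfolding complex_hessian_entry[OF U \<phi> z that] by (simp add: field_simps)
  then have "(\<Sum>j<N. \<Sum>i<N. Re (Complex (?P i 1 j 1 - ?P i \<i> j \<i>) (- ?P i 1 j \<i> - ?P i \<i> j 1) / 4 * v i * v j)
      + Re (complex_hessian N \<phi> z $$ (i, j) * v i * cnj (v j))) =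
     (\<Sum>j<N. \<Sum>i<N. (Re (v j) * (Re (v i) * ?P i 1 j 1 + Im (v i) * ?P i \<i> j 1)
      + Im (v j) * (Re (v i) * ?P i 1 j \<i> + Im (v i) * ?P i \<i> j \<i>)) / 2)"
    by (intro sum.cong refl) auto
  ultimately show ?thesis by (simp add: sum.distrib)
qed

lemma taylor_along_ray:
  assumes U: "openin (Cspace N) U" and \<phi>: "Ck_on 2 N U \<phi>" and v: "v \<in> Cpts N"
    and ray: "\<And>t. 0 \<le> t \<Longrightarrow> t \<le> 1 \<Longrightarrow> ray z v t \<in> U"
  obtains t where "0 < t" "t < 1"
    "\<phi> (ray z v 1) = \<phi> z + dir_deriv N \<phi> v z + second_deriv N \<phi> v (ray z v t) / 2"
proof -
  \<comment> \<open>\<open>f m\<close> is the m-th derivative along the ray for m up to 2, the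
    family that the Maclaurin formula expects.\<close>
  define f where "f m t = (if m = 0 then \<phi> (ray z v t) else if m = 1 then dir_deriv N \<phi> v (ray z v t)
    else second_deriv N \<phi> v (ray z v t))" for m :: nat and t
  have "(f m has_real_derivative f (Suc m) t) (at t)" if t: "m < 2 \<and> 0 \<le> t \<and> t \<le> 1" for m t
  proof (cases "m = 0")
    case True
    have "((\<lambda>s. \<phi> (ray z v s)) has_real_derivative dir_deriv N \<phi> v (ray z v t)) (at t)"
      by (rule ray_DERIV[OF U ray v Ck_on_2_C1_dir(1)[OF U \<phi>]]) (use t in auto)
    then show ?thesis using True by (simp add: f_def[abs_def])
  next
    case False
    then have m: "m = 1" using t by simp
    have *: "((\<lambda>s. partial_deriv j c \<phi> (ray z v s)) has_real_derivative
        dir_deriv N (partial_deriv j c \<phi>) v (ray z v t)) (at t)" if "j < N" "c \<in> {1, \<i>}" for j c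
      by (rule ray_DERIV[OF U ray v Ck_on_2_C1_dir(2)[OF U \<phi> that]]) (use t in auto)
    have "((\<lambda>s. dir_deriv N \<phi> v (ray z v s)) has_real_derivative second_deriv N \<phi> v (ray z v t)) (at t)"
      unfolding dir_deriv_def[of N \<phi>] second_deriv_def
      by (intro DERIV_sum DERIV_add DERIV_cmult *) auto
    then show ?thesis using m by (simp add: f_def[abs_def])
  qed
  then obtain t where "0 < t" "t < 1"
    "f 0 1 = (\<Sum>m<2. f m 0 / fact m * 1 ^ m) + f 2 t / fact 2 * 1 ^ 2"
    using Maclaurin[of 1 2 f "f 0"] by auto
  moreover have "ray z v 0 = z" by (simp add: ray_def)
  ultimately show ?thesis using that[of t] by (simp add: f_def numeral_2_eq_2)
qed

lemma continuous_second_deriv_bound: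
  assumes U: "openin (Cspace N) U" and \<phi>: "Ck_on 2 N U \<phi>" and z: "z \<in> U" and e: "(e::real) > 0"
  obtains d where "d > 0" "pdisc N z d \<subseteq> U"
    "\<And>w i j c c'. w \<in> pdisc N z d \<Longrightarrow> i < N \<Longrightarrow> j < N \<Longrightarrow> c \<in> {1, \<i>} \<Longrightarrow> c' \<in> {1, \<i>} \<Longrightarrow>
      \<bar>partial_deriv i c (partial_deriv j c' \<phi>) w - partial_deriv i c (partial_deriv j c' \<phi>) z\<bar> \<le> e"
proof -
  have UC: "U \<subseteq> Cpts N" using openin_subset[OF U] by simp
  obtain d0 where d0: "d0 > 0" "pdisc N z d0 \<subseteq> U" using openin_Cspace_pdisc[OF U z] by blast
  define I where "I = {..<N} \<times> {..<N} \<times> {1, \<i>} \<times> {1, \<i>}"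
  let ?F = "\<lambda>(i, j, c, c') w. partial_deriv i c (partial_deriv j c' \<phi>) w"
  have "\<forall>x\<in>I. \<exists>d>0. \<forall>w\<in>U \<inter> pdisc N z d. dist (?F x w) (?F x z) < e"
  proof
    fix x assume "x \<in> I"
    obtain i j c c' where x: "x = (i, j, c, c')" "i < N" "j < N" "c \<in> {1, \<i>}" "c' \<in> {1, \<i>}"
      using \<open>x \<in> I\<close> by (auto simp: I_def)
    have "continuous_on U (partial_deriv i c (partial_deriv j c' \<phi>))"
      using Ck_on_2_C1_dir(2)[OF U \<phi> x(3,5,2,4)] by (simp add: C1_dir_def)
    then show "\<exists>d>0. \<forall>w\<in>U \<inter> pdisc N z d. dist (?F x w) (?F x z) < e"
      using z e unfolding continuous_on_Cpts_iff[OF UC] x(1) prod.case by blast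
  qed
  from bchoice[OF this] obtain d where d: "\<And>x. x \<in> I \<Longrightarrow> d x > 0"
    "\<And>x w. x \<in> I \<Longrightarrow> w \<in> U \<inter> pdisc N z (d x) \<Longrightarrow> dist (?F x w) (?F x z) < e"
    by blast
  define D where "D = Min (insert d0 (d ` I))"
  have fin: "finite (insert d0 (d ` I))" by (simp add: I_def)
  have D: "D > 0" unfolding D_def using fin d(1) d0 by (subst Min_gr_iff) auto
  have "D \<le> d x" if "x \<in> I" for x
    unfolding D_def using fin that by (auto intro: Min_le)
  moreover have "D \<le> d0" unfolding D_def using fin by (auto intro: Min_le)
  ultimately have sub: "pdisc N z D \<subseteq> U" "\<And>x. x \<in> I \<Longrightarrow> pdisc N z D \<subseteq> pdisc N z (d x)"
    using d0(2) by (meson order_trans pdisc_mono)+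
  show ?thesis
  proof (rule that[OF D sub(1)])
    fix w i j c c' assume w: "w \<in> pdisc N z D" and x: "i < N" "j < N" "c \<in> {1, \<i>}" "c' \<in> {1, \<i>}"
    have "(i, j, c, c') \<in> I" unfolding I_def by (intro SigmaI) (use x in auto)
    then have "dist (?F (i, j, c, c') w) (?F (i, j, c, c') z) < e"
      by (rule d(2)) (use w sub(1) sub(2)[OF \<open>(i, j, c, c') \<in> I\<close>] in auto)
    then show "\<bar>partial_deriv i c (partial_deriv j c' \<phi>) w - partial_deriv i c (partial_deriv j c' \<phi>) z\<bar> \<le> e"
      by (simp add: dist_real_def)
  qed
qed

text \<open>There are 4 N^2 terms, each at most e |v_i| |v_j| and hence at most e times
  \<open>nsq N v\<close>.\<close>

lemma second_deriv_diff_bound: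
  assumes "\<And>i j c c'. i < N \<Longrightarrow> j < N \<Longrightarrow> c \<in> {1, \<i>} \<Longrightarrow> c' \<in> {1, \<i>} \<Longrightarrow>
      \<bar>partial_deriv i c (partial_deriv j c' \<phi>) w - partial_deriv i c (partial_deriv j c' \<phi>) z\<bar> \<le> e"
    and e: "e \<ge> 0"
  shows "\<bar>second_deriv N \<phi> v w - second_deriv N \<phi> v z\<bar> \<le> 4 * e * (real N)\<^sup>2 * nsq N v"
proof -
  let ?P = "\<lambda>i c j d x. partial_deriv i c (partial_deriv j d \<phi>) x"
  let ?D = "\<lambda>i c j d. ?P i c j d w - ?P i c j d z"
  have eq: "second_deriv N \<phi> v w - second_deriv N \<phi> v z =
    (\<Sum>j<N. \<Sum>i<N. Re (v j) * Re (v i) * ?D i 1 j 1 + Re (v j) * Im (v i) * ?D i \<i> j 1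
      + Im (v j) * Re (v i) * ?D i 1 j \<i> + Im (v j) * Im (v i) * ?D i \<i> j \<i>)"
    unfolding second_deriv_def dir_deriv_def sum_distrib_left sum.distrib[symmetric] sum_subtractf[symmetric]
    by (intro sum.cong refl) (simp add: algebra_simps)
  have "\<bar>second_deriv N \<phi> v w - second_deriv N \<phi> v z\<bar> \<le> (\<Sum>j<N. \<Sum>i<N. 4 * (e * nsq N v))"
    unfolding eq
  proof (intro order_trans[OF sum_abs] sum_mono)
    fix j i assume "j \<in> {..<N}" "i \<in> {..<N}"
    then have ij: "i < N" "j < N" by auto
    have entry: "\<bar>x * y * ?D i c j c'\<bar> \<le> e * nsq N v"
      if "\<bar>x\<bar> \<le> cmod (v j)" "\<bar>y\<bar> \<le> cmod (v i)" "c \<in> {1, \<i>}" "c' \<in> {1, \<i>}" for x y c c'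
    proof -
      have "\<bar>x\<bar> \<le> sqrt (nsq N v)" "\<bar>y\<bar> \<le> sqrt (nsq N v)"
        using that(1,2) real_le_rsqrt[OF cmod_le_nsq[OF ij(1), of v]]
          real_le_rsqrt[OF cmod_le_nsq[OF ij(2), of v]] by linarith+
      then have "\<bar>x\<bar> * \<bar>y\<bar> \<le> sqrt (nsq N v) * sqrt (nsq N v)"
        by (intro mult_mono) (auto simp: nsq_nonneg)
      then have "\<bar>x\<bar> * \<bar>y\<bar> \<le> nsq N v" by (simp add: nsq_nonneg)
      moreover have "\<bar>?D i c j c'\<bar> \<le> e" using assms(1) ij that by blast
      ultimately have "\<bar>x\<bar> * \<bar>y\<bar> * \<bar>?D i c j c'\<bar> \<le> nsq N v * e"
        by (intro mult_mono) (auto simp: nsq_nonneg)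
      then show ?thesis by (simp add: abs_mult mult.commute)
    qed
    have "\<bar>Re (v j) * Re (v i) * ?D i 1 j 1\<bar> \<le> e * nsq N v" "\<bar>Re (v j) * Im (v i) * ?D i \<i> j 1\<bar> \<le> e * nsq N v"
      "\<bar>Im (v j) * Re (v i) * ?D i 1 j \<i>\<bar> \<le> e * nsq N v" "\<bar>Im (v j) * Im (v i) * ?D i \<i> j \<i>\<bar> \<le> e * nsq N v"
      by (rule entry; simp add: abs_Re_le_cmod abs_Im_le_cmod)+
    then show "\<bar>Re (v j) * Re (v i) * ?D i 1 j 1 + Re (v j) * Im (v i) * ?D i \<i> j 1
      + Im (v j) * Re (v i) * ?D i 1 j \<i> + Im (v j) * Im (v i) * ?D i \<i> j \<i>\<bar> \<le> 4 * (e * nsq N v)"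
      by linarith
  qed
  also have "\<dots> = 4 * e * (real N)\<^sup>2 * nsq N v" by (simp add: power2_eq_square)
  finally show ?thesis .
qed

lemma ray_in_pdisc:
  assumes "z \<in> Cpts N" "w \<in> pdisc N z d" "0 \<le> t" "t \<le> 1"
  shows "ray z (\<lambda>i. w i - z i) t \<in> pdisc N z d"
proof -
  have "cmod (of_real t * (w i - z i)) < d" if "i < N" for i
  proof -
    have "cmod (of_real t * (w i - z i)) \<le> 1 * cmod (w i - z i)"
      unfolding norm_mult norm_of_real using assms by (intro mult_right_mono) auto
    then show ?thesis using assms(2) that by (force simp: pdisc_def)
  qed
  then show ?thesis using assms by (auto simp: pdisc_def ray_def Cpts_def)
qed

lemma holo_on_taylor_poly:
  assumes "U \<subseteq> Cpts N"
  shows "holo_on N U (\<lambda>w. taylor_poly N \<phi> z (\<lambda>i. w i - z i))"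
proof -
  have "holo_on N U (\<lambda>w. w i - z i)" for i
    using holo_on_add[OF assms holo_on_coord[OF assms, of i] holo_on_const[OF assms, of "- z i"]] by simp
  then show ?thesis unfolding taylor_poly_def
    by (intro holo_on_add[OF assms] holo_on_sum[OF assms] holo_on_mult[OF assms] holo_on_const[OF assms])
qed

text \<open>Taylor's formula evaluates the second derivative at an intermediate point instead of
  \<open>z\<close>; that error costs half of the Levi bound \<open>c\<close>, and the other half
  survives. The function \<open>h\<close> is a polynomial, hence entire, although \<phi> is
  controlled only on \<open>U\<close>.\<close>

lemma levi_lower_bound:
  assumes U: "openin (Cspace N) U" and \<phi>: "Ck_on 2 N U \<phi>" and z: "z \<in> U" and c: "c > 0"
    and pos: "\<And>w. c * nsq N w \<le> Re (hform N (complex_hessian N \<phi> z) w w)"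
  obtains h d where "holo_on N (Cpts N) h" "d > 0" "pdisc N z d \<subseteq> U"
    "\<And>w. w \<in> pdisc N z d \<Longrightarrow>
      Re (h w) + c / 2 * nsq N w - (Re (h z) + c / 2 * nsq N z) \<le> \<phi> w - \<phi> z"
proof -
  have zC: "z \<in> Cpts N" using openin_subset[OF U] z by auto
  \<comment> \<open>Makes the error 4 e N^2 of \<open>second_deriv_diff_bound\<close> at most
    \<open>c\<close>, which Taylor's factor 1/2 reduces to c / 2; the 1 guards against N =
    0.\<close>
  define e where "e = c / (4 * (real N)\<^sup>2 + 1)"
  have e: "e > 0" unfolding e_def using c by (intro divide_pos_pos add_nonneg_pos) auto
  have e4: "4 * e * (real N)\<^sup>2 \<le> c"
  proof -
    have "c * (4 * (real N)\<^sup>2) \<le> c * (4 * (real N)\<^sup>2 + 1)" using c by simp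
    moreover have "0 < 4 * (real N)\<^sup>2 + 1" by (intro add_nonneg_pos) auto
    ultimately show ?thesis by (simp add: e_def field_simps)
  qed
  obtain d where d: "d > 0" "pdisc N z d \<subseteq> U"
    and near: "\<And>w i j c c'. w \<in> pdisc N z d \<Longrightarrow> i < N \<Longrightarrow> j < N \<Longrightarrow> c \<in> {1, \<i>} \<Longrightarrow> c' \<in> {1, \<i>} \<Longrightarrow>
      \<bar>partial_deriv i c (partial_deriv j c' \<phi>) w - partial_deriv i c (partial_deriv j c' \<phi>) z\<bar> \<le> e"
    using continuous_second_deriv_bound[OF U \<phi> z e] by blast
  \<comment> \<open>The extra linear term rewrites c / 2 |w - z|^2 with centre 0, up to a constant
    (\<open>nsq_diff\<close>).\<close>
  define h where "h w = taylor_poly N \<phi> z (\<lambda>i. w i - z i) + (- of_real c) * inner_to N z w" for w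
  show ?thesis
  proof (rule that[OF _ d])
    show "holo_on N (Cpts N) h" unfolding h_def[abs_def]
      by (intro holo_on_add holo_on_mult holo_on_const holo_on_inner_to holo_on_taylor_poly order_refl)
    fix w assume w: "w \<in> pdisc N z d"
    define v where "v = (\<lambda>i. w i - z i)"
    have v: "v \<in> Cpts N" using w zC by (auto simp: v_def pdisc_def Cpts_def)
    have rays: "ray z v t \<in> pdisc N z d" if "0 \<le> t" "t \<le> 1" for t
      unfolding v_def by (rule ray_in_pdisc[OF zC w that])
    then obtain t where t: "0 < t" "t < 1"
      "\<phi> (ray z v 1) = \<phi> z + dir_deriv N \<phi> v z + second_deriv N \<phi> v (ray z v t) / 2"
      using taylor_along_ray[OF U \<phi> v] d by blast
    have "ray z v 1 = w" by (simp add: ray_def v_def)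
    moreover have "\<bar>second_deriv N \<phi> v (ray z v t) - second_deriv N \<phi> v z\<bar> \<le> 4 * e * (real N)\<^sup>2 * nsq N v"
      using near[OF rays] t e by (intro second_deriv_diff_bound) auto
    then have "\<bar>second_deriv N \<phi> v (ray z v t) - second_deriv N \<phi> v z\<bar> \<le> c * nsq N v"
      using mult_right_mono[OF e4 nsq_nonneg[of N v]] by linarith
    ultimately have "Re (taylor_poly N \<phi> z v) + c / 2 * nsq N v \<le> \<phi> w - \<phi> z"
      using t(3) taylor_poly_plus_levi[OF U \<phi> z, of v] pos[of v] by (simp add: abs_le_iff)
    moreover have "taylor_poly N \<phi> z (\<lambda>i. z i - z i) = 0" by (simp add: taylor_poly_def)
    ultimately show "Re (h w) + c / 2 * nsq N w - (Re (h z) + c / 2 * nsq N z) \<le> \<phi> w - \<phi> z"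
      using nsq_diff[of N w z] by (simp add: h_def v_def algebra_simps)
  qed
qed


section \<open>Peaks on complex spaces\<close>

text \<open>Off \<open>Z\<close> some local equation is nonzero, and remains so nearby.\<close>

lemma subvariety_closed:
  assumes "analytic_subvariety N U Z"
  shows "openin (Cspace N) (U - Z)"
proof (subst openin_subopen, intro ballI)
  fix a assume a: "a \<in> U - Z"
  then have "a \<in> U" by blast
  from bspec[OF conjunct2[OF assms[unfolded analytic_subvariety_def]] this]
  obtain W F where "openin (Cspace N) W \<and> a \<in> W \<and> W \<subseteq> U \<and> finite F \<and>
      (\<forall>f\<in>F. holo_on N W f) \<and> Z \<inter> W = {w \<in> W. \<forall>f\<in>F. f w = 0}"
    by (elim exE) (rule that, assumption)
  then have W: "openin (Cspace N) W" "a \<in> W" "W \<subseteq> U"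
    and F: "\<And>f. f \<in> F \<Longrightarrow> holo_on N W f" "Z \<inter> W = {w \<in> W. \<forall>f\<in>F. f w = 0}"
    by simp_all
  then obtain f where f: "f \<in> F" "f a \<noteq> 0" using a by blast
  have WC: "W \<subseteq> Cpts N" using openin_subset[OF W(1)] by simp
  have "openin (subtopology (Cspace N) W) {w \<in> topspace (subtopology (Cspace N) W). f w \<in> - {0}}"
    using F(1)[OF f(1)] by (intro openin_continuous_map_preimage) (auto simp: holo_on_def)
  moreover have "{w \<in> topspace (subtopology (Cspace N) W). f w \<in> - {0}} = {w \<in> W. f w \<noteq> 0}"
    using WC by auto
  ultimately have "openin (Cspace N) {w \<in> W. f w \<noteq> 0}"
    using W(1) openin_trans_full by metis
  moreover have "a \<in> {w \<in> W. f w \<noteq> 0}" "{w \<in> W. f w \<noteq> 0} \<subseteq> U - Z"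
    using f W F(2) by auto
  ultimately show "\<exists>T. openin (Cspace N) T \<and> a \<in> T \<and> T \<subseteq> U - Z" by blast
qed

lemma subvariety_Int_compact:
  assumes "analytic_subvariety N U Z" "K \<subseteq> U" "compact K" "U \<subseteq> Cpts N"
  shows "compact (Z \<inter> K)"
proof -
  obtain T where T: "open T" "U - Z = Cpts N \<inter> T"
    using subvariety_closed[OF assms(1)] by (auto simp: Cspace_eq openin_open)
  have "Z \<inter> K = K - T" using T(2) assms by (auto simp: analytic_subvariety_def)
  then show ?thesis using assms(3) T(1) by (simp add: compact_diff)
qed

locale chart =
  fixes X :: "'a topology" and \<O> :: "'a structure_sheaf" and \<omega> N U Z z
  assumes emb: "local_embedding X \<O> \<omega> N U Z z"
begin

lemma open_domain: "openin X \<omega>"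
  and open_ambient: "openin (Cspace N) U"
  and subvariety: "analytic_subvariety N U Z"
  and homeo: "homeomorphic_map (subtopology X \<omega>) (subtopology (Cspace N) Z) z"
  using emb by (auto simp: local_embedding_def)

lemma ambient_subset: "U \<subseteq> Cpts N"
  using openin_subset[OF open_ambient] by simp

lemma model_subset: "Z \<subseteq> U"
  using subvariety by (simp add: analytic_subvariety_def)

lemma topspace_domain: "topspace (subtopology X \<omega>) = \<omega>"
  using openin_subset[OF open_domain] by auto

lemma topspace_model: "topspace (subtopology (Cspace N) Z) = Z"
  using ambient_subset model_subset by auto

lemma image_eq: "z ` \<omega> = Z"
  using homeomorphic_imp_surjective_map[OF homeo] unfolding topspace_domain topspace_model .

lemma inj: "inj_on z \<omega>"
  using homeomorphic_imp_injective_map[OF homeo] unfolding topspace_domain .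

lemma in_ambient: "x \<in> \<omega> \<Longrightarrow> z x \<in> U"
  using image_eq model_subset by blast

lemma in_Cpts: "x \<in> \<omega> \<Longrightarrow> z x \<in> Cpts N"
  using in_ambient ambient_subset by blast

lemma continuous: "continuous_map (subtopology X \<omega>) (Cspace N) z"
  using homeomorphic_imp_continuous_map[OF homeo] continuous_map_into_fulltopology by blast

text \<open>Injectivity of the chart makes |z - z p|^2 vanish at \<open>p\<close> alone, which is
  the source of strict maxima.\<close>

lemma nsq_diff_pos:
  assumes "x \<in> \<omega>" "p \<in> \<omega>" "x \<noteq> p"
  shows "0 < nsq N (\<lambda>i. z x i - z p i)"
proof -
  have "z x \<noteq> z p" using assms inj_onD[OF inj, of x p] by auto
  then obtain i where i: "z x i \<noteq> z p i" by auto
  have "i < N"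
    using i in_Cpts[OF assms(1)] in_Cpts[OF assms(2)] by (force simp: Cpts_def not_less[symmetric])
  have "0 < (cmod (z x i - z p i))\<^sup>2" using i by simp
  also have "\<dots> \<le> nsq N (\<lambda>i. z x i - z p i)"
    using cmod_le_nsq[OF \<open>i < N\<close>, of "\<lambda>i. z x i - z p i"] by simp
  finally show ?thesis .
qed

lemma open_preimage:
  assumes "openin (Cspace N) V"
  shows "openin X {x \<in> \<omega>. z x \<in> V}"
proof -
  have "openin (subtopology X \<omega>) {x \<in> topspace (subtopology X \<omega>). z x \<in> V}"
    by (rule openin_continuous_map_preimage[OF continuous assms])
  then show ?thesis
    unfolding topspace_domain using openin_trans_full open_domain by blast
qed

text \<open>\<open>Z\<close> is closed in \<open>U\<close>, so it meets \<open>K\<close> in a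
  compact set, which the inverse homeomorphism carries back to \<open>X\<close>.\<close>

lemma compact_preimage:
  assumes "K \<subseteq> U" "compact K"
  shows "compactin X {x \<in> \<omega>. z x \<in> K}"
proof -
  obtain y where y: "homeomorphic_maps (subtopology X \<omega>) (subtopology (Cspace N) Z) z y"
    using homeo by (auto simp: homeomorphic_map_maps)
  then have cont: "continuous_map (subtopology (Cspace N) Z) (subtopology X \<omega>) y"
    and inv: "\<And>x. x \<in> \<omega> \<Longrightarrow> y (z x) = x" "\<And>w. w \<in> Z \<Longrightarrow> z (y w) = w"
    unfolding homeomorphic_maps_def topspace_domain topspace_model by auto
  have "compactin (Cspace N) (Z \<inter> K)"
    using subvariety_Int_compact[OF subvariety assms ambient_subset] ambient_subset model_subset
    by (auto simp: Cspace_eq compactin_subtopology)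
  then have "compactin (subtopology (Cspace N) Z) (Z \<inter> K)" by (simp add: compactin_subtopology)
  then have "compactin (subtopology X \<omega>) (y ` (Z \<inter> K))" by (rule image_compactin[OF _ cont])
  moreover have "y ` (Z \<inter> K) = {x \<in> \<omega>. z x \<in> K}"
  proof (intro equalityI subsetI)
    fix x assume "x \<in> y ` (Z \<inter> K)"
    then obtain w where w: "w \<in> Z" "w \<in> K" "x = y w" by blast
    have "y w \<in> \<omega>" using w(1) inv(1) image_eq by (metis imageE)
    then show "x \<in> {x \<in> \<omega>. z x \<in> K}" using w inv(2) by simp
  next
    fix x assume x: "x \<in> {x \<in> \<omega>. z x \<in> K}"
    then have "x = y (z x)" "z x \<in> Z \<inter> K" using inv(1) image_eq by auto
    then show "x \<in> y ` (Z \<inter> K)" by blast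
  qed
  ultimately show ?thesis by (simp add: compactin_subtopology)
qed

lemma continuous_compose:
  assumes "continuous_on (Cpts N) g" "E \<subseteq> \<omega>"
  shows "continuous_map (subtopology X E) euclidean (\<lambda>x. g (z x))"
proof -
  have "continuous_map (Cspace N) euclidean g" using assms(1) by (simp add: Cspace_eq)
  then have "continuous_map (subtopology X \<omega>) euclidean (g \<circ> z)"
    by (rule continuous_map_compose[OF continuous])
  then show ?thesis
    using continuous_map_from_subtopology_mono assms(2) unfolding o_def by blast
qed

text \<open>Local compactness of \<open>A\<close>: with A = S \<inter> T, the open \<open>S\<close>
  leaves room for a small closed polydisc of the chart, and the closed \<open>T\<close> cuts a
  compact set out of its preimage. It provides the compact sets for \<open>limit_peak\<close> and
  \<open>peak_violates_maximum_principle\<close>.\<close>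

lemma compact_neighbourhood:
  assumes lc: "locally_closed_in X A" and W: "openin (subtopology X A) W" "p \<in> W" and p: "p \<in> \<omega>"
  obtains D E where "openin (subtopology X A) D" "p \<in> D" "D \<subseteq> E" "E \<subseteq> W" "E \<subseteq> \<omega>" "compactin X E"
proof -
  obtain S T where ST: "openin X S" "closedin X T" "A = S \<inter> T"
    using lc by (auto simp: locally_closed_in_def)
  obtain G where G: "openin X G" "W = G \<inter> A" using W(1) by (auto simp: openin_subtopology)
  define G' where "G' = G \<inter> S \<inter> \<omega>"
  have G': "openin X G'" "p \<in> G'" "G' \<subseteq> \<omega>"
    using G ST W p open_domain by (auto simp: G'_def)
  have "openin (subtopology (Cspace N) Z) (z ` G')"
    using G' open_domain by (intro homeomorphic_map_openness_eq[OF homeo, THEN iffD1, THEN conjunct2])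
      (auto simp: openin_open_subtopology topspace_domain)
  then obtain V where V: "openin (Cspace N) V" "z ` G' = V \<inter> Z" by (auto simp: openin_subtopology)
  have "openin (Cspace N) (V \<inter> U)" "z p \<in> V \<inter> U"
    using V open_ambient G' in_ambient p by auto
  then obtain d where d: "d > 0" "pdisc N (z p) d \<subseteq> V \<inter> U" by (rule openin_Cspace_pdisc)
  define K where "K = {x \<in> \<omega>. z x \<in> cpdisc N (z p) (d / 2)}"
  have cp: "cpdisc N (z p) (d / 2) \<subseteq> V \<inter> U"
    using cpdisc_subset_pdisc[of "d / 2" d N "z p"] d by auto
  \<comment> \<open>The closed polydisc lies in \<open>V\<close>, whose trace on the model is the
    image of \<open>G'\<close>; injectivity of \<open>z\<close> brings the points back into
    \<open>G'\<close>.\<close>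
  have "K \<subseteq> G'"
  proof
    fix x assume "x \<in> K"
    then have x: "x \<in> \<omega>" "z x \<in> V \<inter> Z" using cp image_eq by (auto simp: K_def)
    then obtain y where "y \<in> G'" "z y = z x" unfolding V(2)[symmetric] by force
    then show "x \<in> G'" using inj_onD[OF inj, of y x] x G' by auto
  qed
  have "compactin X K" unfolding K_def using cp by (intro compact_preimage compact_cpdisc) auto
  then have E: "compactin X (K \<inter> T)" using closed_Int_compactin[OF ST(2)] by (simp add: Int_commute)
  define D where "D = {x \<in> \<omega>. z x \<in> pdisc N (z p) (d / 2)} \<inter> A"
  have "openin (subtopology X A) D" unfolding D_def
    by (intro openin_subtopology_Int open_preimage openin_pdisc)
  moreover have "p \<in> D"
    using p d W G centre_in_pdisc[OF in_Cpts[OF p], of "d / 2"] by (auto simp: D_def)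
  moreover have "D \<subseteq> K \<inter> T" using pdisc_subset_cpdisc ST(3) by (fastforce simp: D_def K_def)
  moreover have "K \<inter> T \<subseteq> W" "K \<inter> T \<subseteq> \<omega>"
    using \<open>K \<subseteq> G'\<close> G ST(3) by (auto simp: G'_def)
  ultimately show ?thesis using that E by blast
qed

end

lemma chart_of: "local_embedding X \<O> \<omega> N U Z z \<Longrightarrow> chart X \<O> \<omega> N U Z z"
  by (simp add: chart_def)

section \<open>Maxima on compact sets, and the sources of peaks\<close>

lemma compactin_attains_sup:
  fixes \<Phi> :: "'a \<Rightarrow> real"
  assumes "compactin X E" "E \<noteq> {}" "continuous_map (subtopology X E) euclidean \<Phi>"
  obtains y where "y \<in> E" "\<And>x. x \<in> E \<Longrightarrow> \<Phi> x \<le> \<Phi> y"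
proof -
  have "compactin (subtopology X E) E" using assms(1) by (simp add: compactin_subtopology)
  then have "compact (\<Phi> ` E)" using image_compactin[OF _ assms(3)] by simp
  then obtain s where "s \<in> \<Phi> ` E" "\<And>t. t \<in> \<Phi> ` E \<Longrightarrow> t \<le> s"
    using compact_attains_sup[of "\<Phi> ` E"] assms(2) by auto
  then show ?thesis using that by blast
qed

lemma compactin_diff_open:
  assumes "compactin X E" "openin (subtopology X A) D" "E \<subseteq> A"
  shows "compactin X (E - D)"
proof -
  obtain G where G: "openin X G" "D = G \<inter> A" using assms(2) by (auto simp: openin_subtopology)
  have "closedin X (topspace X - G)" using G(1) by blast
  then have "compactin X ((topspace X - G) \<inter> E)" using assms(1) by (rule closed_Int_compactin)
  moreover have "(topspace X - G) \<inter> E = E - D"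
    using G(2) assms(3) compactin_subset_topspace[OF assms(1)] by auto
  ultimately show ?thesis by simp
qed

text \<open>
  Unlike a maximum principle on domains, absence of peaks is a pointwise condition on germs, so it can
  serve as the invariant of the closure operation.
\<close>

definition local_peak ::
    "'a topology \<Rightarrow> 'a structure_sheaf \<Rightarrow> 'a set \<Rightarrow> ('a \<Rightarrow> complex) \<Rightarrow> 'a \<Rightarrow> bool" where
  "local_peak X \<O> A f p \<longleftrightarrow> (\<exists>\<omega> N U Z z h c W. local_embedding X \<O> \<omega> N U Z z \<and>
     holo_on N (Cpts N) h \<and> 0 < c \<and> openin (subtopology X A) W \<and> p \<in> W \<and> W \<subseteq> \<omega> \<and>
     (\<forall>x\<in>W. (cmod (f x))\<^sup>2 + (Re (h (z x)) + c * nsq N (z x))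
        \<le> (cmod (f p))\<^sup>2 + (Re (h (z p)) + c * nsq N (z p))))"

lemma local_peakI:
  assumes "local_embedding X \<O> \<omega> N U Z z" "holo_on N (Cpts N) h" "0 < c"
    "openin (subtopology X A) W" "p \<in> W" "W \<subseteq> \<omega>"
    "\<And>x. x \<in> W \<Longrightarrow> (cmod (f x))\<^sup>2 + (Re (h (z x)) + c * nsq N (z x))
        \<le> (cmod (f p))\<^sup>2 + (Re (h (z p)) + c * nsq N (z p))"
  shows "local_peak X \<O> A f p"
  unfolding local_peak_def using assms by blast

lemma local_peak_cong:
  assumes "local_peak X \<O> A f p" "openin (subtopology X A) W" "p \<in> W" "\<And>x. x \<in> W \<Longrightarrow> g x = f x"
  shows "local_peak X \<O> A g p"
proof -
  obtain \<omega> N U Z z h c V where V: "local_embedding X \<O> \<omega> N U Z z"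
     "holo_on N (Cpts N) h" "0 < c" "openin (subtopology X A) V" "p \<in> V" "V \<subseteq> \<omega>"
     "\<And>x. x \<in> V \<Longrightarrow> (cmod (f x))\<^sup>2 + (Re (h (z x)) + c * nsq N (z x))
        \<le> (cmod (f p))\<^sup>2 + (Re (h (z p)) + c * nsq N (z p))"
    using assms(1) unfolding local_peak_def by blast
  show ?thesis
    by (rule local_peakI[OF V(1-3), of A "W \<inter> V"]) (use assms V in auto)
qed

text \<open>The minorant from \<open>levi_lower_bound\<close> touches \<Phi> at \<open>z p\<close>,
  so putting it in place of \<Phi> keeps the maximum at \<open>p\<close>. This serves
  pseudoconvexity, holomorphic functions and \<rho> alike; \<Phi> lives on a neighbourhood
  \<open>V\<close> of \<open>z p\<close> because holomorphic extensions from the model are only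
  local.\<close>

lemma levi_peak:
  assumes emb: "local_embedding X \<O> \<omega> N U Z z"
    and V: "openin (Cspace N) V" "z p \<in> V" and \<Phi>: "Ck_on 2 N V \<Phi>"
    and c: "c > 0" "\<And>w. c * nsq N w \<le> Re (hform N (complex_hessian N \<Phi> (z p)) w w)"
    and e: "e > 0"
    and W: "openin (subtopology X A) W" "p \<in> W" "W \<subseteq> \<omega>"
    and le: "\<And>x. x \<in> W \<Longrightarrow> z x \<in> V \<Longrightarrow> (cmod (f x))\<^sup>2 + e * \<Phi> (z x) \<le> (cmod (f p))\<^sup>2 + e * \<Phi> (z p)"
  shows "local_peak X \<O> A f p"
proof -
  interpret chart X \<O> \<omega> N U Z z by (rule chart_of[OF emb])
  obtain h d where h: "holo_on N (Cpts N) h" and d: "d > 0" "pdisc N (z p) d \<subseteq> V"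
    and bound: "\<And>w. w \<in> pdisc N (z p) d \<Longrightarrow>
      Re (h w) + c / 2 * nsq N w - (Re (h (z p)) + c / 2 * nsq N (z p)) \<le> \<Phi> w - \<Phi> (z p)"
    using levi_lower_bound[OF V(1) \<Phi> V(2) c] by blast
  define W' where "W' = {x \<in> \<omega>. z x \<in> pdisc N (z p) d} \<inter> W"
  have W': "openin (subtopology X A) W'"
  proof -
    have "W' = ({x \<in> \<omega>. z x \<in> pdisc N (z p) d} \<inter> A) \<inter> W"
      using openin_subset[OF W(1)] by (auto simp: W'_def)
    then show ?thesis
      by (simp only:) (intro openin_Int openin_subtopology_Int open_preimage openin_pdisc W(1))
  qed
  show ?thesis
  proof (rule local_peakI[OF emb])
    show "holo_on N (Cpts N) (\<lambda>w. of_real e * h w)"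
      by (intro holo_on_mult holo_on_const h order_refl)
    show "0 < e * (c / 2)" using c e by simp
    show "p \<in> W'" using W d in_Cpts centre_in_pdisc by (auto simp: W'_def)
    fix x assume x: "x \<in> W'"
    have "e * (Re (h (z x)) + c / 2 * nsq N (z x) - (Re (h (z p)) + c / 2 * nsq N (z p)))
        \<le> e * (\<Phi> (z x) - \<Phi> (z p))"
      using bound x e by (intro mult_left_mono) (auto simp: W'_def)
    moreover have "(cmod (f x))\<^sup>2 + e * \<Phi> (z x) \<le> (cmod (f p))\<^sup>2 + e * \<Phi> (z p)"
      using x d by (intro le) (auto simp: W'_def)
    ultimately show "(cmod (f x))\<^sup>2 + (Re (of_real e * h (z x)) + e * (c / 2) * nsq N (z x))
        \<le> (cmod (f p))\<^sup>2 + (Re (of_real e * h (z p)) + e * (c / 2) * nsq N (z p))"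
      by (simp add: algebra_simps)
  qed (use W' W in \<open>auto simp: W'_def\<close>)
qed

lemma hform_scalar:
  "Re (hform N (of_real k \<cdot>\<^sub>m 1\<^sub>m N) w w) = k * nsq N w"
proof -
  have "hform N (of_real k \<cdot>\<^sub>m 1\<^sub>m N) w w =
      (\<Sum>i<N. \<Sum>j<N. if j = i then of_real k * (w i * cnj (w i)) else 0)"
    unfolding hform_def by (intro sum.cong refl) auto
  also have "\<dots> = (\<Sum>i<N. of_real (k * (cmod (w i))\<^sup>2))"
    by (intro sum.cong refl) (simp add: complex_norm_square del: of_real_power)
  finally show ?thesis by (simp add: nsq_def sum_distrib_left)
qed

text \<open>With q = 1 all \<open>N\<close> eigenvalues are positive, which bounds the Levi form
  from below and feeds \<open>levi_peak\<close>. Backwards, the peaking function is itself an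
  admissible test function.\<close>

lemma pseudoconvex_iff_local_peak:
  assumes p: "p \<in> A"
  shows "set_q_pseudoconvex_at X \<O> 1 A p \<longleftrightarrow> local_peak X \<O> A (\<lambda>_. 0) p"
proof
  assume "set_q_pseudoconvex_at X \<O> 1 A p"
  then obtain \<omega> N U Z z \<phi> \<omega>' where emb: "local_embedding X \<O> \<omega> N U Z z"
    and \<phi>: "Cinf_on N U (\<phi> :: (nat \<Rightarrow> complex) \<Rightarrow> real)"
    and \<omega>': "openin X \<omega>'" "p \<in> \<omega>'" "\<omega>' \<subseteq> \<omega>"
    and le: "\<And>x. x \<in> A \<inter> \<omega>' \<Longrightarrow> \<phi> (z x) \<le> \<phi> (z p)"
    and num: "N \<le> num_pos_eigenvalues (complex_hessian N \<phi> (z p))"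
    unfolding set_q_pseudoconvex_at_def by auto
  interpret chart X \<O> \<omega> N U Z z by (rule chart_of[OF emb])
  have C2: "Ck_on 2 N U \<phi>" using \<phi> by (simp add: Cinf_on_def)
  have zp: "z p \<in> U" using \<omega>' in_ambient by auto
  have "complex_hessian N \<phi> (z p) \<in> carrier_mat N N" by (simp add: complex_hessian_def)
  then obtain c where c: "c > 0" "\<And>w. c * nsq N w \<le> Re (hform N (complex_hessian N \<phi> (z p)) w w)"
    using hermitian_pos_bound[OF _ complex_hessian_hermitian[OF open_ambient C2 zp] num] by blast
  show "local_peak X \<O> A (\<lambda>_. 0) p"
    by (rule levi_peak[where z = z and p = p and e = 1, OF emb open_ambient zp C2 c,
        where W = "\<omega>' \<inter> A"])
      (use \<omega>' p le in \<open>auto intro: openin_subtopology_Int\<close>)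
next
  assume "local_peak X \<O> A (\<lambda>_. 0) p"
  then obtain \<omega> N U Z z h c W where emb: "local_embedding X \<O> \<omega> N U Z z"
    and h: "holo_on N (Cpts N) h" "0 < c"
    and W: "openin (subtopology X A) W" "p \<in> W" "W \<subseteq> \<omega>"
    and le: "\<And>x. x \<in> W \<Longrightarrow> Re (h (z x)) + c * nsq N (z x) \<le> Re (h (z p)) + c * nsq N (z p)"
    unfolding local_peak_def by auto
  interpret chart X \<O> \<omega> N U Z z by (rule chart_of[OF emb])
  obtain G where G: "openin X G" "W = G \<inter> A" using W(1) by (auto simp: openin_subtopology)
  let ?\<phi> = "\<lambda>w. Re (h w) + c * nsq N w"
  have hU: "holo_on N U h" using holo_on_subset[OF h(1) ambient_subset] .
  have "Cinf_on N U ?\<phi>" using Ck_on_psh_model[OF open_ambient hU] by (simp add: Cinf_on_def)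
  moreover have "N + 1 \<le> num_pos_eigenvalues (complex_hessian N ?\<phi> (z p)) + 1"
    using complex_hessian_psh_model[OF open_ambient hU in_ambient] num_pos_eigenvalues_scalar[OF h(2)] W
    by auto
  moreover have "\<forall>x\<in>A \<inter> (G \<inter> \<omega>). ?\<phi> (z x) \<le> ?\<phi> (z p)" using le G by auto
  ultimately show "set_q_pseudoconvex_at X \<O> 1 A p"
    unfolding set_q_pseudoconvex_at_def using emb W G open_domain
    by (intro exI[of _ \<omega>] exI[of _ N] exI[of _ U] exI[of _ Z] exI[of _ z] exI[of _ ?\<phi>]
        exI[of _ "G \<inter> \<omega>"]) auto
qed

text \<open>
  \<open>|F|\<^sup>2\<close> is bounded below by its linearisation \<open>2 Re (cnj (F p) F) - |F p|\<^sup>2\<close>, the real part of a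
  holomorphic function.
\<close>

lemma holomorphic_local_peak:
  assumes sheaf: "subsheaf_of_continuous X \<O>" and F: "openin X V" "F \<in> \<O> V" "p \<in> V"
    and peak: "local_peak X \<O> A F p"
  shows "local_peak X \<O> A (\<lambda>_. 0) p"
proof -
  obtain \<omega> N U Z z h c W where emb: "local_embedding X \<O> \<omega> N U Z z"
    and h: "holo_on N (Cpts N) h" "0 < c"
    and W: "openin (subtopology X A) W" "p \<in> W" "W \<subseteq> \<omega>"
    and le: "\<And>x. x \<in> W \<Longrightarrow> (cmod (F x))\<^sup>2 + (Re (h (z x)) + c * nsq N (z x))
        \<le> (cmod (F p))\<^sup>2 + (Re (h (z p)) + c * nsq N (z p))"
    using peak unfolding local_peak_def by blast
  interpret chart X \<O> \<omega> N U Z z by (rule chart_of[OF emb])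
  have V\<omega>: "openin X (V \<inter> \<omega>)" using F open_domain by blast
  then have "F \<in> \<O> (V \<inter> \<omega>)"
    using sheaf F unfolding subsheaf_of_continuous_def by (meson inf_le1)
  then obtain g where g: "g \<in> model_sections N (z ` (V \<inter> \<omega>))" "\<And>x. x \<in> V \<inter> \<omega> \<Longrightarrow> F x = g (z x)"
    using emb V\<omega> unfolding local_embedding_def by (meson inf_le2)
  have "z p \<in> z ` (V \<inter> \<omega>)" using F W by auto
  \<comment> \<open>\<open>F\<close> lives on the space only; \<open>G\<close> extends it to an open
    set of the ambient space, where the Hessian makes sense.\<close>
  then obtain B G where B: "openin (Cspace N) B" "z p \<in> B" "holo_on N B G"
    and gG: "\<And>w. w \<in> B \<inter> z ` (V \<inter> \<omega>) \<Longrightarrow> g w = G w"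
    using g(1) unfolding model_sections_def by blast
  have FG: "F x = G (z x)" if "x \<in> V \<inter> \<omega>" "z x \<in> B" for x
    using g(2) gG that by auto
  have BC: "B \<subseteq> Cpts N" using openin_subset[OF B(1)] by simp
  define H where "H w = (2 * cnj (F p)) * G w + h w" for w
  have H: "holo_on N B H" unfolding H_def[abs_def]
    using B(3) holo_on_subset[OF h(1) BC] by (intro holo_on_add[OF BC] holo_on_mult[OF BC] holo_on_const[OF BC])
  let ?\<Phi> = "\<lambda>w. Re (H w) + c * nsq N w"
  have pos: "c * nsq N w \<le> Re (hform N (complex_hessian N ?\<Phi> (z p)) w w)" for w
    unfolding complex_hessian_psh_model[OF B(1) H B(2)] hform_scalar by simp
  show ?thesis
  proof (rule levi_peak[where z = z and p = p and e = 1, OF emb B(1,2) Ck_on_psh_model[OF B(1) H, of 2 c] h(2) pos])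
    show "openin (subtopology X A) (V \<inter> A \<inter> W)"
      using F(1) W(1) by (intro openin_Int openin_subtopology_Int)
    show "p \<in> V \<inter> A \<inter> W" using F W openin_subset[OF W(1)] by auto
    show "V \<inter> A \<inter> W \<subseteq> \<omega>" using W by auto
    fix x assume x: "x \<in> V \<inter> A \<inter> W" "z x \<in> B"
    have "0 \<le> (cmod (F x - F p))\<^sup>2" by simp
    also have "\<dots> = (cmod (F x))\<^sup>2 + (cmod (F p))\<^sup>2 - Re (2 * cnj (F p) * F x)"
      unfolding cmod_power2 by (simp add: power2_eq_square algebra_simps)
    finally have "Re (2 * cnj (F p) * F x) \<le> (cmod (F x))\<^sup>2 + (cmod (F p))\<^sup>2" by simp
    moreover have "Re (2 * cnj (F p) * F p) = 2 * (cmod (F p))\<^sup>2"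
      unfolding cmod_power2 by (simp add: power2_eq_square)
    moreover have "H (z x) = 2 * cnj (F p) * F x + h (z x)" "H (z p) = 2 * cnj (F p) * F p + h (z p)"
      using FG x B(2) F W by (auto simp: H_def)
    ultimately show "(cmod 0)\<^sup>2 + 1 * ?\<Phi> (z x) \<le> (cmod 0)\<^sup>2 + 1 * ?\<Phi> (z p)"
      using le[of x] x by simp
  qed simp
qed


section \<open>The maximum principle\<close>

lemma germ_eqD:
  assumes "germ X A x f = germ X A y g" "openin (subtopology X A) W" "x \<in> W"
  shows "y = x" "\<exists>V. openin (subtopology X A) V \<and> x \<in> V \<and> (\<forall>w\<in>V. f w = g w)"
proof -
  show yx: "y = x" using assms(1) by (simp add: germ_def)
  have "f \<in> snd (germ X A x f)" using assms(2,3) by (auto simp: germ_def)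
  then have "f \<in> snd (germ X A y g)" unfolding assms(1) .
  then show "\<exists>V. openin (subtopology X A) V \<and> x \<in> V \<and> (\<forall>w\<in>V. f w = g w)"
    unfolding yx by (auto simp: germ_def)
qed

text \<open>Continuity is built in because \<open>germ_hull\<close> ranges over sets of continuous
  germs.\<close>

definition peakless_germs :: "'a topology \<Rightarrow> 'a structure_sheaf \<Rightarrow> 'a set \<Rightarrow> 'a germ set" where
  "peakless_germs X \<O> A = {germ X A x f | x f W. openin (subtopology X A) W \<and> x \<in> W \<and>
     continuous_map (subtopology X W) euclidean f \<and> (\<forall>y\<in>W. \<not> local_peak X \<O> A f y)}"

lemma peakless_germsI:
  assumes "openin (subtopology X A) W" "x \<in> W" "continuous_map (subtopology X W) euclidean f"
    "\<And>y. y \<in> W \<Longrightarrow> \<not> local_peak X \<O> A f y"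
  shows "germ X A x f \<in> peakless_germs X \<O> A"
  unfolding peakless_germs_def using assms by blast

lemma peakless_germsD:
  assumes "germ X A x f \<in> peakless_germs X \<O> A"
    "openin (subtopology X A) W" "x \<in> W"
  shows "\<not> local_peak X \<O> A f x"
proof
  assume peak: "local_peak X \<O> A f x"
  obtain y g V where g: "germ X A x f = germ X A y g" "y \<in> V" "\<forall>y\<in>V. \<not> local_peak X \<O> A g y"
    using assms(1) unfolding peakless_germs_def by blast
  have yx: "y = x" using germ_eqD(1)[OF g(1) assms(2,3)] .
  obtain V' where "openin (subtopology X A) V'" "x \<in> V'" "\<forall>w\<in>V'. f w = g w"
    using germ_eqD(2)[OF g(1) assms(2,3)] by blast
  then have "local_peak X \<O> A g x" using local_peak_cong[OF peak] by simp
  then show False using g yx by blast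
qed

lemma section_continuous:
  assumes "subsheaf_of_continuous X \<O>" "openin X V" "f \<in> \<O> V"
  shows "continuous_map (subtopology X V) euclidean f"
  using assms(1)[unfolded subsheaf_of_continuous_def, THEN conjunct1] assms(2,3) by blast

lemma holomorphic_germs_peakless:
  assumes sheaf: "subsheaf_of_continuous X \<O>"
    and np: "\<And>p. p \<in> A \<Longrightarrow> \<not> local_peak X \<O> A (\<lambda>_. 0) p"
  shows "holomorphic_germs X \<O> A \<subseteq> peakless_germs X \<O> A"
proof
  fix \<gamma> assume "\<gamma> \<in> holomorphic_germs X \<O> A"
  then obtain x F V where F: "\<gamma> = germ X A x F" "x \<in> A" "openin X V" "x \<in> V" "F \<in> \<O> V"
    unfolding holomorphic_germs_def by blast
  have "continuous_map (subtopology X V) euclidean F"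
    by (rule section_continuous[OF sheaf F(3,5)])
  then have "continuous_map (subtopology X (V \<inter> A)) euclidean F"
    by (rule continuous_map_from_subtopology_mono) auto
  moreover have "\<not> local_peak X \<O> A F y" if "y \<in> V \<inter> A" for y
    using np holomorphic_local_peak[OF sheaf F(3,5), of y A] that by blast
  ultimately show "\<gamma> \<in> peakless_germs X \<O> A"
    unfolding F(1) using F by (intro peakless_germsI[of X A "V \<inter> A"] openin_subtopology_Int) auto
qed

lemma peakless_germs_continuous: "peakless_germs X \<O> A \<subseteq> continuous_germs X A"
  unfolding peakless_germs_def continuous_germs_def by blast

lemma uniform_limit_cmod_square:
  assumes "uniform_limit E s f sequentially" "\<And>x. x \<in> E \<Longrightarrow> cmod (f x) \<le> B" "0 \<le> B" "0 < (e::real)"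
  shows "\<forall>\<^sub>F n in sequentially. \<forall>x\<in>E. \<bar>(cmod (s n x))\<^sup>2 - (cmod (f x))\<^sup>2\<bar> < e"
proof -
  \<comment> \<open>For moduli a and b, |a^2 - b^2| = |a - b| (a + b), and the sum is at most 2 B +
    1 once they differ by less than 1.\<close>
  define d where "d = min 1 (e / (2 * B + 2))"
  have B: "2 * B + 2 > 0" using assms(3) by simp
  have d: "d > 0" "d \<le> 1" "d \<le> e / (2 * B + 2)"
    using assms(3,4) by (auto simp: d_def)
  then have dB: "d * (2 * B + 2) \<le> e" by (simp only: pos_le_divide_eq[OF B])
  have "\<forall>\<^sub>F n in sequentially. \<forall>x\<in>E. dist (s n x) (f x) < d"
    using assms(1) d(1) unfolding uniform_limit_iff by blast
  then show ?thesis
  proof eventually_elim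
    case (elim n)
    show ?case
    proof
      fix x assume x: "x \<in> E"
      have 1: "\<bar>cmod (s n x) - cmod (f x)\<bar> < d"
        using elim x norm_triangle_ineq3[of "s n x" "f x"] by (fastforce simp: dist_norm)
      have 2: "cmod (s n x) + cmod (f x) \<le> 2 * B + 2"
      proof -
        have "cmod (s n x) < cmod (f x) + d" using 1 by (simp add: abs_less_iff)
        then show ?thesis using d(2) assms(2)[OF x] by linarith
      qed
      have "(cmod (s n x))\<^sup>2 - (cmod (f x))\<^sup>2 = (cmod (s n x) - cmod (f x)) * (cmod (s n x) + cmod (f x))"
        by (simp add: power2_eq_square algebra_simps)
      then have "\<bar>(cmod (s n x))\<^sup>2 - (cmod (f x))\<^sup>2\<bar> = \<bar>cmod (s n x) - cmod (f x)\<bar> * (cmod (s n x) + cmod (f x))"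
        by (simp add: abs_mult)
      also have "\<dots> \<le> \<bar>cmod (s n x) - cmod (f x)\<bar> * (2 * B + 2)"
        by (intro mult_left_mono 2) auto
      also have "\<dots> < d * (2 * B + 2)"
        by (intro mult_strict_right_mono 1 B)
      finally show "\<bar>(cmod (s n x))\<^sup>2 - (cmod (f x))\<^sup>2\<bar> < e" using dB by linarith
    qed
  qed
qed

lemma continuous_map_cmod_square_plus:
  assumes "continuous_map Y euclidean f" "continuous_map Y euclidean (g :: 'a \<Rightarrow> real)"
  shows "continuous_map Y euclidean (\<lambda>x. (cmod (f x))\<^sup>2 + g x)"
  by (intro continuous_map_add continuous_map_real_pow continuous_map_norm assms)

text \<open>
  After subtracting a small multiple of \<open>|z - z p|\<^sup>2\<close> a peak of the
  limit becomes strict, hence forces peaks of the approximating sections nearby.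
\<close>

lemma limit_peak:
  assumes lc: "locally_closed_in X A" and U: "openin (subtopology X A) U"
    and f: "continuous_map (subtopology X U) euclidean f"
    and s: "\<And>n. continuous_map (subtopology X U) euclidean (s n)"
    and lim: "\<And>K. compactin X K \<Longrightarrow> K \<subseteq> U \<Longrightarrow> uniform_limit K s f sequentially"
    and p: "p \<in> U" and peak: "local_peak X \<O> A f p"
  obtains n y where "y \<in> U" "local_peak X \<O> A (s n) y"
proof -
  obtain \<omega> N B Z z h c W where emb: "local_embedding X \<O> \<omega> N B Z z"
    and h: "holo_on N (Cpts N) h" "0 < c"
    and W: "openin (subtopology X A) W" "p \<in> W" "W \<subseteq> \<omega>"
    and le: "\<And>x. x \<in> W \<Longrightarrow> (cmod (f x))\<^sup>2 + (Re (h (z x)) + c * nsq N (z x))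
        \<le> (cmod (f p))\<^sup>2 + (Re (h (z p)) + c * nsq N (z p))"
    using peak unfolding local_peak_def by blast
  interpret chart X \<O> \<omega> N B Z z by (rule chart_of[OF emb])
  have "p \<in> \<omega>" using W by auto
  obtain D E where D: "openin (subtopology X A) D" "p \<in> D" "D \<subseteq> E"
    and E: "E \<subseteq> U \<inter> W" "E \<subseteq> \<omega>" "compactin X E"
    using compact_neighbourhood[OF lc openin_Int[OF U W(1)] _ \<open>p \<in> \<omega>\<close>] p W(2) by blast
  \<comment> \<open>Chosen so that \<open>T\<close> is, up to a constant, the peaking function minus
    c / 2 |z - z p|^2: half of \<open>c\<close> buys strictness, the other half remains as the
    positive coefficient in the peak of \<open>s n\<close>.\<close>
  define h' where "h' w = h w + of_real c * inner_to N (z p) w" for w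
  have h': "holo_on N (Cpts N) h'" unfolding h'_def[abs_def]
    by (intro holo_on_add holo_on_mult holo_on_const holo_on_inner_to h order_refl)
  define T where "T x = Re (h' (z x)) + c / 2 * nsq N (z x)" for x
  have T_diff: "T x - T p = (Re (h (z x)) + c * nsq N (z x)) - (Re (h (z p)) + c * nsq N (z p))
      - c / 2 * nsq N (\<lambda>i. z x i - z p i)" for x
    unfolding nsq_diff T_def h'_def by (simp add: field_simps)
  have contT: "continuous_map (subtopology X E) euclidean T"
  proof -
    have "continuous_on (Cpts N) (\<lambda>w. Re (h' w) + c / 2 * nsq N w)"
      using h' by (intro continuous_intros continuous_on_nsq) (simp add: holo_on_iff)
    then show ?thesis unfolding T_def by (rule continuous_compose[OF _ E(2)])
  qed
  have fE: "continuous_map (subtopology X E) euclidean f"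
    and sE: "continuous_map (subtopology X E) euclidean (s n)" for n
    using f s continuous_map_from_subtopology_mono E(1) by blast+
  have strict: "(cmod (f x))\<^sup>2 + T x < (cmod (f p))\<^sup>2 + T p" if x: "x \<in> E" "x \<noteq> p" for x
  proof -
    have xE: "x \<in> \<omega>" "x \<in> W" using x E by auto
    then have "0 < nsq N (\<lambda>i. z x i - z p i)" using nsq_diff_pos x(2) W by blast
    then have "0 < c / 2 * nsq N (\<lambda>i. z x i - z p i)" using h(2) by simp
    then show ?thesis using le[OF xE(2)] T_diff[of x] by linarith
  qed
  have EA: "E \<subseteq> A" using E(1) openin_subset[OF U] by auto
  have pE: "p \<in> E" using D by auto
  \<comment> \<open>Strictness on the compact set \<open>E - D\<close> gives a gap below the value
    at \<open>p\<close>.\<close>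
  obtain m where m: "m < (cmod (f p))\<^sup>2 + T p" "\<And>x. x \<in> E - D \<Longrightarrow> (cmod (f x))\<^sup>2 + T x \<le> m"
  proof (cases "E - D = {}")
    case True
    then show ?thesis using that[of "(cmod (f p))\<^sup>2 + T p - 1"] by auto
  next
    case False
    have "continuous_map (subtopology X (E - D)) euclidean (\<lambda>x. (cmod (f x))\<^sup>2 + T x)"
      by (rule continuous_map_from_subtopology_mono[OF continuous_map_cmod_square_plus[OF fE contT]]) auto
    then obtain y where y: "y \<in> E - D" "\<And>x. x \<in> E - D \<Longrightarrow> (cmod (f x))\<^sup>2 + T x \<le> (cmod (f y))\<^sup>2 + T y"
      using compactin_attains_sup[OF compactin_diff_open[OF E(3) D(1) EA] False] by blast
    then show ?thesis using that strict[of y] D by blast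
  qed
  obtain y0 where "\<And>x. x \<in> E \<Longrightarrow> cmod (f x) \<le> cmod (f y0)"
    using compactin_attains_sup[OF E(3) _ continuous_map_norm[OF fE]] pE by blast
  moreover have "uniform_limit E s f sequentially" using lim E by auto
  \<comment> \<open>Half the gap, as the approximation error enters twice, at \<open>y\<close> and
    at \<open>p\<close>.\<close>
  moreover have "0 < ((cmod (f p))\<^sup>2 + T p - m) / 2" using m(1) by simp
  ultimately have "\<forall>\<^sub>F n in sequentially. \<forall>x\<in>E. \<bar>(cmod (s n x))\<^sup>2 - (cmod (f x))\<^sup>2\<bar>
      < ((cmod (f p))\<^sup>2 + T p - m) / 2"
    by (intro uniform_limit_cmod_square[where B = "cmod (f y0)"]) auto
  then obtain n where n: "\<And>x. x \<in> E \<Longrightarrow> \<bar>(cmod (s n x))\<^sup>2 - (cmod (f x))\<^sup>2\<bar>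
      < ((cmod (f p))\<^sup>2 + T p - m) / 2"
    unfolding eventually_sequentially by blast
  obtain y where y: "y \<in> E" "\<And>x. x \<in> E \<Longrightarrow> (cmod (s n x))\<^sup>2 + T x \<le> (cmod (s n y))\<^sup>2 + T y"
    using compactin_attains_sup[OF E(3) _ continuous_map_cmod_square_plus[OF sE contT]] pE by blast
  \<comment> \<open>This turns the maximum over the compact set \<open>E\<close> into one over the
    open set \<open>D\<close>, as a local peak demands.\<close>
  have "y \<in> D"
  proof (rule ccontr)
    assume "y \<notin> D"
    then have "(cmod (f y))\<^sup>2 + T y \<le> m" using m(2) y by blast
    then show False
      using n[OF y(1), unfolded abs_less_iff] n[OF pE, unfolded abs_less_iff] y(2)[OF pE] by argo
  qed
  have "local_peak X \<O> A (s n) y"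
    by (rule local_peakI[OF emb h' _ D(1) \<open>y \<in> D\<close>, of "c / 2"])
      (use h(2) D E y(2) in \<open>auto simp: T_def\<close>)
  then show ?thesis using that y(1) E by blast
qed

lemma germ_closure_peakless:
  assumes lc: "locally_closed_in X A"
  shows "germ_closure X A (peakless_germs X \<O> A) \<subseteq> peakless_germs X \<O> A"
proof
  fix \<gamma> assume "\<gamma> \<in> germ_closure X A (peakless_germs X \<O> A)"
  then obtain x f U s where \<gamma>: "\<gamma> = germ X A x f"
    and U: "openin (subtopology X A) U" "x \<in> U"
    and f: "continuous_map (subtopology X U) euclidean f"
    and s: "\<forall>n::nat. s n \<in> germ_sections X A (peakless_germs X \<O> A) U"
    and lim: "\<forall>K. compactin X K \<and> K \<subseteq> U \<longrightarrow> uniform_limit K s f sequentially"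
    unfolding germ_closure_def by blast
  have "\<not> local_peak X \<O> A f p" if p: "p \<in> U" for p
  proof
    assume peak: "local_peak X \<O> A f p"
    have s': "continuous_map (subtopology X U) euclidean (s n)" for n
      using s by (simp add: germ_sections_def)
    obtain n y where "y \<in> U" "local_peak X \<O> A (s n) y"
      by (rule limit_peak[OF lc U(1) f s' _ p peak]) (use lim in auto)
    moreover have "germ X A y (s n) \<in> peakless_germs X \<O> A"
      using s \<open>y \<in> U\<close> by (simp add: germ_sections_def)
    ultimately show False using peakless_germsD[OF _ U(1)] by blast
  qed
  then show "\<gamma> \<in> peakless_germs X \<O> A"
    unfolding \<gamma> by (intro peakless_germsI[OF U f])
qed

text \<open>The peakless germs form one of the sets intersected in \<open>germ_hull\<close>;
  minimality of the hull replaces an induction over the stages.\<close>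

lemma LACR_peakless:
  assumes "subsheaf_of_continuous X \<O>" "locally_closed_in X A"
    "\<And>p. p \<in> A \<Longrightarrow> \<not> local_peak X \<O> A (\<lambda>_. 0) p"
  shows "LACR X \<O> A \<subseteq> peakless_germs X \<O> A"
  unfolding LACR_def germ_hull_def
  by (intro Inter_lower CollectI conjI peakless_germs_continuous
      holomorphic_germs_peakless[OF assms(1,3)] germ_closure_peakless[OF assms(2)])

section \<open>From absence of peaks to the maximum principle\<close>

lemma strictly_psh_chart:
  assumes "strictly_psh_function X \<O> \<rho>" "x \<in> topspace X"
  obtains \<omega> N U Z z \<psi> where "x \<in> \<omega>" "local_embedding X \<O> \<omega> N U Z z"
    "strictly_psh_on N U \<psi>" "\<forall>y\<in>\<omega>. \<rho> y = \<psi> (z y)"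
proof -
  from bspec[OF assms(1)[unfolded strictly_psh_function_def] assms(2)]
  show ?thesis by (elim exE conjE) (rule that)
qed

lemma strictly_psh_continuous:
  assumes "strictly_psh_function X \<O> \<rho>"
  shows "continuous_map X euclidean \<rho>"
  unfolding continuous_map_def
proof (intro conjI allI impI)
  fix V :: "real set" assume V: "openin euclidean V"
  show "openin X {x \<in> topspace X. \<rho> x \<in> V}"
  proof (subst openin_subopen, intro ballI)
    fix x assume x: "x \<in> {x \<in> topspace X. \<rho> x \<in> V}"
    then have "x \<in> topspace X" by blast
    then obtain \<omega> N U Z z \<psi> where x\<omega>: "x \<in> \<omega>" and emb: "local_embedding X \<O> \<omega> N U Z z"
      and \<psi>: "strictly_psh_on N U \<psi>" "\<forall>y\<in>\<omega>. \<rho> y = \<psi> (z y)"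
      by (rule strictly_psh_chart[OF assms])
    interpret chart X \<O> \<omega> N U Z z by (rule chart_of[OF emb])
    have "continuous_map (subtopology (Cspace N) U) euclidean \<psi>"
      using \<psi>(1) by (simp add: strictly_psh_on_def numeral_2_eq_2)
    moreover have "continuous_map (subtopology X \<omega>) (subtopology (Cspace N) U) z"
      using continuous in_ambient by (auto simp: continuous_map_in_subtopology)
    ultimately have "continuous_map (subtopology X \<omega>) euclidean (\<psi> \<circ> z)"
      using continuous_map_compose by blast
    then have "openin (subtopology X \<omega>) {y \<in> topspace (subtopology X \<omega>). (\<psi> \<circ> z) y \<in> V}"
      using V by (intro openin_continuous_map_preimage)
    then have "openin X {y \<in> \<omega>. \<psi> (z y) \<in> V}"
      unfolding topspace_domain o_def using openin_trans_full open_domain by blast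
    moreover have "{y \<in> \<omega>. \<psi> (z y) \<in> V} \<subseteq> {x \<in> topspace X. \<rho> x \<in> V}"
      using \<psi>(2) openin_subset[OF open_domain] by auto
    moreover have "x \<in> {y \<in> \<omega>. \<psi> (z y) \<in> V}" using x x\<omega> \<psi>(2) by auto
    ultimately show "\<exists>T. openin X T \<and> x \<in> T \<and> T \<subseteq> {x \<in> topspace X. \<rho> x \<in> V}" by blast
  qed
qed simp

lemma strictly_psh_peak:
  assumes \<rho>: "strictly_psh_function X \<O> \<rho>" and e: "e > 0"
    and D: "openin (subtopology X A) D" "p \<in> D"
    and le: "\<And>x. x \<in> D \<Longrightarrow> (cmod (u x))\<^sup>2 + e * \<rho> x \<le> (cmod (u p))\<^sup>2 + e * \<rho> p"
  shows "local_peak X \<O> A u p"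
proof -
  have "p \<in> topspace X" using D openin_subset[OF D(1)] by auto
  then obtain \<omega> N U Z z \<psi> where p: "p \<in> \<omega>" and emb: "local_embedding X \<O> \<omega> N U Z z"
    and \<psi>: "strictly_psh_on N U \<psi>" "\<forall>y\<in>\<omega>. \<rho> y = \<psi> (z y)"
    by (rule strictly_psh_chart[OF \<rho>])
  interpret chart X \<O> \<omega> N U Z z by (rule chart_of[OF emb])
  have C2: "Ck_on 2 N U \<psi>" using \<psi>(1) by (simp add: strictly_psh_on_def)
  have "0 < Re (hform N (complex_hessian N \<psi> (z p)) w w)" if "\<exists>i<N. w i \<noteq> 0" for w
    using \<psi>(1) in_ambient[OF p] that unfolding strictly_psh_on_def hform_def by blast
  then obtain c where c: "c > 0" "\<And>w. c * nsq N w \<le> Re (hform N (complex_hessian N \<psi> (z p)) w w)"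
    using pos_form_bound[of N "complex_hessian N \<psi> (z p)"] by blast
  have le': "(cmod (u x))\<^sup>2 + e * \<psi> (z x) \<le> (cmod (u p))\<^sup>2 + e * \<psi> (z p)" if "x \<in> \<omega> \<inter> A \<inter> D" for x
    using le[of x] that p \<psi>(2) by simp
  show ?thesis
    by (rule levi_peak[where z = z and p = p, OF emb open_ambient in_ambient[OF p] C2 c e, where W = "\<omega> \<inter> A \<inter> D"])
      (use D p le' openin_subset[OF D(1)] open_domain in
        \<open>auto intro!: openin_Int openin_subtopology_Int\<close>)
qed

lemma maximum_principle_peakless:
  assumes \<rho>: "strictly_psh_function X \<O> \<rho>" and H: "H \<subseteq> peakless_germs X \<O> A"
  shows "maximum_principle X A H"
  unfolding maximum_principle_def
proof (intro allI impI)
  fix D u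
  let ?K = "(subtopology X A) closure_of D" and ?F = "(subtopology X A) frontier_of D"
  assume asm: "rel_compact_domain X A D \<and> u \<in> germ_sections X A H D \<and>
    continuous_map (subtopology X ?K) euclidean u"
  then have D: "openin (subtopology X A) D" "D \<noteq> {}"
    and K: "compactin X ?K" and KA: "?K \<subseteq> A"
    and u: "\<And>x. x \<in> D \<Longrightarrow> germ X A x u \<in> H" "continuous_map (subtopology X ?K) euclidean u"
    by (auto simp: rel_compact_domain_def germ_sections_def compactin_subtopology)
  have DK: "D \<subseteq> ?K" by (intro closure_of_subset openin_subset[OF D(1)])
  have F: "?F = ?K - D" using D(1) by (simp add: frontier_of_def interior_of_openin)
  have nopeak: "\<not> local_peak X \<O> A u x" if "x \<in> D" for x
    using peakless_germsD[OF subsetD[OF H u(1)[OF that]] D(1) that] .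
  obtain p0 where p0: "p0 \<in> ?K" "\<And>x. x \<in> ?K \<Longrightarrow> cmod (u x) \<le> cmod (u p0)"
    using compactin_attains_sup[OF K _ continuous_map_norm[OF u(2)]] D(2) DK by blast
  have "\<exists>q\<in>?F. cmod (u q) = cmod (u p0)"
  proof (rule ccontr)
    assume no: "\<not> (\<exists>q\<in>?F. cmod (u q) = cmod (u p0))"
    have less: "cmod (u q) < cmod (u p0)" if "q \<in> ?F" for q
      using no p0(2)[of q] that F by (metis DiffD1 order_le_imp_less_or_eq)
    have p0D: "p0 \<in> D" using p0(1) less[of p0] F by blast
    have FK: "compactin X ?F" unfolding F by (rule compactin_diff_open[OF K D(1) KA])
    have rK: "continuous_map (subtopology X ?K) euclidean \<rho>"
      by (rule continuous_map_from_subtopology[OF strictly_psh_continuous[OF \<rho>]])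
    \<comment> \<open>An empty frontier is included: the contradiction below then shows that the
      frontier is not empty, as the existence of its maximum requires.\<close>
    consider m where "0 \<le> m" "m < cmod (u p0)" "\<And>x. x \<in> ?F \<Longrightarrow> cmod (u x) \<le> m" | "?F = {}"
    proof (cases "?F = {}")
      case False
      have "continuous_map (subtopology X ?F) euclidean (\<lambda>x. cmod (u x))"
        by (rule continuous_map_from_subtopology_mono[OF continuous_map_norm[OF u(2)]]) (simp add: F)
      then obtain q where "q \<in> ?F" "\<And>x. x \<in> ?F \<Longrightarrow> cmod (u x) \<le> cmod (u q)"
        using compactin_attains_sup[OF FK False] by blast
      then show ?thesis using that(1)[of "cmod (u q)"] less by auto
    qed
    then obtain e where e: "e > 0" "\<And>x. x \<in> ?F \<Longrightarrow> (cmod (u x))\<^sup>2 + e * \<rho> x < (cmod (u p0))\<^sup>2 + e * \<rho> p0"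
    proof cases
      case 1
      obtain y where y: "\<And>x. x \<in> ?K \<Longrightarrow> \<rho> x \<le> \<rho> y"
        using compactin_attains_sup[OF K _ rK] p0(1) by blast
      have "0 < (cmod (u p0))\<^sup>2 - m\<^sup>2" using 1 by (simp add: power_strict_mono)
      \<comment> \<open>Scaled so that e (\<rho> x - \<rho> p0) stays below the gap between |u p0|^2
        and m^2; the 1 keeps the denominator positive.\<close>
      define b where "b = \<rho> y - \<rho> p0 + 1"
      have b: "b > 0" using y[OF p0(1)] by (simp add: b_def)
      define e where "e = ((cmod (u p0))\<^sup>2 - m\<^sup>2) / b"
      have "e > 0" using b \<open>0 < (cmod (u p0))\<^sup>2 - m\<^sup>2\<close> by (simp add: e_def)
      moreover have "(cmod (u x))\<^sup>2 + e * \<rho> x < (cmod (u p0))\<^sup>2 + e * \<rho> p0" if x: "x \<in> ?F" for x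
      proof -
        have "e * (\<rho> x - \<rho> p0) < e * b"
          using y[of x] x F \<open>e > 0\<close> by (intro mult_strict_left_mono) (auto simp: b_def)
        also have "e * b = (cmod (u p0))\<^sup>2 - m\<^sup>2" using b by (simp add: e_def)
        moreover have "(cmod (u x))\<^sup>2 \<le> m\<^sup>2" using 1 x by (intro power_mono) auto
        ultimately show ?thesis by (simp add: algebra_simps)
      qed
      ultimately show ?thesis by (rule that)
    next
      case 2
      then show ?thesis using that[of 1] by simp
    qed
    have "continuous_map (subtopology X ?K) euclidean (\<lambda>x. (cmod (u x))\<^sup>2 + e * \<rho> x)"
      by (intro continuous_map_cmod_square_plus u(2) continuous_map_real_mult_left rK)
    then obtain p where p: "p \<in> ?K" "\<And>x. x \<in> ?K \<Longrightarrow> (cmod (u x))\<^sup>2 + e * \<rho> x \<le> (cmod (u p))\<^sup>2 + e * \<rho> p"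
      using compactin_attains_sup[OF K] p0(1) by blast
    \<comment> \<open>The perturbed function is smaller on the frontier than at \<open>p0\<close>,
      so its maximum over the closure lies in \<open>D\<close>.\<close>
    have "p \<in> D" using p e(2)[of p] p0(1) F by (metis DiffI not_less)
    then have "local_peak X \<O> A u p"
      using strictly_psh_peak[OF \<rho> e(1) D(1), of p u] p(2) DK by blast
    then show False using nopeak \<open>p \<in> D\<close> by blast
  qed
  then show "\<exists>m. is_max_on (\<lambda>p. cmod (u p)) ?K m \<and> is_max_on (\<lambda>p. cmod (u p)) ?F m"
    unfolding is_max_on_def using p0 F by (intro exI[of _ "cmod (u p0)"]) auto
qed

text \<open>
  Conversely, a peak of the zero function at \<open>p\<close> makes \<open>exp g\<close> a holomorphic peak function at \<open>p\<close>,
  where \<open>Re g\<close> is the peaking function minus a multiple of \<open>|z - z p|\<^sup>2\<close>.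
\<close>

lemma peak_violates_maximum_principle:
  assumes haus: "Hausdorff_space X" and lc: "locally_closed_in X A"
    and H: "holomorphic_germs X \<O> A \<subseteq> H"
    and peak: "local_peak X \<O> A (\<lambda>_. 0) p"
  shows "\<not> maximum_principle X A H"
proof
  assume mp: "maximum_principle X A H"
  obtain \<omega> N U Z z h c W where emb: "local_embedding X \<O> \<omega> N U Z z"
    and h: "holo_on N (Cpts N) h" "0 < c"
    and W: "openin (subtopology X A) W" "p \<in> W" "W \<subseteq> \<omega>"
    and le: "\<And>x. x \<in> W \<Longrightarrow> Re (h (z x)) + c * nsq N (z x) \<le> Re (h (z p)) + c * nsq N (z p)"
    using peak unfolding local_peak_def by auto
  interpret chart X \<O> \<omega> N U Z z by (rule chart_of[OF emb])
  have p\<omega>: "p \<in> \<omega>" using W by auto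
  obtain D E where D: "openin (subtopology X A) D" "p \<in> D" "D \<subseteq> E"
    and E: "E \<subseteq> W" "E \<subseteq> \<omega>" "compactin X E"
    using compact_neighbourhood[OF lc W(1,2) p\<omega>] by blast
  have EA: "E \<subseteq> A" using E(1) openin_subset[OF W(1)] by auto
  \<comment> \<open>Compact sets are closed in a Hausdorff space, so the closure of \<open>D\<close>
    stays in \<open>E\<close>, where the estimate on \<open>u\<close> holds.\<close>
  have "closedin (subtopology X A) E"
    using compactin_imp_closedin[OF haus E(3)] EA by (simp add: closedin_subset_topspace)
  then have KE: "(subtopology X A) closure_of D \<subseteq> E" using D(3) by (simp add: closure_of_minimal)
  have "compactin (subtopology X A) E" using E(3) EA by (simp add: compactin_subtopology)
  then have "compactin (subtopology X A) ((subtopology X A) closure_of D)"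
    by (rule closed_compactin[OF _ KE closedin_closure_of])
  then have dom: "rel_compact_domain X A D" using D by (auto simp: rel_compact_domain_def)
  \<comment> \<open>Subtracting the full c |z - z p|^2 from the peaking function cancels c |z|^2 and
    leaves, up to a constant, the real part of a holomorphic function; hence the factor 2 c.\<close>
  define k where "k w = h w + of_real (2 * c) * inner_to N (z p) w" for w
  have k: "holo_on N (Cpts N) k" unfolding k_def[abs_def]
    by (intro holo_on_add holo_on_mult holo_on_const holo_on_inner_to h order_refl)
  \<comment> \<open>Normalised to have modulus 1 at \<open>p\<close>.\<close>
  define g where "g w = exp (k w + (- k (z p)))" for w
  have g: "holo_on N (Cpts N) g" unfolding g_def[abs_def]
    by (intro holo_on_exp holo_on_add holo_on_const k order_refl)
  define u where "u x = g (z x)" for x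
  have k_diff: "Re (k (z x)) - Re (k (z p)) =
      (Re (h (z x)) + c * nsq N (z x)) - (Re (h (z p)) + c * nsq N (z p))
      - c * nsq N (\<lambda>i. z x i - z p i)" for x
    unfolding nsq_diff k_def by (simp add: algebra_simps)
  have up: "cmod (u p) = 1" by (simp add: u_def g_def)
  have strict: "cmod (u x) < 1" if x: "x \<in> E" "x \<noteq> p" for x
  proof -
    have xE: "x \<in> \<omega>" "x \<in> W" using x E by auto
    then have "0 < nsq N (\<lambda>i. z x i - z p i)" using nsq_diff_pos x(2) W by blast
    then have "0 < c * nsq N (\<lambda>i. z x i - z p i)" using h(2) by simp
    then have "Re (k (z x)) - Re (k (z p)) < 0" using le[OF xE(2)] k_diff[of x] by linarith
    then show ?thesis by (simp add: u_def g_def)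
  qed
  have cont: "continuous_map (subtopology X \<omega>) euclidean u"
    unfolding u_def using g by (intro continuous_compose) (auto simp: holo_on_iff)
  have "g \<in> model_sections N (z ` \<omega>)"
    unfolding model_sections_def using g in_Cpts openin_topspace[of "Cspace N"]
    by (auto intro!: exI[of _ "Cpts N"] exI[of _ g])
  then have "u \<in> \<O> \<omega>"
    using emb open_domain unfolding local_embedding_def u_def by blast
  then have "germ X A x u \<in> H" if "x \<in> D" for x
    using that H D(3) EA E(2) open_domain unfolding holomorphic_germs_def by blast
  moreover have "continuous_map (subtopology X D) euclidean u"
    using cont D(3) E(2) by (blast intro: continuous_map_from_subtopology_mono)
  moreover have "continuous_map (subtopology X ((subtopology X A) closure_of D)) euclidean u"
    using cont KE E(2) by (blast intro: continuous_map_from_subtopology_mono)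
  ultimately obtain m where m: "is_max_on (\<lambda>p. cmod (u p)) ((subtopology X A) closure_of D) m"
     "is_max_on (\<lambda>p. cmod (u p)) ((subtopology X A) frontier_of D) m"
    using mp dom unfolding maximum_principle_def germ_sections_def by blast
  obtain q where q: "q \<in> (subtopology X A) frontier_of D" "cmod (u q) = m"
    using m(2) unfolding is_max_on_def by blast
  \<comment> \<open>As \<open>D\<close> is open, its frontier misses \<open>p\<close>; so the
    frontier maximum is below 1, while the closure maximum is at least 1.\<close>
  have "q \<in> E" "q \<noteq> p"
    using q(1) KE D(1,2) by (auto simp: frontier_of_def interior_of_openin)
  then have "m < 1" using strict q(2) by blast
  moreover have "p \<in> (subtopology X A) closure_of D"
    using D(2) closure_of_subset[OF openin_subset[OF D(1)]] by blast
  then have "1 \<le> m" using m(1) up unfolding is_max_on_def by force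
  ultimately show False by simp
qed

section \<open>Holomorphic germs inside the LACR stages, and the conclusion\<close>

lemma holomorphic_germs_closure:
  assumes sheaf: "subsheaf_of_continuous X \<O>" and H: "holomorphic_germs X \<O> A \<subseteq> H"
  shows "holomorphic_germs X \<O> A \<subseteq> germ_closure X A H"
proof
  fix \<gamma> assume "\<gamma> \<in> holomorphic_germs X \<O> A"
  then obtain x F V where F: "\<gamma> = germ X A x F" "x \<in> A" "openin X V" "x \<in> V" "F \<in> \<O> V"
    unfolding holomorphic_germs_def by blast
  have "continuous_map (subtopology X V) euclidean F"
    by (rule section_continuous[OF sheaf F(3,5)])
  then have cont: "continuous_map (subtopology X (V \<inter> A)) euclidean F"
    by (rule continuous_map_from_subtopology_mono) auto
  have "germ X A y F \<in> H" if "y \<in> V \<inter> A" for y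
    using that H F unfolding holomorphic_germs_def by blast
  then have "F \<in> germ_sections X A H (V \<inter> A)" using cont by (simp add: germ_sections_def)
  \<comment> \<open>A constant sequence serves as the approximation.\<close>
  moreover have "uniform_limit K (\<lambda>n::nat. F) F sequentially" for K
    by (simp add: uniform_limit_iff)
  ultimately show "\<gamma> \<in> germ_closure X A H"
    unfolding germ_closure_def F(1) using F cont openin_subtopology_Int[OF F(3), of A]
    by (intro CollectI exI[of _ x] exI[of _ F] exI[of _ "V \<inter> A"] exI[of _ "\<lambda>n. F"]) auto
qed

lemma holomorphic_germs_LACR: "holomorphic_germs X \<O> A \<subseteq> LACR X \<O> A"
  unfolding LACR_def germ_hull_def by blast

text \<open>The least element of a nonempty \<open>Field r\<close> has no predecessors, so its stage
  is the set of holomorphic germs; the union contains it and the closure preserves it.\<close>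

lemma holomorphic_germs_LACR_stage:
  assumes sheaf: "subsheaf_of_continuous X \<O>" and r: "Well_order r"
  shows "holomorphic_germs X \<O> A \<subseteq> LACR_stage X \<O> A r"
proof (cases "Field r = {}")
  case True
  then show ?thesis by (simp add: LACR_stage_def)
next
  case False
  have "wf (r - Id)" using r by (simp add: well_order_on_def)
  then obtain x where x: "x \<in> Field r" "\<And>y. (y, x) \<in> r - Id \<Longrightarrow> y \<notin> Field r"
    using wfE_min[of "r - Id" _ "Field r"] False by (metis ex_in_conv)
  then have "underS r x = {}" by (auto simp: underS_def Field_def)
  then have "LACR_below X \<O> A r x = holomorphic_germs X \<O> A"
    by (simp add: LACR_below_unfold[OF r])
  then have "holomorphic_germs X \<O> A \<subseteq> (\<Union>x\<in>Field r. LACR_below X \<O> A r x)" using x(1) by blast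
  then show ?thesis
    using False holomorphic_germs_closure[OF sheaf] by (simp add: LACR_stage_def)
qed

theorem theorem3p7:
  fixes X :: "'a topology" and \<O> :: "'a structure_sheaf"
    and A :: "'a set" and \<rho> :: "'a \<Rightarrow> real"
  assumes "reduced_complex_space X \<O>"
    and "pure_dimensional X \<O>"
    and "locally_closed_in X A"
    and "strictly_psh_function X \<O> \<rho>"
  shows "(set_weakly_q_pseudoconcave X \<O> 1 A \<longleftrightarrow> maximum_principle X A (LACR X \<O> A)) \<and>
    (set_weakly_q_pseudoconcave X \<O> 1 A \<longleftrightarrow>
      (\<exists>\<alpha> :: 'o rel. Well_order \<alpha> \<and> maximum_principle X A (LACR_stage X \<O> A \<alpha>)))"
proof -
  have haus: "Hausdorff_space X" and sheaf: "subsheaf_of_continuous X \<O>"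
    using assms(1) by (auto simp: reduced_complex_space_def)
  have pc: "set_weakly_q_pseudoconcave X \<O> 1 A \<longleftrightarrow> (\<forall>p\<in>A. \<not> local_peak X \<O> A (\<lambda>_. 0) p)"
    unfolding set_weakly_q_pseudoconcave_def using pseudoconvex_iff_local_peak[of _ A X \<O>] by simp
  \<comment> \<open>Each half holds for a whole range of germ classes: one containing the
    holomorphic germs detects every pseudoconvex point, and one inside the LACR germs obeys the
    principle if there is no such point.\<close>
  have concave: "set_weakly_q_pseudoconcave X \<O> 1 A"
    if "maximum_principle X A H" "holomorphic_germs X \<O> A \<subseteq> H" for H
    using peak_violates_maximum_principle[OF haus assms(3) that(2)] that(1) unfolding pc by blast
  have mp: "maximum_principle X A H"
    if "set_weakly_q_pseudoconcave X \<O> 1 A" "H \<subseteq> LACR X \<O> A" for H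
    using maximum_principle_peakless[OF assms(4)] LACR_peakless[OF sheaf assms(3)] that
    unfolding pc by (meson order_trans)
  \<comment> \<open>The empty relation is the ordinal 0, available on every type. Its stage is the
    class of holomorphic germs, so \<alpha> = 0 is the witness for c).\<close>
  have empty: "Well_order ({} :: 'o rel)" "LACR_stage X \<O> A ({} :: 'o rel) = holomorphic_germs X \<O> A"
    by (simp_all add: LACR_stage_def)
  show ?thesis
    using concave mp holomorphic_germs_LACR[of X \<O> A] holomorphic_germs_LACR_stage[OF sheaf, of _ A] empty
    by (metis order_refl)
qed

end
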